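(* Every $C_4$-free $1$-planar graph with $n\ge 4$ vertices has at most $\frac{5}{2}(n-2)$ edges.
   Context: All graphs are finite and simple. A graph is $k$-planar if it admits a drawing in the plane in which every edge is crossed at most $k$ times. A graph is $C_\ell$-free if it contains no cycle of length $\ell$ as a subgraph. *)

theory Defs
  imports "HOL-Analysis.Analysis"
begin

definition simple_graph :: "'a set \<Rightarrow> 'a set set \<Rightarrow> bool" where
  "simple_graph V E \<longleftrightarrow> finite V \<and> (\<forall>e\<in>E. e \<subseteq> V \<and> card e = 2)"

definition C4_free :: "'a set set \<Rightarrow> bool" where
  "C4_free E \<longleftrightarrow> \<not> (\<exists>a b c d. distinct [a, b, c, d] \<and>
      {a, b} \<in> E \<and> {b, c} \<in> E \<and> {c, d} \<in> E \<and> {d, a} \<in> E)"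

definition drawing :: "'a set \<Rightarrow> 'a set set \<Rightarrow> ('a \<Rightarrow> real \<times> real)
    \<Rightarrow> ('a set \<Rightarrow> real \<Rightarrow> real \<times> real) \<Rightarrow> bool" where
  "drawing V E pos \<gamma> \<longleftrightarrow> inj_on pos V \<and>
     (\<forall>e\<in>E. arc (\<gamma> e) \<and> {pathstart (\<gamma> e), pathfinish (\<gamma> e)} = pos ` e \<and>
             path_image (\<gamma> e) \<inter> pos ` V = pos ` e)"

definition crossings :: "'a set \<Rightarrow> 'a set set \<Rightarrow> ('a \<Rightarrow> real \<times> real)
    \<Rightarrow> ('a set \<Rightarrow> real \<Rightarrow> real \<times> real) \<Rightarrow> 'a set \<Rightarrow> ('a set \<times> (real \<times> real)) set" where
  "crossings V E pos \<gamma> e = {(f, p). f \<in> E \<and> f \<noteq> e \<and>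
      p \<in> path_image (\<gamma> e) \<inter> path_image (\<gamma> f) \<and> p \<notin> pos ` V}"

definition k_planar :: "nat \<Rightarrow> 'a set \<Rightarrow> 'a set set \<Rightarrow> bool" where
  "k_planar k V E \<longleftrightarrow> (\<exists>pos \<gamma>. drawing V E pos \<gamma> \<and>
      (\<forall>e\<in>E. finite (crossings V E pos \<gamma> e) \<and> card (crossings V E pos \<gamma> e) \<le> k))"

end

(* A minimal counterexample is 3-edge-connected, because two smaller bounds survive being joined by at
   most two edges.  Planarise a 3-edge-connected drawing: a crossing of two disjoint edges becomes a
   vertex of degree 4, while a crossing of two edges ab, ac with a common end a is absorbed by a: the
   segment of one of them from a to the crossing point is added to a, which becomes a fat vertex.  In
   the resulting plane graph every edge is on the boundary of exactly two faces, two faces share at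
   most one edge and no face boundary has a leaf, so no rotation system is needed, and
   |F| >= m0 + 3 c - n + 2, where m0 counts the edges that are not in a crossing of disjoint edges and
   c counts these crossings.  Discharging gives 5 |F| <= 3 m0 + 11 c when the graph has no 4-cycle:
   every face collects charge at least 40, an edge gives at most 24 and a crossing at most 88.
   Since m = m0 + 2 c, this yields 2 m <= 5 (n - 2). *)

theory Submission
  imports Defs
begin

section \<open>Arcs in the plane\<close>

text \<open>A drawing is purely topological: edges sharing a point off the vertices count as
  crossing even if they only touch, and no cyclic order of arcs around a point is available. So
  incidence of edges and faces is read off from how faces merge when an edge is deleted, and its
  properties rest on the Jordan curve theorem and Janiszewski's theorem. 3-edge-connectivity makes
  this work: without any two edges the drawing is still connected, so a deleted edge can be closed
  up to a Jordan curve that avoids the other one. A fat vertex receives only one of the two segments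
  up to a crossing, since both together would enclose a region and the vertex would separate the
  plane. The planarisation has \<open>n + c\<close> vertices and \<open>m0 + 4 * c\<close> edges,
  hence the bound for the faces. The charges \<open>40, 24, 88\<close> are 8 times
  \<open>5, 3, 11\<close>. Even shares would give 12 per side and 22 per corner; only a triangle of
  three sides (36) and a digon of one side and one turn (34) would miss 40, and
  \<open>C4_free\<close> limits how these critical faces crowd around an edge or a crossing.\<close>

definition arc_between :: "complex set \<Rightarrow> complex \<Rightarrow> complex \<Rightarrow> bool" where
  "arc_between T a b \<longleftrightarrow> (\<exists>g. arc g \<and> path_image g = T \<and> pathstart g = a \<and> pathfinish g = b)"

lemma arc_between_sym: "arc_between T a b \<Longrightarrow> arc_between T b a"
  unfolding arc_between_def
  by (metis arc_reversepath path_image_reversepath pathfinish_reversepath pathstart_reversepath)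

lemma arc_between_ends:
  assumes "arc_between T a b"
  shows "a \<in> T" "b \<in> T" "a \<noteq> b"
  using assms unfolding arc_between_def by (auto dest: arc_distinct_ends)

lemma arc_between_topology:
  assumes "arc_between T a b"
  shows "compact T" "closed T" "path_connected T" "connected (- T)"
  using assms unfolding arc_between_def
  by (auto simp: compact_arc_image closed_arc_image path_connected_path_image arc_imp_path connected_arc_complement)

lemma arc_between_interior:
  assumes "arc_between T a b"
  shows "connected (T - {a, b})" "T - {a, b} \<noteq> {}"
proof -
  obtain g where g: "arc g" "path_image g = T" "pathstart g = a" "pathfinish g = b"
    using assms unfolding arc_between_def by blast
  have inj: "inj_on g {0..1}" and cont: "continuous_on {0..1} g"
    using g(1) unfolding arc_def path_def by auto
  have "T - {a, b} = g ` ({0..1} - {0, 1})"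
    using g inj_on_image_set_diff[OF inj, of "{0..1}" "{0,1}"]
    by (auto simp: path_image_def pathstart_def pathfinish_def)
  also have "{0..1::real} - {0, 1} = {0<..<1}" by auto
  finally have eq: "T - {a, b} = g ` {0<..<1}" .
  show "connected (T - {a, b})" unfolding eq
    by (rule connected_continuous_image[OF continuous_on_subset[OF cont]]) auto
  show "T - {a, b} \<noteq> {}" unfolding eq by auto
qed

lemma arc_between_split:
  assumes "arc_between T a b" "p \<in> T" "p \<noteq> a" "p \<noteq> b"
  obtains T1 T2 where "arc_between T1 a p" "arc_between T2 b p" "T1 \<union> T2 = T" "T1 \<inter> T2 = {p}"
proof -
  obtain g where g: "arc g" "path_image g = T" "pathstart g = a" "pathfinish g = b"
    using assms unfolding arc_between_def by blast
  have inj: "inj_on g {0..1}"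
    using g(1) unfolding arc_def by auto
  obtain u where u: "u \<in> {0..1}" "g u = p"
    using assms(2) g(2) unfolding path_image_def by auto
  have g01: "g 0 = a" "g 1 = b"
    using g(3,4) by (auto simp: pathstart_def pathfinish_def)
  have u01: "u \<noteq> 0" "u \<noteq> 1"
    using u assms(3,4) g01 by auto
  have im: "path_image (subpath 0 u g) = g ` {0..u}" "path_image (subpath u 1 g) = g ` {u..1}"
    using u by (auto simp: path_image_subpath)
  have 1: "arc_between (g ` {0..u}) a p"
    unfolding arc_between_def
    using u u01 g(1,2) g01 im by (intro exI[of _ "subpath 0 u g"])
      (auto intro!: arc_subpath_arc)
  have 2: "arc_between (g ` {u..1}) p b"
    unfolding arc_between_def
    using u u01 g(1,2) g01 im by (intro exI[of _ "subpath u 1 g"])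
      (auto intro!: arc_subpath_arc)
  have 3: "g ` {0..u} \<union> g ` {u..1} = T"
  proof -
    have "{0..u} \<union> {u..1} = {0..1}" using u by auto
    then show ?thesis using g(2) unfolding path_image_def by (metis image_Un)
  qed
  have "g ` {0..u} \<inter> g ` {u..1} = g ` ({0..u} \<inter> {u..1})"
    using u by (intro inj_on_image_Int[OF inj, symmetric]) auto
  also have "{0..u} \<inter> {u..1} = {u}" using u by auto
  finally have 4: "g ` {0..u} \<inter> g ` {u..1} = {p}" using u by auto
  show ?thesis using that[OF 1 arc_between_sym[OF 2] 3 4] .
qed

lemma arc_in_path_connected:
  assumes "path_connected S" "a \<in> S" "b \<in> S" "a \<noteq> b"
  obtains B where "arc_between B a b" "B \<subseteq> S"
  using assms unfolding path_connected_arcwise arc_between_def by blast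

text \<open>The two arcs close up to a Jordan curve. That the whole curve is the frontier of both
  sides means that both sides are met near every point of either arc.\<close>

lemma arcs_separate:
  assumes "arc_between A a b" "arc_between B a b" "A \<inter> B = {a, b}"
  obtains P Q where "open P" "open Q" "connected P" "connected Q" "P \<inter> Q = {}"
    "P \<union> Q = - (A \<union> B)" "frontier P = A \<union> B" "frontier Q = A \<union> B"
proof -
  obtain g where g: "arc g" "path_image g = A" "pathstart g = a" "pathfinish g = b"
    using assms unfolding arc_between_def by blast
  obtain h where h: "arc h" "path_image h = B" "pathstart h = b" "pathfinish h = a"
    using arc_between_sym[OF assms(2)] unfolding arc_between_def by blast
  have s: "simple_path (g +++ h)"
    using g h assms(3) by (intro simple_path_join_loop) auto
  have i: "path_image (g +++ h) = A \<union> B"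
    using g h by (simp add: path_image_join)
  have "pathfinish (g +++ h) = pathstart (g +++ h)" using g h by simp
  from Jordan_inside_outside[OF s this]
  show ?thesis unfolding i using that by meson
qed

section \<open>Faces of plane graphs with fat vertices\<close>

lemma connected_in_disjoint_opens:
  assumes "connected C" "open P" "open Q" "P \<inter> Q = {}" "C \<subseteq> P \<union> Q"
  shows "C \<subseteq> P \<or> C \<subseteq> Q"
  using connectedD[OF assms(1-3)] assms(4,5) by blast

text \<open>Path-connected blobs let arcs be routed through vertices, and a connected complement
  makes a blob behave like a point in Janiszewski's theorem. \<open>cross\<close> lets edges meet
  inside blobs, because two absorbed edges end at the same crossing point of a fat vertex.\<close>

locale fat_plane_graph =
  fixes Vs :: "'v set" and Es :: "'v set set"
    and S :: "'v \<Rightarrow> complex set" and I :: "'v set \<Rightarrow> complex set"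
  assumes graph: "simple_graph Vs Es"
    and blob: "\<And>v. v \<in> Vs \<Longrightarrow> compact (S v) \<and> path_connected (S v) \<and> connected (- S v) \<and> S v \<noteq> {}"
    and disj: "\<And>u v. u \<in> Vs \<Longrightarrow> v \<in> Vs \<Longrightarrow> u \<noteq> v \<Longrightarrow> S u \<inter> S v = {}"
    and edge_arc: "\<And>u v. {u, v} \<in> Es \<Longrightarrow>
        \<exists>a b. arc_between (I {u, v}) a b \<and> I {u, v} \<inter> S u = {a} \<and> I {u, v} \<inter> S v = {b}"
    and avoid: "\<And>e w. e \<in> Es \<Longrightarrow> w \<in> Vs \<Longrightarrow> w \<notin> e \<Longrightarrow> I e \<inter> S w = {}"
    and cross: "\<And>e e'. e \<in> Es \<Longrightarrow> e' \<in> Es \<Longrightarrow> e \<noteq> e' \<Longrightarrow> I e \<inter> I e' \<subseteq> \<Union>(S ` Vs)"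
begin

definition B :: "complex set" where "B = \<Union>(S ` Vs)"
definition K :: "'v set set \<Rightarrow> complex set" where "K D = B \<union> \<Union>(I ` D)"
definition Io :: "'v set \<Rightarrow> complex set" where "Io e = I e - B"
definition F :: "'v set set \<Rightarrow> complex set set" where "F D = components (- K D)"
definition U :: "'v set set \<Rightarrow> 'v set \<Rightarrow> complex set" where
  "U D e = connected_component_set (- K D) (SOME z. z \<in> Io e)"
text \<open>An edge lies on the boundary of a face iff deleting the edge merges the face with the
  edge; \<open>U D e\<close> is the face of the edge set \<open>D\<close> into which \<open>e\<close> is drawn.\<close>

definition bd :: "complex set \<Rightarrow> 'v set set" where
  "bd f = {e \<in> Es. f \<subseteq> U (Es - {e}) e}"

lemma finV: "finite Vs" and edge: "e \<in> Es \<Longrightarrow> e \<subseteq> Vs \<and> card e = 2"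
  using graph unfolding simple_graph_def by auto

lemma finE: "finite Es"
  using edge finV by (meson PowI finite_Pow_iff finite_subset subsetI)

lemma edge_cases:
  assumes "e \<in> Es"
  obtains u v a b where "e = {u, v}" "u \<noteq> v" "u \<in> Vs" "v \<in> Vs" "arc_between (I e) a b"
    "I e \<inter> S u = {a}" "I e \<inter> S v = {b}" "I e \<inter> B = {a, b}"
proof -
  obtain u v where uv: "e = {u, v}" "u \<noteq> v" using edge[OF assms] by (auto simp: card_2_iff)
  obtain a b where ab: "arc_between (I e) a b" "I e \<inter> S u = {a}" "I e \<inter> S v = {b}"
    using edge_arc[of u v] assms uv by auto
  have V: "u \<in> Vs" "v \<in> Vs" using edge[OF assms] uv by auto
  have "I e \<inter> B = {a, b}"
  proof
    show "I e \<inter> B \<subseteq> {a, b}" unfolding B_def using avoid[OF assms] ab(2,3) uv by blast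
    show "{a, b} \<subseteq> I e \<inter> B" unfolding B_def using ab(2,3) V by blast
  qed
  then show ?thesis using that uv ab V by blast
qed

lemma Io_props:
  assumes "e \<in> Es"
  shows "connected (Io e)" "Io e \<noteq> {}"
proof -
  obtain a b where "arc_between (I e) a b" "I e \<inter> B = {a, b}" using edge_cases[OF assms] by metis
  moreover from this have "Io e = I e - {a, b}" unfolding Io_def by blast
  ultimately show "connected (Io e)" "Io e \<noteq> {}" using arc_between_interior by auto
qed

lemma compact_I: "e \<in> Es \<Longrightarrow> compact (I e)"
  by (metis edge_cases arc_between_topology(1))

lemma compact_K: "D \<subseteq> Es \<Longrightarrow> compact (K D)"
  unfolding K_def B_def using finV blob compact_I finE
  by (intro compact_Un compact_UN) (auto intro: finite_subset)

lemma closed_K: "D \<subseteq> Es \<Longrightarrow> closed (K D)"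
  using compact_K compact_imp_closed by blast

lemma K_mono: "D \<subseteq> D' \<Longrightarrow> K D \<subseteq> K D'"
  unfolding K_def by auto

lemma K_insert: "K (insert e D) = K D \<union> I e"
  unfolding K_def by auto

lemma I_Int_K:
  assumes "insert e D \<subseteq> Es" "e \<notin> D"
  shows "I e \<inter> K D = I e \<inter> B"
proof -
  have "I e \<inter> I e' \<subseteq> B" if "e' \<in> D" for e'
    using cross[of e e'] that assms unfolding B_def by auto
  then show ?thesis unfolding K_def by blast
qed

lemma Io_K:
  assumes "insert e D \<subseteq> Es" "e \<notin> D"
  shows "Io e \<inter> K D = {}"
  using I_Int_K[OF assms] unfolding Io_def by blast

lemma F_props:
  assumes "D \<subseteq> Es" "f \<in> F D"
  shows "open f" "connected f" "f \<noteq> {}" "f \<inter> K D = {}"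
  using assms closed_K[OF assms(1)] unfolding F_def
  by (auto simp: in_components_connected in_components_nonempty open_Compl dest: in_components_subset
      intro: open_components)

lemma F_eq:
  assumes "f \<in> F D" "g \<in> F D" "f \<inter> g \<noteq> {}"
  shows "f = g"
  using assms unfolding F_def by (metis components_eq)

lemma F_absorb:
  assumes "f \<in> F D" "connected C" "C \<inter> K D = {}" "C \<inter> f \<noteq> {}"
  shows "C \<subseteq> f"
  using assms unfolding F_def by (intro components_maximal[of f "- K D"]) auto

lemma F_exists:
  assumes "z \<notin> K D"
  obtains f where "f \<in> F D" "z \<in> f"
  using assms unfolding F_def by (metis ComplI UnionE Union_components)

lemma F_coarsen:
  assumes "D \<subseteq> D'" "D' \<subseteq> Es" "f \<in> F D'"
  obtains c where "c \<in> F D" "f \<subseteq> c"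
proof -
  obtain z where z: "z \<in> f" using F_props(3)[OF assms(2,3)] by blast
  have fK: "f \<inter> K D = {}" using F_props(4)[OF assms(2,3)] K_mono[OF assms(1)] by blast
  obtain c where "c \<in> F D" "z \<in> c" using F_exists[of z D] fK z by blast
  then show ?thesis using that F_absorb[of c D f] F_props(2)[OF assms(2,3)] fK z by blast
qed

lemma U_props:
  assumes "insert e D \<subseteq> Es" "e \<notin> D"
  shows "U D e \<in> F D" "Io e \<subseteq> U D e"
proof -
  have e: "e \<in> Es" using assms by auto
  let ?z = "SOME z. z \<in> Io e"
  have z: "?z \<in> Io e" using Io_props(2)[OF e] by (metis ex_in_conv someI)
  then have zK: "?z \<in> - K D" using Io_K[OF assms] by blast
  then show 1: "U D e \<in> F D" unfolding U_def F_def by (auto simp: components_def)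
  have "?z \<in> U D e" unfolding U_def using zK by simp
  then show "Io e \<subseteq> U D e"
    using F_absorb[OF 1 Io_props(1)[OF e] Io_K[OF assms]] z by blast
qed

text \<open>Closing \<open>e\<close> up by an arc in the drawing of \<open>D'\<close> gives a Jordan curve. Both of its sides
  meet \<open>U D e\<close> near \<open>e\<close>, and by Janiszewski's theorem each of them contains only one face there.\<close>

lemma edge_sides:
  assumes "insert e D \<subseteq> Es" "e \<notin> D" "D' \<subseteq> D" "path_connected (K D')"
  obtains f g where "f \<noteq> g" "{h \<in> F (insert e D). h \<subseteq> U D e} = {f, g}"
    "\<And>C. connected C \<Longrightarrow> C \<inter> (I e \<union> K D') = {} \<Longrightarrow> C \<inter> f = {} \<or> C \<inter> g = {}"
proof -
  have e: "e \<in> Es" and D: "D \<subseteq> Es" using assms by auto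
  obtain a b where ab: "arc_between (I e) a b" "I e \<inter> B = {a, b}" using edge_cases[OF e] by metis
  have "a \<in> K D'" "b \<in> K D'" using ab unfolding K_def by auto
  then obtain A where A: "arc_between A a b" "A \<subseteq> K D'"
    using arc_in_path_connected[OF assms(4)] arc_between_ends(3)[OF ab(1)] by metis
  have AD: "A \<subseteq> K D" using A(2) K_mono[OF assms(3)] by blast
  have IK: "I e \<inter> K D = {a, b}" using I_Int_K[OF assms(1,2)] ab(2) by simp
  have IA: "I e \<inter> A = {a, b}" using IK AD arc_between_ends[OF A(1)] arc_between_ends[OF ab(1)] by blast
  obtain P Q where PQ: "open P" "open Q" "connected P" "connected Q" "P \<inter> Q = {}"
    "P \<union> Q = - (I e \<union> A)" "frontier P = I e \<union> A" "frontier Q = I e \<union> A"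
    using arcs_separate[OF ab(1) A(1) IA] by metis
  have UF: "U D e \<in> F D" "Io e \<subseteq> U D e" using U_props[OF assms(1,2)] by auto
  note Up = F_props[OF D UF(1)]
  have ins: "insert e D \<subseteq> Es" by (rule assms(1))
  have side: "h \<subseteq> P \<or> h \<subseteq> Q" if "connected h" "h \<inter> (I e \<union> A) = {}" for h
    by (rule connected_in_disjoint_opens) (use that PQ in auto)
  \<comment> \<open>Every point of the open edge is in the frontier of both sides, and
    \<open>U D e\<close> is an open neighbourhood of it, so \<open>U D e\<close> reaches into either
    side.\<close>
  have ex: "\<exists>f. f \<in> F (insert e D) \<and> f \<subseteq> U D e \<and> f \<subseteq> R"
    if R: "R = P \<or> R = Q" for R
  proof -
    obtain z where z: "z \<in> Io e" using Io_props(2)[OF e] by blast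
    then have "z \<in> frontier R" using PQ R unfolding Io_def by auto
    then have "z \<in> closure R" unfolding frontier_def by auto
    moreover have "z \<in> U D e" using UF z by auto
    ultimately obtain p where p: "p \<in> U D e" "p \<in> R"
      using Up(1) by (meson disjoint_iff open_Int_closure_eq_empty)
    have "p \<notin> K D" using p Up by blast
    moreover have "p \<notin> I e" using p PQ R by blast
    ultimately have "p \<notin> K (insert e D)" unfolding K_insert by blast
    then obtain f where f: "f \<in> F (insert e D)" "p \<in> f" using F_exists by blast
    note fp = F_props[OF ins f(1)]
    have "f \<subseteq> U D e" using F_absorb[OF UF(1) fp(2)] fp(4) f p unfolding K_insert by blast
    moreover have "f \<subseteq> R" using side[OF fp(2)] fp(4) AD f p R PQ(5) unfolding K_insert by blast
    ultimately show ?thesis using f by blast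
  qed
  have uniq: "f = h" if R: "R = P \<or> R = Q" and f: "f \<in> F (insert e D)" "f \<subseteq> U D e" "f \<subseteq> R"
    and h: "h \<in> F (insert e D)" "h \<subseteq> U D e" "h \<subseteq> R" for R f h
  proof -
    obtain x y where x: "x \<in> f" and y: "y \<in> h" using F_props(3)[OF ins f(1)] F_props(3)[OF ins h(1)] by blast
    have "connected_component (- (I e \<union> A)) x y"
      unfolding connected_component_def using PQ R x y f h by (intro exI[of _ R]) auto
    moreover have "connected_component (- K D) x y"
      unfolding connected_component_def using Up x y f h by (intro exI[of _ "U D e"]) auto
    \<comment> \<open>Janiszewski's theorem needs the two sets to meet in a connected set; routing
      the closing arc inside \<open>K D\<close> makes this intersection the arc itself.\<close>
    moreover have "(I e \<union> A) \<inter> K D = A" using IK AD IA by blast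
    moreover have "connected A" using arc_between_topology[OF A(1)] path_connected_imp_connected by blast
    moreover have "compact (I e \<union> A)" using arc_between_topology(1) ab(1) A(1) by blast
    ultimately have "connected_component (- (I e \<union> A \<union> K D)) x y"
      using Janiszewski closed_K[OF D] by metis
    moreover have "I e \<union> A \<union> K D = K (insert e D)" using AD unfolding K_insert by blast
    ultimately obtain C where "connected C" "C \<inter> K (insert e D) = {}" "x \<in> C" "y \<in> C"
      unfolding connected_component_def by auto
    then have "y \<in> f" using F_absorb[OF f(1), of C] x by blast
    then show ?thesis using F_eq[OF f(1) h(1)] y by blast
  qed
  obtain f where f: "f \<in> F (insert e D)" "f \<subseteq> U D e" "f \<subseteq> P" using ex[of P] by blast
  obtain g where g: "g \<in> F (insert e D)" "g \<subseteq> U D e" "g \<subseteq> Q" using ex[of Q] by blast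
  have 1: "f \<noteq> g" using f g PQ(5) F_props(3)[OF ins f(1)] by blast
  have 2: "{h \<in> F (insert e D). h \<subseteq> U D e} = {f, g}"
  proof -
    have "h = f \<or> h = g" if h: "h \<in> F (insert e D)" "h \<subseteq> U D e" for h
    proof -
      have "h \<subseteq> P \<or> h \<subseteq> Q" using side[of h] F_props[OF ins h(1)] AD unfolding K_insert by blast
      then show ?thesis using uniq[of P h f] uniq[of Q h g] h f g by blast
    qed
    then show ?thesis using f g by blast
  qed
  have 3: "C \<inter> f = {} \<or> C \<inter> g = {}" if C: "connected C" "C \<inter> (I e \<union> K D') = {}" for C
  proof -
    have "C \<subseteq> P \<or> C \<subseteq> Q" using side[OF C(1)] C(2) A(2) by blast
    then show ?thesis using f(3) g(3) PQ(5) by blast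
  qed
  show ?thesis by (rule that[OF 1 2 3])
qed

text \<open>Sending a new face to the old face that contains it is onto, and it stays onto without
  \<open>g\<close>, because \<open>f\<close> and \<open>g\<close> both go to
  \<open>U D e\<close>.\<close>

lemma F_surj_insert:
  assumes "insert e D \<subseteq> Es" "e \<notin> D" "path_connected (K D)" "finite (F (insert e D))"
  shows "finite (F D) \<and> card (F D) + 1 \<le> card (F (insert e D))"
proof -
  have D: "D \<subseteq> Es" using assms by auto
  obtain f g where fg: "f \<noteq> g" "{h \<in> F (insert e D). h \<subseteq> U D e} = {f, g}"
    using edge_sides[OF assms(1,2) subset_refl assms(3)] by metis
  define \<phi> where "\<phi> h = (SOME c. c \<in> F D \<and> h \<subseteq> c)" for h
  have \<phi>: "\<phi> h \<in> F D \<and> h \<subseteq> \<phi> h" if h: "h \<in> F (insert e D)" for h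
  proof -
    obtain c where "c \<in> F D" "h \<subseteq> c" using F_coarsen[of D "insert e D" h] assms(1) h by blast
    then show ?thesis unfolding \<phi>_def by (metis (mono_tags, lifting) someI)
  qed
  have \<phi>I: "\<phi> h = c" if "h \<in> F (insert e D)" "c \<in> F D" "h \<inter> c \<noteq> {}" for h c
    using \<phi>[OF that(1)] F_eq[of "\<phi> h" D c] that by blast
  have U: "U D e \<in> F D" "Io e \<subseteq> U D e" using U_props[OF assms(1,2)] by auto
  have "F D \<subseteq> \<phi> ` (F (insert e D) - {g})"
  proof
    fix c assume c: "c \<in> F D"
    show "c \<in> \<phi> ` (F (insert e D) - {g})"
    proof (cases "c = U D e")
      case True
      have "f \<in> F (insert e D)" "f \<subseteq> c" using fg True by auto
      then have "\<phi> f = c" using \<phi>I[of f c] c F_props(3)[OF assms(1)] by blast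
      then show ?thesis using \<open>f \<in> _\<close> fg(1) by blast
    next
      case False
      then have "c \<inter> U D e = {}" using F_eq[OF c U(1)] by blast
      moreover obtain z where z: "z \<in> c" using F_props(3)[OF D c] by blast
      moreover have "z \<notin> K D" using z F_props(4)[OF D c] by blast
      ultimately have "z \<notin> K (insert e D)" using U(2) unfolding K_insert Io_def K_def by blast
      then obtain h where h: "h \<in> F (insert e D)" "z \<in> h" using F_exists by blast
      have "\<phi> h = c" using \<phi>I[of h c] h c z by blast
      moreover have "h \<noteq> g" using fg(2) z h \<open>c \<inter> U D e = {}\<close> by blast
      ultimately show ?thesis using h by blast
    qed
  qed
  moreover have "g \<in> F (insert e D)" using fg by auto
  moreover have "card (F (insert e D)) = Suc (card (F (insert e D) - {g}))"
    using assms(4) calculation(2) by (metis card_Suc_Diff1)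
  ultimately show ?thesis using assms(4)
    by (metis Suc_eq_plus1 Suc_le_mono finite_Diff finite_surj surj_card_le)
qed

section \<open>Euler's inequality by deleting edges down to a spanning tree\<close>

lemma path_connected_I: "e \<in> Es \<Longrightarrow> path_connected (I e)"
  by (metis edge_cases arc_between_topology(3))

lemma path_connected_K_mono:
  assumes "path_connected (K T)" "T \<subseteq> D" "D \<subseteq> Es"
  shows "path_connected (K D)"
proof -
  have "path_connected (K (T \<union> D'))" if "finite D'" "D' \<subseteq> Es" for D'
    using that
  proof (induction D' rule: finite_induct)
    case empty
    then show ?case using assms(1) by simp
  next
    case (insert e D')
    have e: "e \<in> Es" using insert by auto
    obtain a b where "I e \<inter> B = {a, b}" using edge_cases[OF e] by metis
    then have "K (T \<union> D') \<inter> I e \<noteq> {}" unfolding K_def by blast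
    moreover have "K (T \<union> insert e D') = K (T \<union> D') \<union> I e" using K_insert[of e "T \<union> D'"] by simp
    ultimately show ?case
      using path_connected_Un[of "K (T \<union> D')" "I e"] insert path_connected_I[OF e] by auto
  qed
  from this[of D] show ?thesis using assms finE by (metis finite_subset sup.absorb2)
qed

text \<open>A spanning tree grown greedily: some edge of \<open>D\<close> leaves the set of blobs
  reached so far, and each such edge adds one blob. Only the edge count and the connectedness are
  recorded.\<close>

lemma spanning_subset:
  assumes "D \<subseteq> Es" "Vs \<noteq> {}"
    and cuts: "\<And>A. A \<noteq> {} \<Longrightarrow> A \<subset> Vs \<Longrightarrow> \<exists>e\<in>D. e \<inter> A \<noteq> {} \<and> e - A \<noteq> {}"
  obtains T where "T \<subseteq> D" "card T < card Vs" "path_connected (K T)"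
proof -
  have "\<exists>W T. W \<subseteq> Vs \<and> card W = Suc k \<and> T \<subseteq> D \<and> card T \<le> k \<and> path_connected (\<Union>(S ` W) \<union> \<Union>(I ` T))"
    if "Suc k \<le> card Vs" for k
    using that
  proof (induction k)
    case 0
    obtain v where "v \<in> Vs" using assms(2) by blast
    then show ?case using blob by (intro exI[of _ "{v}"] exI[of _ "{}"]) auto
  next
    case (Suc k)
    then obtain W T where W: "W \<subseteq> Vs" "card W = Suc k" "T \<subseteq> D" "card T \<le> k"
      "path_connected (\<Union>(S ` W) \<union> \<Union>(I ` T))" by auto
    have fT: "finite T" using W(3) assms(1) finE by (meson finite_subset)
    have fW: "finite W" using W(1) finV finite_subset by blast
    have "W \<noteq> {}" "W \<subset> Vs" using W(1,2) Suc.prems by auto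
    then obtain e where e: "e \<in> D" "e \<inter> W \<noteq> {}" "e - W \<noteq> {}" using cuts by blast
    have eE: "e \<in> Es" using e assms(1) by blast
    obtain u w where uw: "e = {u, w}" "u \<in> W" "w \<notin> W"
    proof -
      obtain p q where "e = {p, q}" using edge[OF eE] by (auto simp: card_2_iff)
      then show ?thesis using e that[of p q] that[of q p] by auto
    qed
    have wV: "w \<in> Vs" using edge[OF eE] uw by auto
    obtain a b where ab: "I e \<inter> S u = {a}" "I e \<inter> S w = {b}" using edge_arc[of u w] eE uw by auto
    have "path_connected ((\<Union>(S ` W) \<union> \<Union>(I ` T)) \<union> I e)"
      by (rule path_connected_Un[OF W(5) path_connected_I[OF eE]]) (use ab uw in auto)
    then have "path_connected (((\<Union>(S ` W) \<union> \<Union>(I ` T)) \<union> I e) \<union> S w)"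
      by (rule path_connected_Un) (use blob[OF wV] ab in auto)
    moreover have "((\<Union>(S ` W) \<union> \<Union>(I ` T)) \<union> I e) \<union> S w = \<Union>(S ` insert w W) \<union> \<Union>(I ` insert e T)"
      by auto
    moreover have "card (insert e T) \<le> Suc k" using W(4) card_insert_le_m1 fT
      by (metis Suc_le_mono card_insert_if le_SucI)
    moreover have "card (insert w W) = Suc (Suc k)" using W(2) uw fW by simp
    ultimately show ?case using W(1,3) wV e(1)
      by (intro exI[of _ "insert w W"] exI[of _ "insert e T"]) auto
  qed
  moreover obtain k where k: "card Vs = Suc k" using assms(2) finV by (metis card_gt_0_iff gr0_implies_Suc)
  ultimately obtain W T where W: "W \<subseteq> Vs" "card W = card Vs" "T \<subseteq> D" "card T \<le> k"
      "path_connected (\<Union>(S ` W) \<union> \<Union>(I ` T))" by (metis order_refl)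
  have "W = Vs" using W(1,2) finV card_subset_eq by blast
  then have "path_connected (K T)" using W unfolding K_def B_def by simp
  then show ?thesis using that W k by auto
qed

text \<open>Deleting an edge outside the tree loses at least one face, and at the tree a face still
  exists because \<open>K T\<close> is bounded. Counting that face from below avoids proving that a
  tree does not separate the plane.\<close>

lemma euler_inequality:
  assumes "Vs \<noteq> {}" "finite (F Es)"
    and cuts: "\<And>A. A \<noteq> {} \<Longrightarrow> A \<subset> Vs \<Longrightarrow> \<exists>e\<in>Es. e \<inter> A \<noteq> {} \<and> e - A \<noteq> {}"
  shows "card Es + 2 \<le> card (F Es) + card Vs"
proof -
  obtain T where T: "T \<subseteq> Es" "card T < card Vs" "path_connected (K T)"
    using spanning_subset[OF subset_refl assms(1) cuts] by metis
  have *: "finite (F D) \<and> card (F D) + n \<le> card (F Es)"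
    if "T \<subseteq> D" "D \<subseteq> Es" "card (Es - D) = n" for n D
    using that
  proof (induction n arbitrary: D)
    case 0
    then have "D = Es" using finE by auto
    then show ?case using assms(2) by simp
  next
    case (Suc n)
    then obtain e where e: "e \<in> Es - D" by (metis card.empty equals0I nat.distinct(1))
    have "card (Es - insert e D) = n" using Suc.prems e finE
      by (metis Diff_insert card_Diff_singleton diff_Suc_1)
    then have 1: "finite (F (insert e D)) \<and> card (F (insert e D)) + n \<le> card (F Es)"
      using Suc.IH[of "insert e D"] Suc.prems e by auto
    have "finite (F D) \<and> card (F D) + 1 \<le> card (F (insert e D))"
      using e Suc.prems 1 path_connected_K_mono[OF T(3), of D] by (intro F_surj_insert) auto
    then show ?case using 1 by auto
  qed
  have "\<not> bounded (- K T)" using compact_K[OF T(1)]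
    by (metis bounded_Un compact_imp_bounded Compl_partition not_bounded_UNIV)
  then have "- K T \<noteq> {}" by (metis bounded_empty)
  then have "F T \<noteq> {}" unfolding F_def by simp
  moreover have c: "finite (F T) \<and> card (F T) + card (Es - T) \<le> card (F Es)" using *[of T] T by auto
  ultimately have "card (F T) \<ge> 1" using card_gt_0_iff[of "F T"] by auto
  moreover have "card (Es - T) = card Es - card T" using T(1) finE
    by (meson card_Diff_subset finite_subset)
  ultimately show ?thesis using c T(2) by linarith
qed

text \<open>Edges off the boundary of a face can be deleted; this reduces the absence of leaves to the
  case where the boundary is the whole graph.\<close>

lemma F_bd:
  assumes "f \<in> F Es"
  shows "f \<in> F (bd f)"
proof -
  have bdE: "bd f \<subseteq> Es" unfolding bd_def by auto
  note fp = F_props[OF subset_refl assms]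
  obtain C where C: "C \<in> F (bd f)" "f \<subseteq> C" using F_coarsen[OF bdE subset_refl assms] by blast
  note Cp = F_props[OF bdE C(1)]
  \<comment> \<open>This makes \<open>f\<close> relatively closed as well as open in the connected
    set \<open>C\<close>. A frontier point of \<open>f\<close> in \<open>C\<close> would lie on an
    open edge \<open>e\<close> outside \<open>bd f\<close>; but the face into which \<open>e\<close>
    is drawn then swallows \<open>f\<close>, so that \<open>e\<close> belongs to
    \<open>bd f\<close>.\<close>
  have "closure f \<inter> C \<subseteq> f"
  proof
    fix z assume z: "z \<in> closure f \<inter> C"
    show "z \<in> f"
    proof (rule ccontr)
      assume zf: "z \<notin> f"
      have "z \<in> K Es"
      proof (rule ccontr)
        assume "z \<notin> K Es"
        then obtain g where g: "g \<in> F Es" "z \<in> g" using F_exists by blast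
        then have "g \<inter> f \<noteq> {}" using z F_props(1)[OF subset_refl g(1)]
          by (metis IntD1 disjoint_iff open_Int_closure_eq_empty)
        then show False using F_eq[OF g(1) assms] g zf by blast
      qed
      moreover have "z \<notin> K (bd f)" using z Cp by blast
      ultimately obtain e where e: "e \<in> Es" "e \<notin> bd f" "z \<in> Io e" unfolding K_def Io_def by blast
      have ins: "insert e (Es - {e}) \<subseteq> Es" "e \<notin> Es - {e}" using e by auto
      note Ue = U_props[OF ins]
      have "U (Es - {e}) e \<inter> f \<noteq> {}"
        using z e Ue F_props(1)[OF _ Ue(1)]
        by (metis Diff_subset IntD1 disjoint_iff open_Int_closure_eq_empty subsetD)
      moreover have "f \<inter> K (Es - {e}) = {}" using fp(4) K_mono[of "Es - {e}" Es] by blast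
      ultimately have "f \<subseteq> U (Es - {e}) e" using F_absorb[OF Ue(1) fp(2)] by blast
      then show False using e unfolding bd_def by blast
    qed
  qed
  then have "C \<subseteq> f \<or> C \<subseteq> - closure f"
    using connected_in_disjoint_opens[OF Cp(2), of f "- closure f"] fp(1) closure_subset[of f] by blast
  then have "C = f" using C(2) fp(3) closure_subset[of f] by blast
  then show ?thesis using C by simp
qed

text \<open>The blobs are added one at a time; an empty intersection is connected, so Janiszewski's
  theorem applies.\<close>

lemma connected_Compl_B: "connected (- B)"
proof -
  have "connected (- \<Union>(S ` W)) \<and> compact (\<Union>(S ` W))" if "finite W" "W \<subseteq> Vs" for W
    using that
  proof (induction W rule: finite_induct)
    case empty
    then show ?case using convex_connected[OF convex_UNIV] by simp
  next
    case (insert w W)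
    have w: "w \<in> Vs" and IH: "connected (- \<Union>(S ` W))" "compact (\<Union>(S ` W))" using insert by auto
    have "S w \<inter> \<Union>(S ` W) = {}"
    proof -
      have "S w \<inter> S x = {}" if "x \<in> W" for x using disj[OF w, of x] that insert by blast
      then show ?thesis by blast
    qed
    then have "connected (- (S w \<union> \<Union>(S ` W)))"
      using blob[OF w] IH compact_imp_closed by (intro Janiszewski_connected) auto
    moreover have "\<Union>(S ` insert w W) = S w \<union> \<Union>(S ` W)" by simp
    ultimately show ?case using blob[OF w] IH by (simp only: compact_Un)
  qed
  from this[of Vs] show ?thesis unfolding B_def using finV by simp
qed

end

section \<open>Face boundaries under 3-edge-connectivity\<close>

locale fat_plane_graph_3conn = fat_plane_graph +
  assumes cuts3: "\<And>A. A \<noteq> {} \<Longrightarrow> A \<subset> Vs \<Longrightarrow> 3 \<le> card {e \<in> Es. e \<inter> A \<noteq> {} \<and> e - A \<noteq> {}}"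
    and two: "2 \<le> card Vs"
begin

text \<open>Every cut has at least three edges and so survives the loss of two. The case
  \<open>e = e'\<close> serves \<open>bd_two\<close>.\<close>

lemma path_connected_remove2: "path_connected (K (Es - {e, e'}))"
proof -
  have "\<exists>c\<in>Es - {e, e'}. c \<inter> A \<noteq> {} \<and> c - A \<noteq> {}" if "A \<noteq> {}" "A \<subset> Vs" for A
  proof (rule ccontr)
    assume "\<not> ?thesis"
    then have "{c \<in> Es. c \<inter> A \<noteq> {} \<and> c - A \<noteq> {}} \<subseteq> {e, e'}" by blast
    then have "card {c \<in> Es. c \<inter> A \<noteq> {} \<and> c - A \<noteq> {}} \<le> card {e, e'}" by (intro card_mono) auto
    also have "\<dots> \<le> 2" by (simp add: card_insert_if)
    finally show False using cuts3[OF that] by linarith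
  qed
  moreover have "Vs \<noteq> {}" using two by auto
  ultimately obtain T where "T \<subseteq> Es - {e, e'}" "path_connected (K T)"
    using spanning_subset[of "Es - {e, e'}"] by (metis Diff_subset)
  then show ?thesis using path_connected_K_mono[of T "Es - {e, e'}"] by blast
qed

text \<open>The arc that closes up \<open>e\<close> is taken in the drawing without \<open>e\<close>
  and \<open>e'\<close>, so the separation of \<open>f\<close> from \<open>g\<close> does not depend
  on \<open>e'\<close>; \<open>bd_share\<close> needs exactly this.\<close>

lemma bd_pair:
  assumes "e \<in> Es" "e' \<in> Es"
  obtains f g where "f \<noteq> g" "{h \<in> F Es. e \<in> bd h} = {f, g}"
    "\<And>C. connected C \<Longrightarrow> C \<inter> (I e \<union> K (Es - {e, e'})) = {} \<Longrightarrow> C \<inter> f = {} \<or> C \<inter> g = {}"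
proof -
  have 1: "insert e (Es - {e}) \<subseteq> Es" "e \<notin> Es - {e}" "Es - {e, e'} \<subseteq> Es - {e}" using assms by auto
  have 2: "insert e (Es - {e}) = Es" using assms by auto
  have 3: "{h \<in> F Es. h \<subseteq> U (Es - {e}) e} = {h \<in> F Es. e \<in> bd h}" unfolding bd_def using assms by blast
  show ?thesis
    by (rule edge_sides[OF 1 path_connected_remove2], unfold 2 3) (rule that)
qed

lemma bd_two: "e \<in> Es \<Longrightarrow> card {f \<in> F Es. e \<in> bd f} = 2"
  by (rule bd_pair[of e e]) (auto simp: card_2_iff)

text \<open>If \<open>f\<close> and \<open>g\<close> shared two edges, deleting \<open>e'\<close>
  would merge them into one connected set, although by \<open>bd_pair\<close> the edge
  \<open>e\<close> together with the edges other than \<open>e'\<close> already separates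
  them.\<close>

lemma bd_share:
  assumes "f \<in> F Es" "g \<in> F Es" "f \<noteq> g" "e \<in> bd f" "e \<in> bd g" "e' \<in> bd f" "e' \<in> bd g"
  shows "e = e'"
proof (rule ccontr)
  assume ne: "e \<noteq> e'"
  have e: "e \<in> Es" "e' \<in> Es" using assms unfolding bd_def by auto
  obtain f' g' where fg: "f' \<noteq> g'" "{h \<in> F Es. e \<in> bd h} = {f', g'}"
    and sep: "\<And>C. connected C \<Longrightarrow> C \<inter> (I e \<union> K (Es - {e, e'})) = {} \<Longrightarrow> C \<inter> f' = {} \<or> C \<inter> g' = {}"
    by (rule bd_pair[OF e]) (rule that)
  have fg': "{f', g'} = {f, g}" using fg assms by blast
  let ?U = "U (Es - {e'}) e'"
  have U: "?U \<in> F (Es - {e'})" using U_props(1)[of e' "Es - {e'}"] e by auto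
  note Up = F_props[OF Diff_subset U]
  have "I e \<union> K (Es - {e, e'}) \<subseteq> K (Es - {e'})" using e ne unfolding K_def by blast
  then have "?U \<inter> f' = {} \<or> ?U \<inter> g' = {}" by (intro sep[OF Up(2)]) (use Up(4) in blast)
  then have "?U \<inter> f = {} \<or> ?U \<inter> g = {}" using fg' by (auto simp: doubleton_eq_iff)
  moreover have "f \<subseteq> ?U" "g \<subseteq> ?U" using assms unfolding bd_def by auto
  moreover have "f \<noteq> {}" "g \<noteq> {}" using F_props(3)[OF subset_refl] assms by auto
  ultimately show False by blast
qed

lemma Es_nonempty: "Es \<noteq> {}"
proof
  assume "Es = {}"
  obtain v where v: "v \<in> Vs" using two by fastforce
  have "{v} \<subset> Vs" using v two by (metis card.empty card_insert_if empty_iff finite.emptyI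
        insert_subset not_less_eq_eq numeral_2_eq_2 order_refl psubsetI empty_subsetI One_nat_def)
  then show False using cuts3[of "{v}"] \<open>Es = {}\<close> by simp
qed

text \<open>By \<open>F_bd\<close> a face without boundary edges would be the whole complement of
  the blobs, and the open edges run through that complement.\<close>

lemma bd_nonempty:
  assumes "f \<in> F Es"
  shows "bd f \<noteq> {}"
proof
  assume "bd f = {}"
  then have f: "f \<in> F {}" using F_bd[OF assms] by simp
  have "K {} = B" unfolding K_def by simp
  then have "- B \<subseteq> f" using F_absorb[OF f connected_Compl_B] F_props[OF _ f] by blast
  moreover obtain e where e: "e \<in> Es" using Es_nonempty by blast
  ultimately have "Io e \<subseteq> f" unfolding Io_def by blast
  moreover have "Io e \<subseteq> K Es" unfolding Io_def K_def using e by blast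
  ultimately show False using F_props(4)[OF subset_refl assms] Io_props(2)[OF e] by blast
qed

text \<open>If \<open>e\<close> were the only boundary edge of \<open>f\<close> at \<open>v\<close>,
  then \<open>I e\<close> with the blob of \<open>v\<close> would be a pendant piece of
  \<open>K (bd f)\<close>: it does not separate the plane and meets the rest in one point. By
  Janiszewski's theorem such a piece cannot separate \<open>f\<close> from the face \<open>g\<close>
  across \<open>e\<close>, since the rest does not separate them either.\<close>

lemma bd_no_leaf:
  assumes f: "f \<in> F Es" and v: "v \<in> Vs"
  shows "card {e \<in> bd f. v \<in> e} \<noteq> 1"
proof
  assume "card {e \<in> bd f. v \<in> e} = 1"
  then obtain e where e: "{e \<in> bd f. v \<in> e} = {e}" by (auto simp: card_1_singleton_iff)
  have ebd: "e \<in> bd f" "v \<in> e" using e by auto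
  have bdE: "bd f \<subseteq> Es" unfolding bd_def by auto
  have eE: "e \<in> Es" using ebd bdE by blast
  obtain w where w: "e = {v, w}" "w \<noteq> v" "w \<in> Vs"
  proof -
    obtain p q where "e = {p, q}" "p \<noteq> q" "p \<in> Vs" "q \<in> Vs" using edge_cases[OF eE] by metis
    then show ?thesis using that[of q] that[of p] ebd(2) by auto
  qed
  obtain a b where ab: "arc_between (I e) a b" "I e \<inter> S v = {a}" "I e \<inter> S w = {b}"
    using edge_arc[of v w] w(1) eE by auto
  obtain f' g' where "f' \<noteq> g'" "{h \<in> F Es. e \<in> bd h} = {f', g'}"
    using bd_two[OF eE] by (metis card_2_iff)
  then obtain g where g: "g \<in> F Es" "g \<noteq> f" "e \<in> bd g" by blast
  obtain x y where x: "x \<in> f" and y: "y \<in> g"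
    using F_props(3)[OF subset_refl f] F_props(3)[OF subset_refl g(1)] by blast
  define T where "T = \<Union>(S ` (Vs - {v})) \<union> \<Union>(I ` (bd f - {e}))"
  have "finite (bd f)" using bdE finE finite_subset by blast
  then have "compact T" unfolding T_def using finV blob compact_I bdE
    by (intro compact_Un compact_UN) auto
  then have clT: "closed T" using compact_imp_closed by blast
  have TK: "T \<subseteq> K (Es - {e})" unfolding T_def K_def B_def using bdE by blast
  let ?U = "U (Es - {e}) e"
  have U: "?U \<in> F (Es - {e})" using U_props(1)[of e "Es - {e}"] eE by auto
  note Up = F_props[OF Diff_subset U]
  have "f \<subseteq> ?U" "g \<subseteq> ?U" using ebd g unfolding bd_def by auto
  then have 1: "connected_component (- T) x y"
    unfolding connected_component_def using x y Up TK by (intro exI[of _ ?U]) auto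
  have cS: "compact (I e \<union> S v)" using compact_I[OF eE] blob[OF v] by blast
  have "connected (- (S v \<union> I e))"
    using blob[OF v] ab arc_between_topology[OF ab(1)] by (intro Janiszewski_connected) (auto simp: Int_commute)
  then have conS: "connected (- (I e \<union> S v))" by (simp only: Un_commute)
  have fp: "f \<inter> K Es = {}" "g \<inter> K Es = {}" using F_props(4)[OF subset_refl] f g by auto
  have "I e \<union> S v \<subseteq> K Es" unfolding K_def B_def using eE v by blast
  then have 2: "connected_component (- (I e \<union> S v)) x y"
    unfolding connected_component_def using conS x y fp by (intro exI[of _ "- (I e \<union> S v)"]) blast
  have other: "I e' \<inter> S v = {}" "I e \<inter> I e' \<subseteq> {b}" if e': "e' \<in> bd f" "e' \<noteq> e" for e'
  proof -
    have "v \<notin> e'" using e e' by blast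
    then show 3: "I e' \<inter> S v = {}" using avoid[of e' v] bdE e' v by blast
    have "I e \<inter> I e' \<subseteq> B" unfolding B_def using cross[of e e'] e' eE bdE by auto
    moreover have "I e \<inter> S u \<subseteq> {a, b}" if "u \<in> Vs" for u using avoid[OF eE that] ab w by blast
    ultimately show "I e \<inter> I e' \<subseteq> {b}" using 3 ab(2) unfolding B_def by blast
  qed
  have "(I e \<union> S v) \<inter> T = {b}"
  proof
    have "(I e \<union> S v) \<inter> S u \<subseteq> {b}" if "u \<in> Vs" "u \<noteq> v" for u
      using disj[OF v that(1)] avoid[OF eE that(1)] that(2) ab(3) w(1) by blast
    moreover have "(I e \<union> S v) \<inter> I e' \<subseteq> {b}" if "e' \<in> bd f" "e' \<noteq> e" for e' using other[OF that] by blast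
    ultimately show "(I e \<union> S v) \<inter> T \<subseteq> {b}" unfolding T_def by blast
    show "{b} \<subseteq> (I e \<union> S v) \<inter> T" unfolding T_def using ab(3) w by blast
  qed
  then have "connected ((I e \<union> S v) \<inter> T)" by simp
  then have "connected_component (- (I e \<union> S v \<union> T)) x y" using Janiszewski[OF cS clT _ 2 1] by blast
  moreover have "I e \<union> S v \<union> T = K (bd f)" unfolding T_def K_def B_def using ebd v by blast
  ultimately obtain C where "connected C" "C \<inter> K (bd f) = {}" "x \<in> C" "y \<in> C"
    unfolding connected_component_def by auto
  then have "y \<in> f" using F_absorb[OF F_bd[OF f], of C] x by blast
  then show False using F_eq[OF f g(1)] g(2) y by blast
qed

lemma finite_F: "finite (F Es)"
proof -
  have "F Es \<subseteq> (\<Union>e\<in>Es. {f \<in> F Es. e \<in> bd f})"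
  proof
    fix f assume f: "f \<in> F Es"
    obtain e where "e \<in> bd f" using bd_nonempty[OF f] by auto
    then show "f \<in> (\<Union>e\<in>Es. {f \<in> F Es. e \<in> bd f})" using f bd_def by auto
  qed
  moreover have "finite {f \<in> F Es. e \<in> bd f}" if "e \<in> Es" for e
    by (rule card_ge_0_finite) (simp add: bd_two[OF that])
  ultimately show ?thesis using finE by (meson finite_UN_I finite_subset)
qed

lemma euler: "card Es + 2 \<le> card (F Es) + card Vs"
proof (rule euler_inequality[OF _ finite_F])
  show "Vs \<noteq> {}" using two by auto
  show "\<exists>e\<in>Es. e \<inter> A \<noteq> {} \<and> e - A \<noteq> {}" if "A \<noteq> {}" "A \<subset> Vs" for A
  proof -
    have "{e \<in> Es. e \<inter> A \<noteq> {} \<and> e - A \<noteq> {}} \<noteq> {}" using cuts3[OF that]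
      by (metis card.empty not_numeral_le_zero)
    then show ?thesis by blast
  qed
qed

end

section \<open>Discharging\<close>

text \<open>\<open>X\<close> consists of the crossings, each given as the set of its two disjoint edges. For a face
  \<open>f\<close>, \<open>side0 f\<close> is the set of the edges outside \<open>\<Union>X\<close> on the boundary, and \<open>corner f x\<close>
  is the set of those ends \<open>v\<close> for which the half-edge from \<open>v\<close> to \<open>x\<close> is on the boundary.\<close>

locale face_structure =
  fixes E :: "'a set set" and X :: "'a set set set" and Fs :: "'f set"
    and side0 :: "'f \<Rightarrow> 'a set set" and corner :: "'f \<Rightarrow> 'a set set \<Rightarrow> 'a set"
  assumes finE: "finite E" and E2: "\<And>e. e \<in> E \<Longrightarrow> card e = 2" and C4: "C4_free E"
    and X_pair: "\<And>x. x \<in> X \<Longrightarrow> \<exists>e f. x = {e, f} \<and> e \<in> E \<and> f \<in> E \<and> e \<inter> f = {}"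
    and X_disj: "\<And>x y e. x \<in> X \<Longrightarrow> y \<in> X \<Longrightarrow> e \<in> x \<Longrightarrow> e \<in> y \<Longrightarrow> x = y"
    and finF: "finite Fs"
    and side0_sub: "\<And>f. f \<in> Fs \<Longrightarrow> side0 f \<subseteq> E - \<Union>X"
    and side0_two: "\<And>e. e \<in> E - \<Union>X \<Longrightarrow> card {f \<in> Fs. e \<in> side0 f} = 2"
    and corner_sub: "\<And>f x. f \<in> Fs \<Longrightarrow> x \<in> X \<Longrightarrow> corner f x \<subseteq> \<Union>x"
    and corner_two: "\<And>x v. x \<in> X \<Longrightarrow> v \<in> \<Union>x \<Longrightarrow> card {f \<in> Fs. v \<in> corner f x} = 2"
    and corner_one: "\<And>f x. f \<in> Fs \<Longrightarrow> x \<in> X \<Longrightarrow> card (corner f x) \<noteq> 1"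
    and share_side: "\<And>f g e e'. f \<in> Fs \<Longrightarrow> g \<in> Fs \<Longrightarrow> f \<noteq> g \<Longrightarrow> e \<in> side0 f \<Longrightarrow> e \<in> side0 g \<Longrightarrow>
        e' \<in> side0 f \<Longrightarrow> e' \<in> side0 g \<Longrightarrow> e = e'"
    and share_mixed: "\<And>f g e x v. f \<in> Fs \<Longrightarrow> g \<in> Fs \<Longrightarrow> f \<noteq> g \<Longrightarrow> e \<in> side0 f \<Longrightarrow> e \<in> side0 g \<Longrightarrow>
        x \<in> X \<Longrightarrow> v \<in> corner f x \<Longrightarrow> v \<notin> corner g x"
    and share_corner: "\<And>f g x v w. f \<in> Fs \<Longrightarrow> g \<in> Fs \<Longrightarrow> f \<noteq> g \<Longrightarrow> x \<in> X \<Longrightarrow>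
        v \<in> corner f x \<Longrightarrow> v \<in> corner g x \<Longrightarrow> w \<in> corner f x \<Longrightarrow> w \<in> corner g x \<Longrightarrow> v = w"
    and leaf: "\<And>f v. f \<in> Fs \<Longrightarrow> card {e \<in> side0 f. v \<in> e} + card {x \<in> X. v \<in> corner f x} \<noteq> 1"
    and bd_ne: "\<And>f. f \<in> Fs \<Longrightarrow> side0 f \<noteq> {} \<or> (\<exists>x\<in>X. corner f x \<noteq> {})"
begin

section \<open>Corners of the faces at one crossing\<close>

lemma X_cases:
  assumes "x \<in> X"
  obtains a b c d where "distinct [a, b, c, d]" "x = {{a, b}, {c, d}}" "{a, b} \<in> E" "{c, d} \<in> E"
    "\<Union>x = {a, b, c, d}"
proof -
  obtain e f where ef: "x = {e, f}" "e \<in> E" "f \<in> E" "e \<inter> f = {}" using X_pair[OF assms] by blast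
  obtain a b where "e = {a, b}" "a \<noteq> b" using E2[OF ef(2)] by (auto simp: card_2_iff)
  moreover obtain c d where "f = {c, d}" "c \<noteq> d" using E2[OF ef(3)] by (auto simp: card_2_iff)
  ultimately show ?thesis using ef by (intro that[of a b c d]) auto
qed

lemma finX: "finite X"
proof -
  have "X \<subseteq> Pow E" using X_pair by blast
  then show ?thesis using finE finite_subset by blast
qed

lemma no_C4:
  assumes "distinct [a, b, c, d]" "{a, b} \<in> E" "{b, c} \<in> E" "{c, d} \<in> E" "{d, a} \<in> E"
  shows False
  using C4 assms unfolding C4_free_def by blast

lemma fin_corner: "f \<in> Fs \<Longrightarrow> x \<in> X \<Longrightarrow> finite (corner f x)"
  using corner_sub X_cases by (metis finite.emptyI finite.insertI finite_subset)

text \<open>Passing across the half-edge at \<open>p\<close>: the face on its other side must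
  continue along another half-edge of \<open>x\<close>, and it shares no further half-edge with
  \<open>f\<close>.\<close>

lemma other_corner:
  assumes "f \<in> Fs" "x \<in> X" "p \<in> corner f x"
  obtains g u where "g \<in> Fs" "g \<noteq> f" "p \<in> corner g x" "u \<in> corner g x" "u \<noteq> p"
    "\<And>q. q \<in> corner f x \<Longrightarrow> q \<noteq> p \<Longrightarrow> q \<notin> corner g x"
proof -
  have "p \<in> \<Union>x" using corner_sub assms by blast
  from corner_two[OF assms(2) this] obtain g1 g2 where "g1 \<noteq> g2" "{h \<in> Fs. p \<in> corner h x} = {g1, g2}"
    by (auto simp: card_2_iff)
  then obtain g where g: "g \<in> Fs" "g \<noteq> f" "p \<in> corner g x" by blast
  have "corner g x \<noteq> {p}" using corner_one[OF g(1) assms(2)] by auto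
  then obtain u where u: "u \<in> corner g x" "u \<noteq> p" using g(3) by blast
  have "q \<notin> corner g x" if "q \<in> corner f x" "q \<noteq> p" for q
    using share_corner[OF assms(1) g(1) g(2)[symmetric] assms(2,3) g(3) that(1)] that(2) by blast
  then show ?thesis using that[OF g u] by blast
qed

text \<open>If a face had three half-edges at \<open>x\<close>, the faces across them would be
  distinct, and each would have to continue along the fourth half-edge, which bounds only two
  faces.\<close>

lemma corner_card:
  assumes f: "f \<in> Fs" and x: "x \<in> X" and ne: "corner f x \<noteq> {}"
  shows "card (corner f x) = 2"
proof (rule ccontr)
  assume "card (corner f x) \<noteq> 2"
  moreover have "card (corner f x) \<noteq> 0" using ne fin_corner[OF f x] by auto
  ultimately have "3 \<le> card (corner f x)" using corner_one[OF f x] by linarith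
  then obtain T where T: "T \<subseteq> corner f x" "card T = 3"
    using obtain_subset_with_card_n by metis
  then obtain p q r where pqr: "T = {p, q, r}" "distinct [p, q, r]" by (auto simp: card_3_iff)
  have in_f: "p \<in> corner f x" "q \<in> corner f x" "r \<in> corner f x" using T pqr by auto
  obtain a b c d where abcd: "distinct [a, b, c, d]" "\<Union>x = {a, b, c, d}" using X_cases[OF x] by metis
  have "card (\<Union>x) = 4" using abcd by auto
  moreover have sub: "{p, q, r} \<subseteq> \<Union>x" using T pqr corner_sub[OF f x] by blast
  ultimately have "card (\<Union>x - {p, q, r}) = 1" using pqr by (subst card_Diff_subset) auto
  then obtain s where s: "\<Union>x - {p, q, r} = {s}" by (auto simp: card_1_singleton_iff)
  have third: "\<exists>g\<in>Fs. corner g x \<inter> {p, q, r, s} = {v, s} \<and> g \<noteq> f" if v: "v \<in> {p, q, r}" for v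
  proof -
    have vf: "v \<in> corner f x" using in_f v by blast
    obtain g u where g: "g \<in> Fs" "g \<noteq> f" "v \<in> corner g x" "u \<in> corner g x" "u \<noteq> v"
      and ng: "\<And>q. q \<in> corner f x \<Longrightarrow> q \<noteq> v \<Longrightarrow> q \<notin> corner g x"
      by (rule other_corner[OF f x vf]) (rule that)
    have "u \<in> \<Union>x" using corner_sub[OF g(1) x] g(4) by blast
    moreover have "u \<notin> {p, q, r}" using ng[of u] g(4,5) in_f by blast
    ultimately have "u = s" using s by blast
    moreover have "w \<notin> corner g x" if "w \<in> {p, q, r}" "w \<noteq> v" for w using ng[of w] in_f that by blast
    ultimately have "corner g x \<inter> {p, q, r, s} = {v, s}" using g(3,4) v by auto
    then show ?thesis using g by blast
  qed
  have sn: "s \<notin> {p, q, r}" "s \<in> \<Union>x" using s by auto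
  obtain g1 where g1: "g1 \<in> Fs" "corner g1 x \<inter> {p, q, r, s} = {p, s}" using third[of p] by blast
  obtain g2 where g2: "g2 \<in> Fs" "corner g2 x \<inter> {p, q, r, s} = {q, s}" using third[of q] by blast
  obtain g3 where g3: "g3 \<in> Fs" "corner g3 x \<inter> {p, q, r, s} = {r, s}" using third[of r] by blast
  have "{p, s} \<noteq> {q, s}" "{p, s} \<noteq> {r, s}" "{q, s} \<noteq> {r, s}" using sn pqr by (auto simp: doubleton_eq_iff)
  then have ne3: "g1 \<noteq> g2" "g1 \<noteq> g3" "g2 \<noteq> g3" using g1(2) g2(2) g3(2) by metis+
  have "{g1, g2, g3} \<subseteq> {h \<in> Fs. s \<in> corner h x}" using g1 g2 g3 by blast
  then have "card {g1, g2, g3} \<le> card {h \<in> Fs. s \<in> corner h x}" using finF by (intro card_mono) auto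
  then show False using corner_two[OF x sn(2)] ne3 by simp
qed

lemma corner_inj:
  assumes "f \<in> Fs" "g \<in> Fs" "x \<in> X" "corner f x = corner g x" "corner f x \<noteq> {}"
  shows "f = g"
proof (rule ccontr)
  assume "f \<noteq> g"
  obtain v w where vw: "corner f x = {v, w}" "v \<noteq> w"
    using corner_card[OF assms(1,3,5)] by (auto simp: card_2_iff)
  then have "corner g x = {v, w}" using assms(4) by simp
  with vw have "v = w" by (intro share_corner[OF assms(1,2) \<open>f \<noteq> g\<close> assms(3)]) simp_all
  then show False using vw(2) by contradiction
qed

text \<open>The corners at a crossing form a 4-cycle on its four ends. The crossing is \<open>touching\<close> if
  this cycle uses the two crossing edges.\<close>

definition Cs :: "'a set set \<Rightarrow> 'a set set" where
  "Cs x = {corner f x | f. f \<in> Fs \<and> corner f x \<noteq> {}}"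

lemma Cs_sub:
  assumes "x \<in> X" "p \<in> Cs x"
  shows "p \<subseteq> \<Union>x" "card p = 2"
  using assms corner_sub corner_card unfolding Cs_def by blast+

text \<open>By \<open>corner_inj\<close> the two faces at the half-edge of \<open>v\<close> have
  different corners, so \<open>v\<close> has degree two in the graph formed by the corners.\<close>

lemma Cs_at:
  assumes x: "x \<in> X" and W: "\<Union>x = {v, w1, w2, w3}" and dist: "distinct [v, w1, w2, w3]"
  shows "({v, w1} \<in> Cs x \<and> {v, w2} \<in> Cs x \<and> {v, w3} \<notin> Cs x) \<or>
         ({v, w1} \<in> Cs x \<and> {v, w2} \<notin> Cs x \<and> {v, w3} \<in> Cs x) \<or>
         ({v, w1} \<notin> Cs x \<and> {v, w2} \<in> Cs x \<and> {v, w3} \<in> Cs x)"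
proof -
  have vx: "v \<in> \<Union>x" using W by blast
  obtain f g where fg: "f \<noteq> g" "{h \<in> Fs. v \<in> corner h x} = {f, g}"
    using corner_two[OF x vx] by (auto simp: card_2_iff)
  have f: "f \<in> Fs" "v \<in> corner f x" and g: "g \<in> Fs" "v \<in> corner g x" using fg by auto
  have pr: "\<exists>u. corner h x = {v, u} \<and> u \<in> {w1, w2, w3}" if h: "h \<in> Fs" "v \<in> corner h x" for h
  proof -
    have "card (corner h x) = 2" using corner_card[OF h(1) x] h(2) by blast
    then obtain u where "corner h x = {v, u}" "u \<noteq> v" using h(2) by (auto simp: card_2_iff doubleton_eq_iff)
    moreover have "u \<in> \<Union>x" using corner_sub[OF h(1) x] calculation by blast
    ultimately show ?thesis using W by auto
  qed
  obtain u1 where u1: "corner f x = {v, u1}" "u1 \<in> {w1, w2, w3}" using pr[OF f] by blast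
  obtain u2 where u2: "corner g x = {v, u2}" "u2 \<in> {w1, w2, w3}" using pr[OF g] by blast
  have "u1 \<noteq> u2" using corner_inj[OF f(1) g(1) x] u1 u2 fg(1) by auto
  have iff: "{v, w} \<in> Cs x \<longleftrightarrow> {v, w} = {v, u1} \<or> {v, w} = {v, u2}" for w
  proof
    assume "{v, w} \<in> Cs x"
    then obtain h where h: "h \<in> Fs" "corner h x = {v, w}" unfolding Cs_def by auto
    then have "h = f \<or> h = g" using fg(2) by blast
    then have "corner h x = corner f x \<or> corner h x = corner g x" by blast
    then show "{v, w} = {v, u1} \<or> {v, w} = {v, u2}" unfolding h(2) u1(1) u2(1) .
  next
    assume "{v, w} = {v, u1} \<or> {v, w} = {v, u2}"
    then have "{v, w} = corner f x \<or> {v, w} = corner g x" unfolding u1(1) u2(1) .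
    then show "{v, w} \<in> Cs x" unfolding Cs_def using f(1) g(1) by blast
  qed
  show ?thesis unfolding iff using u1(2) u2(2) \<open>u1 \<noteq> u2\<close> dist by (auto simp: doubleton_eq_iff)
qed

definition touching :: "'a set set \<Rightarrow> bool" where
  "touching x \<longleftrightarrow> (\<exists>p\<in>Cs x. p \<in> x)"

lemma Cs_pairs:
  assumes "x \<in> X" "\<Union>x = {a, b, c, d}"
  shows "Cs x \<subseteq> {{a, b}, {a, c}, {a, d}, {b, c}, {b, d}, {c, d}}"
proof
  fix p assume p: "p \<in> Cs x"
  obtain y z where yz: "p = {y, z}" "y \<noteq> z" using Cs_sub(2)[OF assms(1) p] by (auto simp: card_2_iff)
  have "y \<in> {a, b, c, d}" "z \<in> {a, b, c, d}" using Cs_sub(1)[OF assms(1) p] assms(2) yz by auto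
  then show "p \<in> {{a, b}, {a, c}, {a, d}, {b, c}, {b, d}, {c, d}}"
    using yz by (auto simp: doubleton_eq_iff)
qed

lemma Cs_proper:
  assumes x: "x \<in> X" "\<not> touching x" and abcd: "x = {{a, b}, {c, d}}" "distinct [a, b, c, d]"
  shows "Cs x = {{a, c}, {c, b}, {b, d}, {d, a}}"
proof -
  have W: "\<Union>x = {a, b, c, d}" using abcd by auto
  have n: "{a, b} \<notin> Cs x" "{c, d} \<notin> Cs x" using x abcd unfolding touching_def by auto
  have "{a, c} \<in> Cs x \<and> {a, d} \<in> Cs x" using Cs_at[OF x(1), of a b c d] W abcd n by auto
  moreover have "{b, c} \<in> Cs x \<and> {b, d} \<in> Cs x"
    using Cs_at[OF x(1), of b a c d] W abcd n by (auto simp: insert_commute)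
  ultimately show ?thesis using Cs_pairs[OF x(1) W] n by (auto simp: insert_commute)
qed

text \<open>A 4-cycle on the four ends is the union of two perfect matchings, so a crossing edge
  that is a corner brings the other one along. The names \<open>a\<close> and \<open>b\<close> are
  chosen so that the remaining corners are \<open>{b, c}\<close> and \<open>{d, a}\<close>.\<close>

lemma Cs_touching:
  assumes x: "x \<in> X" "touching x"
  obtains a b c d where "x = {{a, b}, {c, d}}" "distinct [a, b, c, d]"
    "Cs x = {{a, b}, {c, d}, {b, c}, {d, a}}"
proof -
  obtain a b c d where abcd: "distinct [a, b, c, d]" "x = {{a, b}, {c, d}}" using X_cases[OF x(1)] by metis
  have W: "\<Union>x = {a, b, c, d}" using abcd by auto
  note at = Cs_at[OF x(1), of a b c d] Cs_at[OF x(1), of b a c d] Cs_at[OF x(1), of c a b d] Cs_at[OF x(1), of d a b c]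
  have W': "\<Union>x = {b, a, c, d}" "\<Union>x = {c, a, b, d}" "\<Union>x = {d, a, b, c}" using W by auto
  have sy: "{b, a} = {a, b}" "{c, a} = {a, c}" "{d, a} = {a, d}" "{c, b} = {b, c}" "{d, b} = {b, d}" "{d, c} = {c, d}"
    by auto
  have dd: "distinct [b, a, c, d]" "distinct [c, a, b, d]" "distinct [d, a, b, c]" using abcd by auto
  have t: "{a, b} \<in> Cs x \<or> {c, d} \<in> Cs x" using x(2) abcd unfolding touching_def by auto
  note at' = at(1)[OF W abcd(1)] at(2)[OF W'(1) dd(1)] at(3)[OF W'(2) dd(2)] at(4)[OF W'(3) dd(3)]
  have "({a, b} \<in> Cs x \<and> {c, d} \<in> Cs x) \<and>
    ({b, c} \<in> Cs x \<and> {a, d} \<in> Cs x \<and> {a, c} \<notin> Cs x \<and> {b, d} \<notin> Cs x \<or>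
     {a, c} \<in> Cs x \<and> {b, d} \<in> Cs x \<and> {b, c} \<notin> Cs x \<and> {a, d} \<notin> Cs x)"
    using at' t unfolding sy by satx
  then have "Cs x = {{a, b}, {c, d}, {b, c}, {a, d}} \<or> Cs x = {{a, b}, {c, d}, {a, c}, {b, d}}"
  proof (elim conjE disjE, goal_cases)
    case 1
    have "Cs x = {{a, b}, {c, d}, {b, c}, {a, d}}" by (rule subset_antisym) (use 1 Cs_pairs[OF x(1) W] in auto)
    then show ?case ..
  next
    case 2
    have "Cs x = {{a, b}, {c, d}, {a, c}, {b, d}}" by (rule subset_antisym) (use 2 Cs_pairs[OF x(1) W] in auto)
    then show ?case ..
  qed
  then show ?thesis
  proof
    assume 1: "Cs x = {{a, b}, {c, d}, {b, c}, {a, d}}"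
    show ?thesis by (rule that[of a b c d]) (use 1 abcd in \<open>simp_all add: sy\<close>)
  next
    assume 2: "Cs x = {{a, b}, {c, d}, {a, c}, {b, d}}"
    show ?thesis by (rule that[of b a c d]) (use 2 abcd dd in \<open>simp_all add: sy\<close>)
  qed
qed

text \<open>A corner that is one of the two edges of its crossing counts as a side of the face, as if the
  edge were drawn along it; the other corners are turns. The critical faces are the triangles without
  turns and the digons formed by one side and one turn (\<open>Kface\<close>). By \<open>C4_free\<close> a proper crossing has
  at most two corners of the latter kind, and these are adjacent.\<close>

definition flats :: "'f \<Rightarrow> 'a set set set" where
  "flats f = {x \<in> X. corner f x \<in> x}"
definition turns :: "'f \<Rightarrow> 'a set set set" where
  "turns f = {x \<in> X. corner f x \<noteq> {} \<and> corner f x \<notin> x}"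
definition sides :: "'f \<Rightarrow> 'a set set" where
  "sides f = side0 f \<union> corner f ` flats f"
definition Kface :: "'f \<Rightarrow> bool" where
  "Kface f \<longleftrightarrow> card (turns f) = 1 \<and> card (sides f) = 1"
definition Kc :: "'a set set \<Rightarrow> 'a set set" where
  "Kc x = {corner f x | f. f \<in> Fs \<and> Kface f \<and> corner f x \<noteq> {}}"
definition plain :: "'a set \<Rightarrow> bool" where
  "plain e \<longleftrightarrow> (\<exists>f\<in>Fs. e \<in> sides f)"
text \<open>These are the critical faces that would miss 40 if a side gave only 10: a triangle would
  get \<open>3 * 10\<close>, and a digon only \<open>10 + 26\<close> when its crossing has to serve
  two digons.\<close>

definition poor :: "'f \<Rightarrow> bool" where
  "poor f \<longleftrightarrow> turns f = {} \<and> card (sides f) = 3 \<or>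
     Kface f \<and> (\<exists>x\<in>turns f. \<not> touching x \<and> card (Kc x) \<noteq> 1)"
text \<open>A weak corner is next to a critical one and gives up 4 of the even share 22 in its
  favour.\<close>

definition weak :: "'a set set \<Rightarrow> 'a set \<Rightarrow> bool" where
  "weak x p \<longleftrightarrow> \<not> touching x \<and> p \<notin> Kc x \<and> card (p \<inter> \<Union>(Kc x)) = 1"
text \<open>The charge \<open>h x p\<close> that a crossing sends to the face at corner \<open>p\<close> sums to at most
  \<open>88 = 14 + 14 + 30 + 30 = 4 * 22 = 30 + 18 + 18 + 22 = 26 + 26 + 18 + 18\<close>.\<close>

definition h :: "'a set set \<Rightarrow> 'a set \<Rightarrow> nat" where
  "h x p = (if p \<in> x then 14 else if touching x then 30
     else if p \<in> Kc x then (if card (Kc x) = 1 then 30 else 26)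
     else if weak x p then 18 else 22)"
definition sg :: "'f \<Rightarrow> nat" where
  "sg f = (if poor f then 14 else 10)"

section \<open>Sides and turns of a face\<close>

lemma X_E: "x \<in> X \<Longrightarrow> e \<in> x \<Longrightarrow> e \<in> E"
  using X_pair by blast

lemma X_ne: "x \<in> X \<Longrightarrow> {} \<notin> x"
  using X_E E2 by fastforce

lemma fin_side0: "f \<in> Fs \<Longrightarrow> finite (side0 f)"
  using side0_sub finE by (meson Diff_subset finite_subset)

lemma fin_flats: "finite (flats f)" and fin_turns: "finite (turns f)"
  using finX unfolding flats_def turns_def by auto

lemma fin_sides: "f \<in> Fs \<Longrightarrow> finite (sides f)"
  using fin_side0 fin_flats unfolding sides_def by auto

lemma sides_E: "f \<in> Fs \<Longrightarrow> e \<in> sides f \<Longrightarrow> e \<in> E"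
  using side0_sub X_E unfolding sides_def flats_def by blast

lemma inj_flats: "inj_on (corner f) (flats f)"
  unfolding flats_def by (rule inj_onI) (metis (no_types, lifting) X_disj mem_Collect_eq)

lemma side0_flats_disj: "f \<in> Fs \<Longrightarrow> side0 f \<inter> corner f ` A = {}" if "A \<subseteq> flats f"
  using side0_sub that unfolding flats_def by blast

lemma card_sides: "f \<in> Fs \<Longrightarrow> card (sides f) = card (side0 f) + card (flats f)"
  unfolding sides_def
  using fin_side0 fin_flats side0_flats_disj[OF subset_refl] card_image[OF inj_flats]
  by (metis card_Un_disjoint finite_imageI)

text \<open>The absence of leaves is preserved when flats are counted as sides, because different
  flats of a face are different edges and none of them is in \<open>side0\<close>.\<close>

lemma degree:
  assumes f: "f \<in> Fs"
  shows "card {e \<in> sides f. v \<in> e} + card {x \<in> turns f. v \<in> corner f x} \<noteq> 1"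
proof -
  let ?A = "{x \<in> flats f. v \<in> corner f x}"
  have A: "?A \<subseteq> flats f" by blast
  have "{e \<in> sides f. v \<in> e} = {e \<in> side0 f. v \<in> e} \<union> corner f ` ?A" unfolding sides_def by auto
  moreover have "{e \<in> side0 f. v \<in> e} \<inter> corner f ` ?A = {}" using side0_flats_disj[OF A f] by auto
  moreover have "card (corner f ` ?A) = card ?A" using inj_on_subset[OF inj_flats A] card_image by blast
  ultimately have 1: "card {e \<in> sides f. v \<in> e} = card {e \<in> side0 f. v \<in> e} + card ?A"
    using fin_side0[OF f] fin_flats[of f] by (simp add: card_Un_disjoint)
  have "{x \<in> X. v \<in> corner f x} = ?A \<union> {x \<in> turns f. v \<in> corner f x}"
    "?A \<inter> {x \<in> turns f. v \<in> corner f x} = {}"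
    unfolding flats_def turns_def by auto
  then have 2: "card {x \<in> X. v \<in> corner f x} = card ?A + card {x \<in> turns f. v \<in> corner f x}"
    using fin_flats[of f] fin_turns[of f] by (simp add: card_Un_disjoint)
  show ?thesis using leaf[OF f, of v] 1 2 by linarith
qed

lemma degree_side:
  assumes f: "f \<in> Fs" "e \<in> sides f" "v \<in> e"
  shows "(\<exists>e'\<in>sides f. e' \<noteq> e \<and> v \<in> e') \<or> (\<exists>x\<in>turns f. v \<in> corner f x)"
proof (rule ccontr)
  assume "\<not> ?thesis"
  then have 1: "{e \<in> sides f. v \<in> e} = {e}" and 2: "{x \<in> turns f. v \<in> corner f x} = {}" using f by auto
  show False using degree[OF f(1), of v] unfolding 1 2 by simp
qed

lemma degree_turn:
  assumes f: "f \<in> Fs" "x \<in> turns f" "v \<in> corner f x"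
  shows "(\<exists>y\<in>turns f. y \<noteq> x \<and> v \<in> corner f y) \<or> (\<exists>e\<in>sides f. v \<in> e)"
proof (rule ccontr)
  assume "\<not> ?thesis"
  then have 1: "{e \<in> sides f. v \<in> e} = {}" and 2: "{x \<in> turns f. v \<in> corner f x} = {x}" using f by auto
  show False using degree[OF f(1), of v] unfolding 1 2 by simp
qed

lemma turnsD: "x \<in> turns f \<Longrightarrow> x \<in> X \<and> corner f x \<noteq> {} \<and> corner f x \<notin> x"
  unfolding turns_def by auto

lemma turn_pair:
  assumes "f \<in> Fs" "x \<in> turns f"
  obtains p q where "corner f x = {p, q}" "p \<noteq> q"
  using corner_card[OF assms(1), of x] turnsD[OF assms(2)] by (auto simp: card_2_iff)

lemma edge_pair:
  assumes "e \<in> E" "p \<in> e"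
  obtains q where "e = {p, q}" "q \<noteq> p"
proof -
  obtain a b where "e = {a, b}" "a \<noteq> b" using E2[OF assms(1)] by (auto simp: card_2_iff)
  then show ?thesis using assms(2) that[of a] that[of b] by auto
qed

lemma nonempty_face: "f \<in> Fs \<Longrightarrow> turns f = {} \<Longrightarrow> sides f \<noteq> {}"
  using bd_ne[of f] unfolding turns_def sides_def flats_def by blast

text \<open>The sides alone form a simple graph without leaves, so \<open>{p, q}\<close> extends to
  a path at both ends; if there are only three sides, the path has to close up to a
  triangle.\<close>

lemma no_turns:
  assumes f: "f \<in> Fs" "turns f = {}" and pq: "{p, q} \<in> sides f" "p \<noteq> q"
  obtains r s where "r \<noteq> q" "r \<noteq> p" "s \<noteq> p" "s \<noteq> q" "{p, r} \<in> sides f" "{q, s} \<in> sides f"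
    "3 \<le> card (sides f)" "card (sides f) = 3 \<Longrightarrow> r = s"
proof -
  obtain e1 where e1: "e1 \<in> sides f" "e1 \<noteq> {p, q}" "p \<in> e1" using degree_side[OF f(1) pq(1), of p] f(2) by auto
  obtain e2 where e2: "e2 \<in> sides f" "e2 \<noteq> {p, q}" "q \<in> e2" using degree_side[OF f(1) pq(1), of q] f(2) by auto
  obtain r where r: "e1 = {p, r}" "r \<noteq> p" using edge_pair sides_E f(1) e1 by metis
  obtain s where s: "e2 = {q, s}" "s \<noteq> q" using edge_pair sides_E f(1) e2 by metis
  have rq: "r \<noteq> q" using e1(2) r by auto
  have sp: "s \<noteq> p" using e2(2) s by (auto simp: insert_commute)
  have ne: "e1 \<noteq> e2" using r s rq sp pq(2) by (auto simp: doubleton_eq_iff)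
  have sub: "{{p, q}, e1, e2} \<subseteq> sides f" using e1 e2 pq by auto
  have c3: "card {{p, q}, e1, e2} = 3" using e1(2) e2(2) ne by (auto simp: eq_commute)
  have ge: "3 \<le> card (sides f)" using card_mono[OF fin_sides[OF f(1)] sub] c3 by simp
  have "r = s" if "card (sides f) = 3"
  proof -
    have eq: "sides f = {{p, q}, e1, e2}"
      using card_subset_eq[OF fin_sides[OF f(1)] sub] c3 that by simp
    obtain e where "e \<in> sides f" "e \<noteq> e1" "r \<in> e" using degree_side[OF f(1) e1(1), of r] f(2) r(1) by auto
    then show ?thesis using eq r s rq by auto
  qed
  then show ?thesis using that[of r s] rq sp r s e1(1) e2(1) ge by blast
qed

text \<open>A crossed edge can be a side only as a flat, and a flat is a corner that is an edge of
  its crossing. So the edges of a proper crossing are never plain, which is what the later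
  contradictions use.\<close>

lemma plain_crossed:
  assumes "plain e" "e \<in> x" "x \<in> X"
  shows "touching x"
proof -
  obtain f where f: "f \<in> Fs" "e \<in> sides f" using assms(1) unfolding plain_def by blast
  have "e \<notin> side0 f" using side0_sub[OF f(1)] assms by blast
  then obtain y where y: "y \<in> X" "corner f y \<in> y" "e = corner f y" using f(2) unfolding sides_def flats_def by blast
  then have "y = x" using X_disj[of y x e] assms by auto
  moreover have "corner f x \<noteq> {}" using E2[OF X_E[OF y(1,2)]] calculation by auto
  ultimately show ?thesis unfolding touching_def Cs_def using f(1) y(2) by blast
qed

text \<open>Both ends of the turn need a second incidence, and the only side has to supply
  both.\<close>

lemma Kface_side:
  assumes f: "f \<in> Fs" "Kface f" "x \<in> turns f"
  shows "sides f = {corner f x}"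
proof -
  have t: "turns f = {x}" using f unfolding Kface_def by (auto simp: card_1_singleton_iff)
  obtain e where e: "sides f = {e}" using f unfolding Kface_def by (auto simp: card_1_singleton_iff)
  have "corner f x \<subseteq> e" using degree_turn[OF f(1,3)] t e by auto
  moreover have "card e = 2" "finite e" using E2 sides_E[OF f(1), of e] e by (auto intro: card_ge_0_finite)
  moreover have "card (corner f x) = 2" using corner_card f turnsD by blast
  ultimately have "corner f x = e" using card_subset_eq by metis
  then show ?thesis using e by simp
qed

lemma Kc_face:
  assumes "x \<in> X" "\<not> touching x" "p \<in> Kc x"
  obtains f where "f \<in> Fs" "Kface f" "corner f x = p" "x \<in> turns f" "sides f = {p}"
proof -
  obtain f where f: "f \<in> Fs" "Kface f" "corner f x = p" "p \<noteq> {}" using assms(3) unfolding Kc_def by blast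
  then have "p \<notin> x" using assms(2) unfolding touching_def Cs_def by blast
  then have "x \<in> turns f" using f assms(1) unfolding turns_def by blast
  then show ?thesis using that f Kface_side by metis
qed

lemma Kc_props:
  assumes "x \<in> X" "\<not> touching x" "p \<in> Kc x"
  shows "plain p" "p \<in> E" "p \<in> Cs x"
proof -
  obtain f where f: "f \<in> Fs" "Kface f" "corner f x = p" "x \<in> turns f" "sides f = {p}"
    using Kc_face[OF assms] by metis
  show "plain p" "p \<in> E" using f sides_E unfolding plain_def by blast+
  show "p \<in> Cs x" using f turnsD unfolding Cs_def by blast
qed

text \<open>A pair of ends that is not an edge of \<open>x\<close> joins its two edges, so
  \<open>w\<close> and \<open>z\<close> both lie on the crossing edge that avoids
  \<open>u\<close>.\<close>

lemma third_in_crossing: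
  assumes x: "x \<in> X" and "{u, w} \<subseteq> \<Union>x" "{u, z} \<subseteq> \<Union>x" "{u, w} \<notin> x" "{u, z} \<notin> x" "distinct [u, w, z]"
  shows "{w, z} \<in> x"
proof -
  obtain a b c d where abcd: "distinct [a, b, c, d]" "x = {{a, b}, {c, d}}" using X_cases[OF x] by metis
  have k: "w \<in> {c, d} \<longleftrightarrow> u \<in> {a, b}" if "{u, w} \<subseteq> {a, b, c, d}" "{u, w} \<notin> {{a, b}, {c, d}}" "u \<noteq> w" for u w
    using that abcd(1) by (auto simp: insert_commute)
  have U: "\<Union>x = {a, b, c, d}" using abcd by auto
  have "w \<in> {c, d} \<longleftrightarrow> u \<in> {a, b}" "z \<in> {c, d} \<longleftrightarrow> u \<in> {a, b}" using assms k[of u w] k[of u z] U abcd(2) by auto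
  moreover have "w \<in> {a, b, c, d}" "z \<in> {a, b, c, d}" "w \<noteq> z" using assms U by auto
  ultimately show ?thesis unfolding abcd(2) by (auto simp: doubleton_eq_iff)
qed

text \<open>The critical corner that meets \<open>p\<close> in \<open>u\<close> is an edge
  \<open>{u, z}\<close> of the graph, and the crossing edge at \<open>w\<close> ends in
  \<open>z\<close>. So the ends of a weak corner have a common neighbour, reached over one plain and
  one crossed edge.\<close>

lemma weak_path:
  assumes x: "x \<in> X" and p: "p \<in> Cs x" and w: "weak x p"
  obtains u w z where "p = {u, w}" "distinct [u, w, z]" "plain {u, z}" "{w, z} \<in> x" "{u, z} \<in> E"
proof -
  have nt: "\<not> touching x" using w unfolding weak_def by blast
  obtain u where u: "p \<inter> \<Union>(Kc x) = {u}" using w unfolding weak_def by (auto simp: card_1_singleton_iff)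
  have "u \<in> p" using u by blast
  then obtain w where w': "p = {u, w}" "u \<noteq> w" using Cs_sub(2)[OF x p]
    by (auto simp: card_2_iff)
  obtain k where k: "k \<in> Kc x" "u \<in> k" using u by blast
  note kp = Kc_props[OF x nt k(1)]
  obtain z where z: "k = {u, z}" "z \<noteq> u" using edge_pair kp(2) k(2) by metis
  have zw: "z \<noteq> w" using u w' z k by blast
  have "{u, w} \<subseteq> \<Union>x" "{u, z} \<subseteq> \<Union>x" using Cs_sub(1)[OF x p] Cs_sub(1)[OF x kp(3)] w' z by auto
  moreover have "{u, w} \<notin> x" "{u, z} \<notin> x" using nt p kp(3) w' z unfolding touching_def by auto
  ultimately have "{w, z} \<in> x" using third_in_crossing[OF x, of u w z] w' z zw by auto
  then show ?thesis using that[of u w z] w' z zw kp by auto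
qed

lemma weak_nbr:
  assumes x: "x \<in> X" and p: "p \<in> Cs x" "p = {u, w}" and wk: "weak x p"
  obtains z where "distinct [u, w, z]" "{u, z} \<in> E" "{w, z} \<in> E"
    "({w, z} \<in> x \<and> plain {u, z}) \<or> ({u, z} \<in> x \<and> plain {w, z})"
proof -
  obtain u' w' z where *: "p = {u', w'}" "distinct [u', w', z]" "plain {u', z}" "{w', z} \<in> x" "{u', z} \<in> E"
    using weak_path[OF x p(1) wk] by metis
  have "{w', z} \<in> E" using X_E x * by blast
  moreover have "u = u' \<and> w = w' \<or> u = w' \<and> w = u'" using p(2) *(1) by (auto simp: doubleton_eq_iff)
  ultimately show ?thesis using that[of z] * by auto
qed

end

lemma card_2_other:
  assumes "card A = 2" "a \<in> A"
  obtains b where "A = {a, b}" "b \<noteq> a"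
proof -
  obtain u v where "A = {u, v}" "u \<noteq> v" using assms(1) by (auto simp: card_2_iff)
  then show ?thesis using assms(2) that[of u] that[of v] by (metis insertE insert_commute singletonD)
qed

context face_structure
begin

lemma h_turn:
  assumes "x \<in> turns f"
  shows "18 \<le> h x (corner f x)" "\<not> weak x (corner f x) \<Longrightarrow> 22 \<le> h x (corner f x)"
  using turnsD[OF assms] unfolding h_def by auto

lemma sg_ge: "10 \<le> sg f"
  unfolding sg_def by simp

lemma turn_Cs: "f \<in> Fs \<Longrightarrow> x \<in> turns f \<Longrightarrow> corner f x \<in> Cs x"
  using turnsD unfolding Cs_def by blast

text \<open>By \<open>C4_free\<close> the ends \<open>p\<close> and \<open>q\<close> have only one
  common neighbour, so \<open>m\<close> is the one that \<open>weak_nbr\<close> provides.\<close>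

lemma weak_turn_other:
  assumes f: "f \<in> Fs" "x \<in> turns f" "corner f x = {p, q}" "weak x (corner f x)"
    and m: "{p, m} \<in> E" "{q, m} \<in> E" "m \<noteq> p" "m \<noteq> q"
  shows "({q, m} \<in> x \<and> plain {p, m}) \<or> ({p, m} \<in> x \<and> plain {q, m})"
proof -
  have x: "x \<in> X" using turnsD f by blast
  obtain z where z: "distinct [p, q, z]" "{p, z} \<in> E" "{q, z} \<in> E"
    "({q, z} \<in> x \<and> plain {p, z}) \<or> ({p, z} \<in> x \<and> plain {q, z})"
    by (rule weak_nbr[OF x turn_Cs[OF f(1,2)] f(3,4)]) (rule that)
  have "z = m"
  proof (rule ccontr)
    assume "z \<noteq> m"
    then show False using no_C4[of p m q z] m z by (auto simp: insert_commute)
  qed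
  then show ?thesis using z(4) by simp
qed

lemma weak_nontouching: "weak x p \<Longrightarrow> \<not> touching x"
  unfolding weak_def by blast

text \<open>With one turn and two sides the face is a triangle. Were the turn weak, its third vertex
  would be the common neighbour from \<open>weak_turn_other\<close>, and one side would be both
  plain and an edge of a proper crossing.\<close>

lemma one_turn:
  assumes f: "f \<in> Fs" and t: "turns f = {x}"
  obtains "card (sides f) = 1" "sides f = {corner f x}"
  | "card (sides f) = 2" "\<not> weak x (corner f x)"
  | "3 \<le> card (sides f)"
proof -
  have xt: "x \<in> turns f" using t by simp
  obtain p q where pq: "corner f x = {p, q}" "p \<noteq> q" using turn_pair[OF f xt] by metis
  obtain e1 where e1: "e1 \<in> sides f" "p \<in> e1" using degree_turn[OF f xt, of p] t pq by auto
  obtain e2 where e2: "e2 \<in> sides f" "q \<in> e2" using degree_turn[OF f xt, of q] t pq by auto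
  have c0: "card (sides f) \<noteq> 0" using e1 fin_sides[OF f] by auto
  consider "card (sides f) = 1" | "card (sides f) = 2" | "3 \<le> card (sides f)" using c0 by linarith
  then show ?thesis
  proof cases
    case 1
    then have "Kface f" using t unfolding Kface_def by simp
    then show ?thesis using that(1)[OF 1] Kface_side[OF f _ xt] by blast
  next
    case 2
    have "\<not> weak x (corner f x)"
    proof
      assume wk: "weak x (corner f x)"
      \<comment> \<open>If one side joined \<open>p\<close> and \<open>q\<close>, the other side
        would have an end off both, and that end would be a leaf.\<close>
      have ne: "e1 \<noteq> e2"
      proof
        assume "e1 = e2"
        then have e1pq: "e1 = {p, q}" using e1 e2 pq(2) edge_pair[OF sides_E[OF f e1(1)] e1(2)] by auto
        obtain e3 where e3: "sides f = {e1, e3}" "e3 \<noteq> e1"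
          using card_2_other[OF 2 e1(1)] by metis
        have e3E: "e3 \<in> E" using sides_E[OF f, of e3] e3 by auto
        obtain m where m: "m \<in> e3" "m \<notin> {p, q}"
        proof -
          have "card e3 = card {p, q}" using E2[OF e3E] pq(2) by simp
          then have "\<not> e3 \<subseteq> {p, q}" using e3(2) e1pq card_subset_eq[of "{p, q}" e3] by auto
          then show ?thesis using that by blast
        qed
        have "(\<exists>e'\<in>sides f. e' \<noteq> e3 \<and> m \<in> e') \<or> (\<exists>x\<in>turns f. m \<in> corner f x)"
          by (rule degree_side) (use f e3 m in auto)
        then show False using e3 t pq m e1pq by auto
      qed
      have eq: "sides f = {e1, e2}"
        using card_subset_eq[OF fin_sides[OF f], of "{e1, e2}"] e1 e2 ne 2 by simp
      obtain m where m: "e1 = {p, m}" "m \<noteq> p" using edge_pair[OF sides_E[OF f e1(1)] e1(2)] by metis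
      obtain m' where m': "e2 = {q, m'}" "m' \<noteq> q" using edge_pair[OF sides_E[OF f e2(1)] e2(2)] by metis
      \<comment> \<open>The outer ends of the two sides each need a second incidence, which only the
        other side can supply.\<close>
      have mm: "m = m'"
      proof -
        have mq: "m \<noteq> q"
        proof
          assume mq: "m = q"
          then have "m' \<noteq> p" using ne m m' by (auto simp: insert_commute)
          moreover have "(\<exists>e'\<in>sides f. e' \<noteq> e2 \<and> m' \<in> e') \<or> (\<exists>x\<in>turns f. m' \<in> corner f x)"
            by (rule degree_side) (use f e2 m' in auto)
          ultimately show False using eq m m' mq t pq by auto
        qed
        have "(\<exists>e'\<in>sides f. e' \<noteq> e1 \<and> m \<in> e') \<or> (\<exists>x\<in>turns f. m \<in> corner f x)"
          by (rule degree_side) (use f e1 m in auto)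
        then show ?thesis using eq m m' mq t pq by auto
      qed
      have pl: "plain e1" "plain e2" using e1 e2 f unfolding plain_def by auto
      have "({q, m} \<in> x \<and> plain {p, m}) \<or> ({p, m} \<in> x \<and> plain {q, m})"
        by (rule weak_turn_other[OF f xt pq(1) wk]) (use sides_E[OF f e1(1)] sides_E[OF f e2(1)] m m' mm in auto)
      then have "touching x" using plain_crossed[OF pl(1)] plain_crossed[OF pl(2)] m m' mm turnsD[OF xt] by auto
      then show False using weak_nontouching[OF wk] by blast
    qed
    then show ?thesis using that(2)[OF 2] by blast
  next
    case 3
    then show ?thesis using that(3) by blast
  qed
qed

text \<open>Both turns have the same ends \<open>p\<close> and \<open>q\<close>, and weakness of
  both gives the same common neighbour \<open>z\<close>. Proper crossings contain no plain edge, so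
  \<open>x\<close> and \<open>y\<close> would contain the same one of the two edges at
  \<open>z\<close>; but distinct crossings have no common edge.\<close>

lemma two_turns:
  assumes f: "f \<in> Fs" and t: "turns f = {x, y}" "x \<noteq> y" and s: "sides f = {}"
  shows "\<not> weak x (corner f x) \<or> \<not> weak y (corner f y)"
proof (rule ccontr)
  assume "\<not> ?thesis"
  then have wk: "weak x (corner f x)" "weak y (corner f y)" by auto
  have xt: "x \<in> turns f" "y \<in> turns f" using t by auto
  have xX: "x \<in> X" "y \<in> X" using xt turnsD by blast+
  obtain p q where pq: "corner f x = {p, q}" "p \<noteq> q" using turn_pair[OF f xt(1)] by metis
  have "corner f x \<subseteq> corner f y" using degree_turn[OF f xt(1)] t s by auto
  moreover have "card (corner f x) = card (corner f y)" using corner_card f turnsD xt by metis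
  ultimately have pqy: "corner f y = {p, q}" using pq card_subset_eq fin_corner[OF f xX(2)] by metis
  obtain z where z: "distinct [p, q, z]" "{p, z} \<in> E" "{q, z} \<in> E"
    "({q, z} \<in> x \<and> plain {p, z}) \<or> ({p, z} \<in> x \<and> plain {q, z})"
    by (rule weak_nbr[OF xX(1) turn_Cs[OF f xt(1)] pq(1) wk(1)]) (rule that)
  have zy: "({q, z} \<in> y \<and> plain {p, z}) \<or> ({p, z} \<in> y \<and> plain {q, z})"
    by (rule weak_turn_other[OF f xt(2) pqy wk(2)]) (use z in auto)
  have d: "e \<notin> y" if "e \<in> x" for e using X_disj[OF xX that] t(2) by blast
  have np: "\<not> plain e" if "e \<in> x \<or> e \<in> y" for e
    using plain_crossed[of e] that xX weak_nontouching wk by blast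
  show False using z(4) zy d np by blast
qed

definition charge :: "'f \<Rightarrow> nat" where
  "charge f = (\<Sum>e\<in>side0 f. sg f) + (\<Sum>x\<in>{x \<in> X. corner f x \<noteq> {}}. h x (corner f x))"

text \<open>A flat brings 14, the larger value of \<open>sg\<close>, so it can be counted as a side
  even in a poor face.\<close>

lemma charge_ge:
  assumes f: "f \<in> Fs"
  shows "card (sides f) * sg f + (\<Sum>x\<in>turns f. h x (corner f x)) \<le> charge f"
proof -
  have 1: "{x \<in> X. corner f x \<noteq> {}} = flats f \<union> turns f"
  proof (intro set_eqI iffI)
    fix x assume "x \<in> flats f \<union> turns f"
    then show "x \<in> {x \<in> X. corner f x \<noteq> {}}" using X_ne[of x] unfolding flats_def turns_def by auto
  qed (auto simp: flats_def turns_def)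
  have 2: "flats f \<inter> turns f = {}" unfolding flats_def turns_def by auto
  have "charge f = (\<Sum>e\<in>side0 f. sg f) + ((\<Sum>x\<in>flats f. h x (corner f x)) + (\<Sum>x\<in>turns f. h x (corner f x)))"
    unfolding charge_def 1 by (simp only: sum.union_disjoint[OF fin_flats fin_turns 2])
  moreover have "(\<Sum>x\<in>flats f. h x (corner f x)) \<ge> (\<Sum>x\<in>flats f. sg f)"
    by (rule sum_mono) (auto simp: flats_def h_def sg_def)
  ultimately show ?thesis unfolding card_sides[OF f] by (simp add: add_mult_distrib)
qed

text \<open>The tight cases are four sides (\<open>4 * 10\<close>), a digon of a side and a turn
  (\<open>10 + 30\<close> or \<open>14 + 26\<close>) and two turns of which one is weak
  (\<open>22 + 18\<close>). Three sides give \<open>3 * 14\<close>, two sides with one turn at least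
  \<open>2 * 10 + 22\<close>, three turns at least \<open>3 * 18\<close>.\<close>

lemma charge_ge_40:
  assumes f: "f \<in> Fs"
  shows "40 \<le> charge f"
proof -
  let ?s = "card (sides f)" and ?T = "\<Sum>x\<in>turns f. h x (corner f x)"
  have ge: "?s * sg f + ?T \<le> charge f" by (rule charge_ge[OF f])
  have s10: "?s * 10 \<le> ?s * sg f" using sg_ge by simp
  have T18: "card (turns f) * 18 \<le> ?T"
    using sum_mono[of "turns f" "\<lambda>_. 18" "\<lambda>x. h x (corner f x)"] h_turn by simp
  consider "card (turns f) = 0" | "card (turns f) = 1" | "card (turns f) = 2" | "3 \<le> card (turns f)" by linarith
  then show ?thesis
  proof cases
    case 1
    then have t: "turns f = {}" using fin_turns by auto
    obtain e where e: "e \<in> sides f" using nonempty_face[OF f t] by blast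
    obtain p q where pq: "e = {p, q}" "p \<noteq> q" using E2[OF sides_E[OF f e]] by (auto simp: card_2_iff)
    have s3: "3 \<le> ?s" using no_turns[OF f t] e pq by metis
    show ?thesis
    proof (cases "?s = 3")
      case True
      then have "sg f = 14" using t unfolding sg_def poor_def by auto
      then show ?thesis using ge True by simp
    next
      case False
      then show ?thesis using ge s10 s3 by linarith
    qed
  next
    case 2
    then obtain x where t: "turns f = {x}" by (auto simp: card_1_singleton_iff)
    have xt: "x \<in> turns f" using t by simp
    have T: "?T = h x (corner f x)" using t by simp
    from f t show ?thesis
    proof (cases rule: one_turn)
      case 1
      have Kf: "Kface f" using t 1 unfolding Kface_def by simp
      have Kc: "corner f x \<in> Kc x" using Kf f turnsD[OF xt] unfolding Kc_def by blast
      show ?thesis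
      proof (cases "touching x \<or> card (Kc x) = 1")
        case True
        then have "h x (corner f x) = 30" using Kc turnsD[OF xt] unfolding h_def by auto
        then show ?thesis using ge s10 T 1 by linarith
      next
        case False
        then have "sg f = 14" using Kf xt unfolding sg_def poor_def by auto
        moreover have "h x (corner f x) = 26" using Kc False turnsD[OF xt] unfolding h_def by auto
        ultimately show ?thesis using ge T 1 by simp
      qed
    next
      case 2
      then show ?thesis using ge s10 T h_turn(2)[OF xt] by linarith
    next
      case 3
      then show ?thesis using ge s10 T h_turn(1)[OF xt] by linarith
    qed
  next
    case 3
    then obtain x y where t: "turns f = {x, y}" "x \<noteq> y" by (auto simp: card_2_iff)
    have xt: "x \<in> turns f" "y \<in> turns f" using t by auto
    have T: "?T = h x (corner f x) + h y (corner f y)" using t by simp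
    show ?thesis
    proof (cases "sides f = {}")
      case True
      then show ?thesis using two_turns[OF f t] ge T h_turn[OF xt(1)] h_turn[OF xt(2)] by fastforce
    next
      case False
      then have "?s \<noteq> 0" using fin_sides[OF f] by simp
      then show ?thesis using ge s10 T18 3 by linarith
    qed
  next
    case 4
    then show ?thesis using ge T18 by linarith
  qed
qed

end

section \<open>What an edge and a crossing give away\<close>

lemma subset_4_no_opposite:
  assumes "K \<subseteq> {k1, k2, k3, k4}" "\<not> (k1 \<in> K \<and> k3 \<in> K)" "\<not> (k2 \<in> K \<and> k4 \<in> K)"
  shows "K = {} \<or> K = {k1} \<or> K = {k2} \<or> K = {k3} \<or> K = {k4} \<or>
    K = {k1, k2} \<or> K = {k2, k3} \<or> K = {k3, k4} \<or> K = {k4, k1}"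
proof -
  have "K \<in> Pow {k1, k2, k3, k4}" using assms(1) by simp
  then show ?thesis using assms(2,3) by (simp only: Pow_insert Pow_empty image_insert image_empty image_Un Un_iff insert_iff empty_iff) (elim disjE; simp add: insert_commute)
qed

context face_structure
begin

text \<open>Critical corners are edges of the graph; two opposite ones form a 4-cycle with the two
  crossing edges.\<close>

lemma Kc_opposite:
  assumes x: "x \<in> X" "\<not> touching x" and abcd: "x = {{a, b}, {c, d}}" "distinct [a, b, c, d]"
  shows "\<not> ({a, c} \<in> Kc x \<and> {b, d} \<in> Kc x)"
proof
  assume K: "{a, c} \<in> Kc x \<and> {b, d} \<in> Kc x"
  have "{a, c} \<in> E" "{b, d} \<in> E" using Kc_props(2)[OF x] K by auto
  moreover have "{a, b} \<in> E" "{c, d} \<in> E" using X_E[OF x(1)] abcd(1) by auto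
  ultimately show False using no_C4[of a c d b] abcd(2) by (auto simp: insert_commute)
qed

lemma Kc_opposite':
  assumes x: "x \<in> X" "\<not> touching x" and abcd: "x = {{a, b}, {c, d}}" "distinct [a, b, c, d]"
  shows "\<not> ({a, d} \<in> Kc x \<and> {b, c} \<in> Kc x)"
proof -
  have "{d, c} = {c, d}" by (rule insert_commute)
  then have "x = {{a, b}, {d, c}}" "distinct [a, b, d, c]" using abcd by auto
  then show ?thesis by (rule Kc_opposite[OF x])
qed

lemma Kc_sub: "x \<in> X \<Longrightarrow> \<not> touching x \<Longrightarrow> Kc x \<subseteq> Cs x"
  using Kc_props(3) by blast

text \<open>Since \<open>Kc x\<close> contains \<open>{p, q}\<close> and is not a singleton, it has
  a second element, which meets \<open>{p, q}\<close> because opposite critical corners are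
  excluded. These two edges and an edge of the crossing form a triangle.\<close>

lemma poor_K:
  assumes f: "f \<in> Fs" "Kface f" and x: "x \<in> turns f" "\<not> touching x" "card (Kc x) \<noteq> 1" and pq: "{p, q} \<in> sides f" "p \<noteq> q"
  obtains r where "r \<noteq> p" "r \<noteq> q" "{p, r} \<in> E" "{q, r} \<in> E" "corner f x = {p, q}"
    "({p, r} \<in> x \<and> plain {q, r}) \<or> ({q, r} \<in> x \<and> plain {p, r})"
proof -
  have xX: "x \<in> X" using turnsD x by blast
  have c: "corner f x = {p, q}" using Kface_side[OF f x(1)] pq by auto
  have pqK: "{p, q} \<in> Kc x" unfolding Kc_def using f c by force
  have "Kc x \<noteq> {{p, q}}" using x(3) by auto
  then obtain k where k: "k \<in> Kc x" "k \<noteq> {p, q}" using pqK by blast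
  note kp = Kc_props[OF xX x(2) k(1)]
  obtain a b c' d where abcd: "distinct [a, b, c', d]" "x = {{a, b}, {c', d}}" using X_cases[OF xX] by metis
  have opp: "\<not> ({a, c'} \<in> Kc x \<and> {b, d} \<in> Kc x)" by (rule Kc_opposite[OF xX x(2) abcd(2,1)])
  have opp': "\<not> ({a, d} \<in> Kc x \<and> {b, c'} \<in> Kc x)"
    by (rule Kc_opposite'[OF xX x(2) abcd(2,1)])
  have meet: "L \<inter> P \<noteq> {}" if PL: "P \<in> Kc x" "L \<in> Kc x" for P L
  proof -
    have Cs: "Cs x = {{a, c'}, {c', b}, {b, d}, {d, a}}" by (rule Cs_proper[OF xX x(2) abcd(2,1)])
    have "P \<in> Cs x" "L \<in> Cs x" using subsetD[OF Kc_sub[OF xX x(2)]] PL by simp_all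
    then have "P = {a, c'} \<or> P = {a, d} \<or> P = {b, c'} \<or> P = {b, d}"
      "L = {a, c'} \<or> L = {a, d} \<or> L = {b, c'} \<or> L = {b, d}"
      unfolding Cs by (simp_all add: insert_commute)
    then show ?thesis using PL opp opp' by (elim disjE) simp_all
  qed
  have "k \<inter> {p, q} \<noteq> {}" by (rule meet[OF pqK k(1)])
  then obtain u w where uw: "u \<in> k" "{p, q} = {u, w}" "u \<noteq> w" "(u = p \<and> w = q) \<or> (u = q \<and> w = p)"
    using pq(2) by auto
  obtain r where r: "k = {u, r}" "r \<noteq> u" using edge_pair[OF kp(2) uw(1)] by metis
  have rw: "r \<noteq> w"
  proof
    assume "r = w"
    then show False using k(2) r(1) uw(2) by simp
  qed
  have C: "{u, w} \<in> Cs x" "{u, r} \<in> Cs x" using subsetD[OF Kc_sub[OF xX x(2)]] pqK k(1) uw(2) r(1) by simp_all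
  have "{u, w} \<subseteq> \<Union>x" "{u, r} \<subseteq> \<Union>x" by (rule Cs_sub(1)[OF xX C(1)], rule Cs_sub(1)[OF xX C(2)])
  moreover have "{u, w} \<notin> x" "{u, r} \<notin> x"
    using x(2)[unfolded touching_def] C by (meson bexI)+
  moreover have "distinct [u, w, r]" using uw(3) r(2) rw by simp
  ultimately have wr: "{w, r} \<in> x" by (rule third_in_crossing[OF xX])
  have wrE: "{w, r} \<in> E" using X_E[OF xX wr] .
  have ur: "plain {u, r}" "{u, r} \<in> E" using kp r(1) by simp_all
  from uw(4) show ?thesis
  proof (elim disjE conjE)
    assume "u = p" "w = q"
    then show ?thesis using that[of r] r(2) rw ur wr wrE c by simp
  next
    assume "u = q" "w = p"
    then show ?thesis using that[of r] r(2) rw ur wr wrE c by simp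
  qed
qed

text \<open>This extends \<open>share_side\<close> to flats: a common flat would mean common
  half-edges at one crossing, which \<open>share_mixed\<close> excludes.\<close>

lemma sides_share:
  assumes "f \<in> Fs" "g \<in> Fs" "f \<noteq> g" "e \<in> side0 f" "e \<in> side0 g" "e' \<in> sides f" "e' \<in> sides g"
  shows "e' = e"
proof (cases "e' \<in> \<Union>X")
  case False
  then have "e' \<in> side0 f" "e' \<in> side0 g" using assms(6,7) unfolding sides_def flats_def by auto
  then show ?thesis using share_side[OF assms(1-5)] by blast
next
  case True
  then have "e' \<notin> side0 f" "e' \<notin> side0 g" using side0_sub assms(1,2) by blast+
  then obtain x y where x: "x \<in> X" "corner f x \<in> x" "e' = corner f x"
    and y: "y \<in> X" "corner g y \<in> y" "e' = corner g y"
    using assms(6,7) unfolding sides_def flats_def by blast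
  have "x = y" using X_disj[of x y e'] x y by auto
  moreover have "e' \<noteq> {}" using X_ne[OF x(1)] x(2,3) by metis
  then obtain v where "v \<in> e'" by blast
  ultimately have False using share_mixed[OF assms(1-5) x(1), of v] x y by auto
  then show ?thesis ..
qed

text \<open>Poor faces take 14 instead of 10 from an edge, so this keeps the charge of an edge at 24.
  Two poor faces would put \<open>e\<close> into two triangles, which coincide by \<open>C4_free\<close>.\<close>

lemma one_poor:
  assumes fg: "f \<in> Fs" "g \<in> Fs" "f \<noteq> g" "e \<in> side0 f" "e \<in> side0 g"
  shows "\<not> (poor f \<and> poor g)"
proof
  assume P: "poor f \<and> poor g"
  have eE: "e \<in> E" using side0_sub fg by blast
  obtain p q where e: "e = {p, q}" "p \<noteq> q" using E2[OF eE] by (auto simp: card_2_iff)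
  define tri where "tri f r \<longleftrightarrow> {p, r} \<in> sides f \<and> {q, r} \<in> sides f" for f r
  define kf where "kf f r \<longleftrightarrow> (\<exists>x\<in>X. \<not> touching x \<and> corner f x = {p, q} \<and>
    ({p, r} \<in> x \<and> plain {q, r} \<or> {q, r} \<in> x \<and> plain {p, r}))" for f r
  have cs: "\<exists>r. r \<noteq> p \<and> r \<noteq> q \<and> {p, r} \<in> E \<and> {q, r} \<in> E \<and> (tri f r \<or> kf f r)"
    if f: "f \<in> Fs" "{p, q} \<in> sides f" "poor f" for f
  proof (cases "turns f = {} \<and> card (sides f) = 3")
    case True
    then obtain r where "r \<noteq> q" "r \<noteq> p" "{p, r} \<in> sides f" "{q, r} \<in> sides f"
      using no_turns[OF f(1) _ f(2) e(2)] by metis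
    then show ?thesis using sides_E[OF f(1)] unfolding tri_def by blast
  next
    case False
    then obtain x where x: "Kface f" "x \<in> turns f" "\<not> touching x" "card (Kc x) \<noteq> 1"
      using f(3) unfolding poor_def by blast
    obtain r where "r \<noteq> p" "r \<noteq> q" "{p, r} \<in> E" "{q, r} \<in> E" "corner f x = {p, q}"
      "({p, r} \<in> x \<and> plain {q, r}) \<or> ({q, r} \<in> x \<and> plain {p, r})"
      by (rule poor_K[OF f(1) x f(2) e(2)]) (rule that)
    then show ?thesis using x(2,3) turnsD unfolding kf_def by blast
  qed
  have es: "{p, q} \<in> sides f" "{p, q} \<in> sides g" using fg e unfolding sides_def by auto
  obtain r where r: "r \<noteq> p" "r \<noteq> q" "{p, r} \<in> E" "{q, r} \<in> E" "tri f r \<or> kf f r"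
    using cs[OF fg(1) es(1)] P by blast
  obtain s where s: "s \<noteq> p" "s \<noteq> q" "{p, s} \<in> E" "{q, s} \<in> E" "tri g s \<or> kf g s"
    using cs[OF fg(2) es(2)] P by blast
  have "s = r"
  proof (rule ccontr)
    assume "s \<noteq> r"
    then show False using no_C4[of p r q s] r s e by (auto simp: insert_commute)
  qed
  then have s': "tri g r \<or> kf g r" using s by simp
  have tri_plain: "plain {p, r} \<and> plain {q, r}" if "tri f r" "f \<in> Fs" for f
    using that unfolding tri_def plain_def by blast
  have np: False if "kf f r" "plain {p, r}" "plain {q, r}" for f
    using that plain_crossed unfolding kf_def by blast
  \<comment> \<open>Two facial triangles would share more than the side \<open>e\<close>. In a mixed
    pair the triangle makes both edges at \<open>r\<close> plain, but one of them lies in a proper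
    crossing. Two digons would have the same crossing and the same corner there, hence coincide by
    \<open>corner_inj\<close>.\<close>
  consider "tri f r" "tri g r" | "tri f r" "kf g r" | "kf f r" "tri g r" | "kf f r" "kf g r"
    using r(5) s' by blast
  then show False
  proof cases
    case 1
    then have "{p, r} = e" using sides_share[OF fg] unfolding tri_def by blast
    then show False using e r(1,2) by (auto simp: doubleton_eq_iff)
  next
    case 2
    then show False using np tri_plain fg(1) by blast
  next
    case 3
    then show False using np tri_plain fg(2) by blast
  next
    case 4
    obtain x where x: "x \<in> X" "\<not> touching x" "corner f x = {p, q}"
      "({p, r} \<in> x \<and> plain {q, r} \<or> {q, r} \<in> x \<and> plain {p, r})"
      using 4(1) unfolding kf_def by blast
    obtain y where y: "y \<in> X" "\<not> touching y" "corner g y = {p, q}"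
      "({p, r} \<in> y \<and> plain {q, r} \<or> {q, r} \<in> y \<and> plain {p, r})"
      using 4(2) unfolding kf_def by blast
    have "\<not> plain {p, r} \<or> {p, r} \<notin> x \<and> {p, r} \<notin> y" "\<not> plain {q, r} \<or> {q, r} \<notin> x \<and> {q, r} \<notin> y"
      using plain_crossed x(1,2) y(1,2) by metis+
    then have "{p, r} \<in> x \<and> {p, r} \<in> y \<or> {q, r} \<in> x \<and> {q, r} \<in> y" using x(4) y(4) by satx
    then have xy: "x = y" using X_disj[OF x(1) y(1)] by metis
    have "corner f x = corner g x" "corner f x \<noteq> {}" using x(3) y(3) xy by simp_all
    then show False using corner_inj[OF fg(1,2) x(1)] fg(3) by metis
  qed
qed

lemma edge_charge:
  assumes e: "e \<in> E - \<Union>X"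
  shows "(\<Sum>f\<in>{f \<in> Fs. e \<in> side0 f}. sg f) \<le> 24"
proof -
  obtain f g where fg: "f \<noteq> g" "{f \<in> Fs. e \<in> side0 f} = {f, g}"
    using side0_two[OF e] by (auto simp: card_2_iff)
  then have "f \<in> {f \<in> Fs. e \<in> side0 f}" "g \<in> {f \<in> Fs. e \<in> side0 f}" by simp_all
  then have "\<not> (poor f \<and> poor g)" using one_poor[of f g e] fg(1) by simp
  then show ?thesis unfolding fg(2) using fg(1) by (auto simp: sg_def)
qed

text \<open>Opposite critical corners being excluded, \<open>Kc x\<close> is empty, a single corner
  or two adjacent ones. A noncritical corner next to a critical one is weak, while the corner
  opposite to a single critical one is disjoint from it and keeps 22.\<close>

lemma proper_sum:
  assumes x: "x \<in> X" "\<not> touching x"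
  shows "(\<Sum>p\<in>Cs x. h x p) \<le> 88"
proof -
  obtain a b c d where abcd: "distinct [a, b, c, d]" "x = {{a, b}, {c, d}}" using X_cases[OF x(1)] by metis
  have Cs: "Cs x = {{a, c}, {c, b}, {b, d}, {d, a}}" by (rule Cs_proper[OF x abcd(2,1)])
  have opp: "\<not> ({a, c} \<in> Kc x \<and> {b, d} \<in> Kc x)" by (rule Kc_opposite[OF x abcd(2,1)])
  have opp': "\<not> ({c, b} \<in> Kc x \<and> {d, a} \<in> Kc x)"
    using Kc_opposite'[OF x abcd(2,1)] by (simp only: insert_commute) blast
  have Ksub: "Kc x \<subseteq> {{a, c}, {c, b}, {b, d}, {d, a}}" using Kc_sub[OF x] Cs by simp
  have ne: "{a, c} \<noteq> {c, b}" "{a, c} \<noteq> {b, d}" "{a, c} \<noteq> {d, a}" "{c, b} \<noteq> {b, d}" "{c, b} \<noteq> {d, a}" "{b, d} \<noteq> {d, a}"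
    using abcd(1) by (auto simp: doubleton_eq_iff)
  have nx: "p \<notin> x" if "p \<in> Cs x" for p using x(2) that unfolding touching_def by blast
  have hp: "h x p = (if p \<in> Kc x then (if card (Kc x) = 1 then 30 else 26)
     else if card (p \<inter> \<Union>(Kc x)) = 1 then 18 else 22)" if "p \<in> Cs x" for p
    using nx[OF that] x(2) unfolding h_def weak_def by auto
  have sum: "(\<Sum>p\<in>Cs x. h x p) = h x {a, c} + h x {c, b} + h x {b, d} + h x {d, a}"
    unfolding Cs by (simp add: ne)
  have C: "{a, c} \<in> Cs x" "{c, b} \<in> Cs x" "{b, d} \<in> Cs x" "{d, a} \<in> Cs x" unfolding Cs by simp_all
  have "Kc x = {} \<or> Kc x = {{a, c}} \<or> Kc x = {{c, b}} \<or> Kc x = {{b, d}} \<or> Kc x = {{d, a}} \<or>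
    Kc x = {{a, c}, {c, b}} \<or> Kc x = {{c, b}, {b, d}} \<or> Kc x = {{b, d}, {d, a}} \<or> Kc x = {{d, a}, {a, c}}"
    by (rule subset_4_no_opposite[OF Ksub]) (use opp opp' in simp_all)
  moreover have "a \<noteq> b" "a \<noteq> c" "a \<noteq> d" "b \<noteq> c" "b \<noteq> d" "c \<noteq> d"
    "b \<noteq> a" "c \<noteq> a" "d \<noteq> a" "c \<noteq> b" "d \<noteq> b" "d \<noteq> c"
    using abcd(1) by auto
  ultimately show ?thesis unfolding sum hp[OF C(1)] hp[OF C(2)] hp[OF C(3)] hp[OF C(4)]
    by (elim disjE) (simp_all add: doubleton_eq_iff Int_insert_left)
qed

lemma crossing_sum:
  assumes x: "x \<in> X"
  shows "(\<Sum>p\<in>Cs x. h x p) \<le> 88"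
proof (cases "touching x")
  case False
  then show ?thesis using proper_sum x by blast
next
  case True
  then obtain a b c d where abcd: "x = {{a, b}, {c, d}}" "distinct [a, b, c, d]"
    "Cs x = {{a, b}, {c, d}, {b, c}, {d, a}}" using Cs_touching[OF x] by metis
  have "{b, c} \<notin> x" "{d, a} \<notin> x" using abcd by (auto simp: doubleton_eq_iff)
  moreover have "{a, b} \<noteq> {c, d}" "{a, b} \<noteq> {b, c}" "{a, b} \<noteq> {d, a}" "{c, d} \<noteq> {b, c}" "{c, d} \<noteq> {d, a}" "{b, c} \<noteq> {d, a}"
    using abcd(2) by (auto simp: doubleton_eq_iff)
  moreover have "{a, b} \<in> x" "{c, d} \<in> x" using abcd by auto
  ultimately show ?thesis unfolding abcd(3) using True by (simp add: h_def)
qed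

text \<open>By \<open>corner_inj\<close> the faces at \<open>x\<close> correspond to its corners, so
  the sum may be taken over \<open>Cs x\<close>.\<close>

lemma crossing_charge:
  assumes x: "x \<in> X"
  shows "(\<Sum>f\<in>{f \<in> Fs. corner f x \<noteq> {}}. h x (corner f x)) \<le> 88"
proof -
  have inj: "inj_on (\<lambda>f. corner f x) {f \<in> Fs. corner f x \<noteq> {}}"
    by (rule inj_onI) (use corner_inj x in blast)
  have "Cs x = (\<lambda>f. corner f x) ` {f \<in> Fs. corner f x \<noteq> {}}" unfolding Cs_def by auto
  then have "(\<Sum>p\<in>Cs x. h x p) = (\<Sum>f\<in>{f \<in> Fs. corner f x \<noteq> {}}. h x (corner f x))"
    by (simp add: sum.reindex[OF inj])
  then show ?thesis using crossing_sum[OF x] by simp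
qed

text \<open>The total charge is counted by faces and by its sources, which gives
  \<open>40 * card Fs \<le> 24 * card (E - \<Union>X) + 88 * card X\<close>; this is 8 times the
  claim.\<close>

theorem face_count: "5 * card Fs \<le> 3 * card (E - \<Union>X) + 11 * card X"
proof -
  have "40 * card Fs \<le> (\<Sum>f\<in>Fs. charge f)"
    using sum_mono[of Fs "\<lambda>_. 40" charge] charge_ge_40 by simp
  also have "\<dots> = (\<Sum>f\<in>Fs. \<Sum>e\<in>side0 f. sg f) + (\<Sum>f\<in>Fs. \<Sum>x\<in>{x \<in> X. corner f x \<noteq> {}}. h x (corner f x))"
    unfolding charge_def by (simp add: sum.distrib)
  also have "(\<Sum>f\<in>Fs. \<Sum>x\<in>{x \<in> X. corner f x \<noteq> {}}. h x (corner f x)) =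
      (\<Sum>x\<in>X. \<Sum>f\<in>{f \<in> Fs. corner f x \<noteq> {}}. h x (corner f x))"
    by (rule sum.swap_restrict[OF finF finX])
  also have "\<dots> \<le> (\<Sum>x\<in>X. 88)" by (rule sum_mono) (rule crossing_charge)
  also have "(\<Sum>f\<in>Fs. \<Sum>e\<in>side0 f. sg f) = (\<Sum>f\<in>Fs. \<Sum>e\<in>{e \<in> E - \<Union>X. e \<in> side0 f}. sg f)"
  proof (rule sum.cong[OF refl])
    fix f assume "f \<in> Fs"
    then have "{e \<in> E - \<Union>X. e \<in> side0 f} = side0 f" using side0_sub by blast
    then show "(\<Sum>e\<in>side0 f. sg f) = (\<Sum>e\<in>{e \<in> E - \<Union>X. e \<in> side0 f}. sg f)" by simp
  qed
  also have "\<dots> = (\<Sum>e\<in>E - \<Union>X. \<Sum>f\<in>{f \<in> Fs. e \<in> side0 f}. sg f)"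
    by (rule sum.swap_restrict) (use finF finE in auto)
  also have "\<dots> \<le> (\<Sum>e\<in>E - \<Union>X. 24)" by (rule sum_mono) (rule edge_charge)
  finally show ?thesis by simp
qed

end

section \<open>Planarisation of a drawing\<close>

text \<open>Meant for fat vertices: each new arc meets the union of the earlier ones only in the
  centre \<open>z\<close>, so Janiszewski's theorem keeps the complement connected.\<close>

lemma nonseparating_bouquet:
  assumes "finite \<T>"
    and "\<And>T. T \<in> \<T> \<Longrightarrow> compact T \<and> path_connected T \<and> connected (- T) \<and> z \<in> T"
    and "\<And>T T'. T \<in> \<T> \<Longrightarrow> T' \<in> \<T> \<Longrightarrow> T \<noteq> T' \<Longrightarrow> T \<inter> T' \<subseteq> {z :: complex}"
  shows "compact (insert z (\<Union>\<T>)) \<and> path_connected (insert z (\<Union>\<T>)) \<and> connected (- insert z (\<Union>\<T>))"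
  using assms
proof (induction \<T> rule: finite_induct)
  case empty
  have "connected (- {z})" by (rule connected_punctured_universe) simp
  then show ?case by (simp add: path_connected_singleton)
next
  case (insert T \<T>)
  have IH: "compact (insert z (\<Union>\<T>)) \<and> path_connected (insert z (\<Union>\<T>)) \<and> connected (- insert z (\<Union>\<T>))"
    by (rule insert.IH) (use insert.prems in auto)
  have T: "compact T \<and> path_connected T \<and> connected (- T) \<and> z \<in> T" using insert.prems(1) by simp
  have "T \<inter> T' \<subseteq> {z}" if "T' \<in> \<T>" for T'
    using insert.prems(2)[of T T'] that insert.hyps(2) by auto
  then have i: "T \<inter> insert z (\<Union>\<T>) = {z}" using T by blast
  have u: "insert z (\<Union>(insert T \<T>)) = T \<union> insert z (\<Union>\<T>)" using T by auto
  have "connected (- (T \<union> insert z (\<Union>\<T>)))"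
  proof (rule Janiszewski_connected)
    show "closed (insert z (\<Union>\<T>))" using IH compact_imp_closed by blast
    show "connected (T \<inter> insert z (\<Union>\<T>))" unfolding i by simp
  qed (use T IH in blast)+
  moreover have "path_connected (T \<union> insert z (\<Union>\<T>))"
    by (rule path_connected_Un) (use T IH in auto)
  moreover have "compact (T \<union> insert z (\<Union>\<T>))" using T IH compact_Un by blast
  ultimately show ?case unfolding u by blast
qed

text \<open>As \<open>crossings\<close> counts pairs of an edge and a point, 1-planarity forbids a
  second partner as well as a second meeting point with the same partner; \<open>once\<close>
  expresses both.\<close>

locale one_planar =
  fixes V :: "'a set" and E :: "'a set set" and pos :: "'a \<Rightarrow> complex" and A :: "'a set \<Rightarrow> complex set"
  assumes graph: "simple_graph V E"
    and inj: "inj_on pos V"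
    and arcs: "\<And>a b. {a, b} \<in> E \<Longrightarrow> arc_between (A {a, b}) (pos a) (pos b)"
    and meets: "\<And>e. e \<in> E \<Longrightarrow> A e \<inter> pos ` V = pos ` e"
    and once: "\<And>e f g p q. \<lbrakk>e \<in> E; f \<in> E; g \<in> E; f \<noteq> e; g \<noteq> e; p \<in> A e \<inter> A f; q \<in> A e \<inter> A g;
        p \<notin> pos ` V; q \<notin> pos ` V\<rbrakk> \<Longrightarrow> f = g \<and> p = q"
begin

definition crosses :: "'a set \<Rightarrow> 'a set \<Rightarrow> complex \<Rightarrow> bool" where
  "crosses e f p \<longleftrightarrow> e \<in> E \<and> f \<in> E \<and> f \<noteq> e \<and> p \<in> A e \<inter> A f \<and> p \<notin> pos ` V"
definition crossed :: "'a set \<Rightarrow> bool" where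
  "crossed e \<longleftrightarrow> (\<exists>f p. crosses e f p)"
text \<open>\<open>mate\<close> and \<open>pt\<close>, the partner and the point of the crossing, are junk on uncrossed edges;
  \<open>apex\<close> and \<open>far\<close> are junk unless the edge crosses an edge with a common end.\<close>

definition mate :: "'a set \<Rightarrow> 'a set" where
  "mate e = (SOME f. \<exists>p. crosses e f p)"
definition pt :: "'a set \<Rightarrow> complex" where
  "pt e = (SOME p. crosses e (mate e) p)"
definition adj :: "'a set \<Rightarrow> bool" where
  "adj e \<longleftrightarrow> crossed e \<and> e \<inter> mate e \<noteq> {}"
definition X :: "'a set set set" where
  "X = {{e, mate e} | e. crossed e \<and> e \<inter> mate e = {}}"
definition apex :: "'a set \<Rightarrow> 'a" where
  "apex e = (THE v. v \<in> e \<inter> mate e)"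
definition far :: "'a set \<Rightarrow> 'a" where
  "far e = (THE v. v \<in> e \<and> v \<noteq> apex e)"
text \<open>Of two crossing edges with a common end, the stem is the one whose initial segment is added to
  the common end.\<close>

definition stem :: "'a set \<Rightarrow> bool" where
  "stem e \<longleftrightarrow> adj e \<and> e = (SOME e'. e' \<in> {e, mate e})"
text \<open>One function yields both halves, so that they come from the same cut of the arc. The
  names \<open>a\<close> and \<open>b\<close> are quantified inside because an edge carries no
  orientation.\<close>

definition H :: "'a set \<Rightarrow> 'a \<Rightarrow> complex set" where
  "H e = (SOME h. \<forall>a b. e = {a, b} \<and> a \<noteq> b \<longrightarrow>
     arc_between (h a) (pos a) (pt e) \<and> h a \<union> h b = A e \<and> h a \<inter> h b = {pt e})"

section \<open>Crossings and half-arcs of a 1-planar drawing\<close>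

lemma finV: "finite V" and edge: "e \<in> E \<Longrightarrow> e \<subseteq> V \<and> card e = 2"
  using graph unfolding simple_graph_def by auto

lemma finE: "finite E"
  using edge finV by (meson PowI finite_Pow_iff finite_subset subsetI)

lemma edge_pair:
  assumes "e \<in> E" "v \<in> e"
  obtains w where "e = {v, w}" "w \<noteq> v" "v \<in> V" "w \<in> V"
proof -
  obtain w where "e = {v, w}" "w \<noteq> v" using card_2_other[OF _ assms(2)] edge[OF assms(1)] by metis
  then show ?thesis using that[of w] edge[OF assms(1)] by blast
qed

lemma crosses_sym: "crosses e f p \<Longrightarrow> crosses f e p"
  unfolding crosses_def by auto

lemma crosses_unique: "crosses e f p \<Longrightarrow> crosses e g q \<Longrightarrow> f = g \<and> p = q"
  unfolding crosses_def using once[of e f g p q] by blast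

lemma crossed_crosses:
  assumes "crossed e"
  shows "crosses e (mate e) (pt e)"
proof -
  have "\<exists>p. crosses e (mate e) p" unfolding mate_def by (rule someI_ex) (use assms crossed_def in blast)
  then show ?thesis unfolding pt_def by (rule someI_ex)
qed

lemma crosses_mate: "crosses e f p \<Longrightarrow> crossed e \<and> f = mate e \<and> p = pt e"
  using crossed_crosses[of e] crosses_unique[of e f p] unfolding crossed_def by blast

lemma mate_props:
  assumes "crossed e"
  shows "crossed (mate e)" "mate (mate e) = e" "pt (mate e) = pt e" "e \<in> E" "mate e \<in> E" "mate e \<noteq> e"
    "pt e \<in> A e" "pt e \<notin> pos ` V"
proof -
  have c: "crosses e (mate e) (pt e)" by (rule crossed_crosses[OF assms])
  show "crossed (mate e)" "mate (mate e) = e" "pt (mate e) = pt e"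
    using crosses_mate[OF crosses_sym[OF c]] by auto
  show "e \<in> E" "mate e \<in> E" "mate e \<noteq> e" "pt e \<in> A e" "pt e \<notin> pos ` V"
    using c unfolding crosses_def by auto
qed

lemma pt_on:
  assumes "crossed f" "e \<in> E" "pt f \<in> A e"
  shows "e = f \<or> e = mate f"
proof (cases "e = f")
  case False
  then have "crosses f e (pt f)" using mate_props[OF assms(1)] assms unfolding crosses_def by auto
  then show ?thesis using crosses_mate by blast
qed simp

lemma A_Int:
  assumes "e \<in> E" "f \<in> E" "e \<noteq> f" "p \<in> A e" "p \<in> A f"
  shows "p \<in> pos ` (e \<inter> f) \<or> (crossed e \<and> f = mate e \<and> p = pt e)"
proof (cases "p \<in> pos ` V")
  case True
  then have "p \<in> pos ` e \<inter> pos ` f" using meets assms by blast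
  then show ?thesis using inj_on_image_Int[OF inj, of e f] edge assms by auto
next
  case False
  then have "crosses e f p" using assms unfolding crosses_def by auto
  then show ?thesis using crosses_mate by blast
qed

lemma H_props:
  assumes c: "crossed e" and e: "e = {a, b}" "a \<noteq> b"
  shows "arc_between (H e a) (pos a) (pt e)" "H e a \<union> H e b = A e" "H e a \<inter> H e b = {pt e}"
proof -
  have ab: "arc_between (A e) (pos a) (pos b)" using arcs mate_props(4)[OF c] e by auto
  have V: "a \<in> V" "b \<in> V" using edge[OF mate_props(4)[OF c]] e by auto
  have p: "pt e \<in> A e" "pt e \<noteq> pos a" "pt e \<noteq> pos b" using mate_props(7,8)[OF c] V by auto
  obtain T1 T2 where T: "arc_between T1 (pos a) (pt e)" "arc_between T2 (pos b) (pt e)" "T1 \<union> T2 = A e" "T1 \<inter> T2 = {pt e}"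
    using arc_between_split[OF ab p] by metis
  let ?h = "\<lambda>v. if v = a then T1 else T2"
  have "\<forall>a' b'. e = {a', b'} \<and> a' \<noteq> b' \<longrightarrow>
     arc_between (?h a') (pos a') (pt e) \<and> ?h a' \<union> ?h b' = A e \<and> ?h a' \<inter> ?h b' = {pt e}"
  proof (intro allI impI)
    fix a' b' assume "e = {a', b'} \<and> a' \<noteq> b'"
    then have "(a' = a \<and> b' = b) \<or> (a' = b \<and> b' = a)" using e(1) by (metis doubleton_eq_iff)
    moreover have "T2 \<union> T1 = A e" "T2 \<inter> T1 = {pt e}" using T(3,4) by (simp_all only: Un_commute Int_commute)
    ultimately show "arc_between (?h a') (pos a') (pt e) \<and> ?h a' \<union> ?h b' = A e \<and> ?h a' \<inter> ?h b' = {pt e}"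
      using T e(2) by (elim disjE) simp_all
  qed
  then have ex: "\<exists>h. \<forall>a b. e = {a, b} \<and> a \<noteq> b \<longrightarrow>
     arc_between (h a) (pos a) (pt e) \<and> h a \<union> h b = A e \<and> h a \<inter> h b = {pt e}" by (rule exI[of _ ?h])
  have "\<forall>a b. e = {a, b} \<and> a \<noteq> b \<longrightarrow>
     arc_between (H e a) (pos a) (pt e) \<and> H e a \<union> H e b = A e \<and> H e a \<inter> H e b = {pt e}"
    unfolding H_def by (rule someI_ex[OF ex])
  then show "arc_between (H e a) (pos a) (pt e)" "H e a \<union> H e b = A e" "H e a \<inter> H e b = {pt e}"
    using e by blast+
qed

lemma H_at:
  assumes "crossed e" "v \<in> e"
  shows "arc_between (H e v) (pos v) (pt e)" "H e v \<subseteq> A e" "H e v \<inter> pos ` V = {pos v}" "pt e \<in> H e v"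
proof -
  obtain w where w: "e = {v, w}" "w \<noteq> v" "v \<in> V" "w \<in> V" using edge_pair[OF mate_props(4)[OF assms(1)] assms(2)] by metis
  note h = H_props[OF assms(1) w(1) w(2)[symmetric]]
  have h': "arc_between (H e w) (pos w) (pt e)"
    using H_props(1)[OF assms(1), of w v] w by (auto simp: insert_commute)
  show "arc_between (H e v) (pos v) (pt e)" "H e v \<subseteq> A e" using h by auto
  show "pt e \<in> H e v" using arc_between_ends(2)[OF h(1)] .
  have "pos w \<notin> H e v"
  proof
    assume "pos w \<in> H e v"
    then have "pos w = pt e" using h(3) arc_between_ends(1)[OF h'] by blast
    then show False using mate_props(8)[OF assms(1)] w(4) by (metis imageI)
  qed
  moreover have "A e \<inter> pos ` V = {pos v, pos w}" using meets[OF mate_props(4)[OF assms(1)]] w(1) by simp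
  moreover have "P \<inter> Q = {p}" if "P \<subseteq> R" "p \<in> P" "q \<notin> P" "R \<inter> Q = {p, q}" for P Q R :: "complex set" and p q
    using that by blast
  ultimately show "H e v \<inter> pos ` V = {pos v}"
    using arc_between_ends(1)[OF h(1)] \<open>H e v \<subseteq> A e\<close> by metis
qed

lemma apex_far:
  assumes "adj e"
  shows "apex e \<in> e" "apex e \<in> mate e" "e \<inter> mate e = {apex e}" "far e \<in> e" "far e \<noteq> apex e" "e = {apex e, far e}"
    "adj (mate e)" "apex (mate e) = apex e"
proof -
  have c: "crossed e" using assms unfolding adj_def by blast
  obtain v where v: "v \<in> e" "v \<in> mate e" using assms unfolding adj_def by blast
  obtain w where w: "e = {v, w}" "w \<noteq> v" using edge_pair[OF mate_props(4)[OF c] v(1)] by metis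
  obtain u where u: "mate e = {v, u}" "u \<noteq> v" using edge_pair[OF mate_props(5)[OF c] v(2)] by metis
  have "u \<noteq> w" using mate_props(6)[OF c] u w by auto
  then have i: "e \<inter> mate e = {v}" using u w by auto
  have ap: "apex e = v" unfolding apex_def i by simp
  have fa: "far e = w" unfolding far_def ap using w by (intro the_equality) auto
  show "apex e \<in> e" "apex e \<in> mate e" "e \<inter> mate e = {apex e}" "far e \<in> e" "far e \<noteq> apex e" "e = {apex e, far e}"
    using ap fa v w i by auto
  show "adj (mate e)" using mate_props(1,2)[OF c] v unfolding adj_def by auto
  show "apex (mate e) = apex e" unfolding apex_def mate_props(2)[OF c] by (simp add: Int_commute)
qed

lemma adj_crossed: "adj e \<Longrightarrow> crossed e"
  unfolding adj_def by blast

lemma stem_adj: "stem e \<Longrightarrow> adj e"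
  unfolding stem_def by blast

text \<open>\<open>e\<close> and \<open>mate e\<close> choose from the same set
  \<open>{e, mate e}\<close>, so \<open>SOME\<close> selects the same edge for both.\<close>

lemma stem_mate: "stem e \<Longrightarrow> \<not> stem (mate e)"
  unfolding stem_def using mate_props(2,6)[OF adj_crossed] by (metis insert_commute)

lemma stem_exists:
  assumes "adj e"
  shows "stem e \<or> stem (mate e)"
proof -
  have "(SOME e'. e' \<in> {e, mate e}) \<in> {e, mate e}" by (rule someI[of _ e]) simp
  moreover have "{mate e, mate (mate e)} = {e, mate e}" using mate_props(2)[OF adj_crossed[OF assms]] by auto
  ultimately show ?thesis unfolding stem_def using assms apex_far(7)[OF assms] by (metis insertE singletonD)
qed

text \<open>Off the vertices \<open>f\<close> can only be met in \<open>pt f\<close>, and only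
  \<open>f\<close> and \<open>mate f\<close> pass through that point.\<close>

lemma H_Int:
  assumes e: "e \<in> E" "w \<in> V" and f: "crossed f" "v \<in> f" and ef: "e \<noteq> f" "e \<noteq> mate f"
  shows "A e \<inter> H f v \<subseteq> {pos v} \<inter> pos ` e"
proof
  fix p assume p: "p \<in> A e \<inter> H f v"
  have fE: "f \<in> E" using mate_props f by blast
  have pf: "p \<in> A f" using H_at(2)[OF f] p by blast
  have "p \<in> pos ` (f \<inter> e) \<or> (crossed f \<and> e = mate f \<and> p = pt f)"
    using A_Int[OF fE e(1) _ pf] ef(1) p by auto
  then have "p \<in> pos ` (f \<inter> e)" using ef(2) by blast
  moreover from this have "p \<in> pos ` V" using edge[OF fE] by blast
  ultimately show "p \<in> {pos v} \<inter> pos ` e" using H_at(3)[OF f] p by blast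
qed

section \<open>Blobs and edges of the planarisation\<close>

definition M :: "'a set set" where "M = E - \<Union>X"
definition ptx :: "'a set set \<Rightarrow> complex" where "ptx x = pt (SOME e. e \<in> x)"
text \<open>The blob of the common end contains \<open>pt e\<close>, where the far halves of the
  stem and of its mate both end; the initial segment of the mate is not drawn at all.\<close>

definition S :: "'a + 'a set set \<Rightarrow> complex set" where
  "S u = (case u of Inl v \<Rightarrow> insert (pos v) (\<Union>{H e v | e. stem e \<and> apex e = v}) | Inr x \<Rightarrow> {ptx x})"
definition base :: "'a set \<Rightarrow> complex set" where
  "base e = (if crossed e then H e (far e) else A e)"
definition Vs :: "('a + 'a set set) set" where "Vs = Inl ` V \<union> Inr ` X"
definition lift :: "'a set \<Rightarrow> ('a + 'a set set) set" where "lift e = Inl ` e"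
definition half :: "'a \<Rightarrow> 'a set set \<Rightarrow> ('a + 'a set set) set" where "half v x = {Inl v, Inr x}"
definition Es :: "('a + 'a set set) set set" where
  "Es = lift ` M \<union> {half v x | v x. x \<in> X \<and> v \<in> \<Union>x}"
text \<open>An edge of the planarisation is a bare set of two vertices. A crossing vertex in it
  marks a half-edge, and \<open>THE\<close> recovers the end, the crossing and the edge of the
  crossing at that end. Outside \<open>Es\<close> the value is junk.\<close>

definition I :: "('a + 'a set set) set \<Rightarrow> complex set" where
  "I c = (if c \<subseteq> range Inl then base (Inl -` c)
     else H (THE e. e \<in> (THE x. Inr x \<in> c) \<and> (THE v. Inl v \<in> c) \<in> e) (THE v. Inl v \<in> c))"

lemma X_mem:
  assumes "x \<in> X" "e \<in> x"
  shows "crossed e" "e \<inter> mate e = {}" "x = {e, mate e}" "e \<in> E" "\<not> adj e"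
proof -
  obtain f where f: "x = {f, mate f}" "crossed f" "f \<inter> mate f = {}" using assms(1) unfolding X_def by blast
  consider "e = f" | "e = mate f" using f(1) assms(2) by blast
  then show "crossed e" "e \<inter> mate e = {}" "x = {e, mate e}" "e \<in> E" "\<not> adj e"
    using f mate_props[OF f(2)] unfolding adj_def by (cases; auto)+
qed

lemma X_eq: "x \<in> X \<Longrightarrow> y \<in> X \<Longrightarrow> e \<in> x \<Longrightarrow> e \<in> y \<Longrightarrow> x = y"
  using X_mem(3) by metis

lemma X_edge_at:
  assumes "x \<in> X" "v \<in> \<Union>x"
  obtains e where "e \<in> x" "v \<in> e" "\<And>f. f \<in> x \<Longrightarrow> v \<in> f \<Longrightarrow> f = e"
proof -
  obtain e where e: "e \<in> x" "v \<in> e" using assms by blast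
  have "f = e" if "f \<in> x" "v \<in> f" for f
  proof (rule ccontr)
    assume "f \<noteq> e"
    then have "f = mate e" using that(1) X_mem(3)[OF assms(1) e(1)] by blast
    then show False using X_mem(2)[OF assms(1) e(1)] e(2) that(2) by blast
  qed
  then show ?thesis using that e by blast
qed

lemma ptx_eq:
  assumes "x \<in> X" "e \<in> x"
  shows "ptx x = pt e"
proof -
  have "(SOME e. e \<in> x) \<in> x" by (rule someI[of _ e]) (rule assms(2))
  then have "(SOME e. e \<in> x) = e \<or> (SOME e. e \<in> x) = mate e" using X_mem(3)[OF assms] by blast
  then show ?thesis unfolding ptx_def using mate_props(3)[OF X_mem(1)[OF assms]] by metis
qed

lemma crossed_cases: "crossed e \<Longrightarrow> adj e \<or> {e, mate e} \<in> X"
  unfolding adj_def X_def by blast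

lemma M_cases: "e \<in> M \<Longrightarrow> e \<in> E \<and> (\<not> crossed e \<or> adj e)"
  using crossed_cases[of e] unfolding M_def by blast

lemma I_base: "I (lift e) = base e"
proof -
  have "Inl -` (lift e) = e" unfolding lift_def by (auto simp: inj_vimage_image_eq)
  moreover have "lift e \<subseteq> range Inl" unfolding lift_def by auto
  ultimately show ?thesis unfolding I_def by simp
qed

lemma I_half:
  assumes "x \<in> X" "e \<in> x" "v \<in> e"
  shows "I (half v x) = H e v"
proof -
  have v: "(THE v'. Inl v' \<in> half v x) = v" unfolding half_def by (rule the_equality) auto
  have x: "(THE x'. Inr x' \<in> half v x) = x" unfolding half_def by (rule the_equality) auto
  have "v \<in> \<Union>x" using assms by blast
  then have "(THE e'. e' \<in> x \<and> v \<in> e') = e" using X_edge_at[OF assms(1)] assms(2,3) by (intro the_equality) metis+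
  moreover have "\<not> half v x \<subseteq> range Inl" unfolding half_def by auto
  ultimately show ?thesis unfolding I_def v x by simp
qed

lemma Es_cases:
  assumes "c \<in> Es"
  obtains (plain) e where "c = lift e" "e \<in> E" "\<not> crossed e" "I c = A e"
  | (adjacent) e where "c = lift e" "e \<in> E" "adj e" "I c = H e (far e)"
  | (half) v x e where "c = half v x" "x \<in> X" "e \<in> x" "v \<in> e" "I c = H e v"
proof -
  consider e where "c = lift e" "e \<in> M" | v x where "c = half v x" "x \<in> X" "v \<in> \<Union>x"
    using assms unfolding Es_def by blast
  then show ?thesis
  proof cases
    case 1
    then show ?thesis using M_cases[OF 1(2)] that(1)[of e] that(2)[of e] I_base[of e] adj_crossed[of e]
      unfolding base_def by auto
  next
    case 2
    then obtain e where "e \<in> x" "v \<in> e" by blast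
    then show ?thesis using that(3)[of v x e] 2 I_half by blast
  qed
qed

lemma I_sub:
  assumes "c \<in> Es"
  obtains e where "e \<in> E" "I c \<subseteq> A e" "c = lift e \<or> (\<exists>v x. c = half v x \<and> x \<in> X \<and> e \<in> x \<and> v \<in> e)"
  using assms
proof (cases rule: Es_cases)
  case (plain e)
  then show ?thesis using that by blast
next
  case (adjacent e)
  then show ?thesis using that[of e] H_at(2)[OF adj_crossed apex_far(4), of e] by blast
next
  case (half v x e)
  then show ?thesis using that[of e] H_at(2)[of e v] X_mem(1,4)[OF half(2,3)] by blast
qed

lemma S_Inl: "S (Inl v) = insert (pos v) (\<Union>{H e v | e. stem e \<and> apex e = v})"
  and S_Inr: "S (Inr x) = {ptx x}"
  unfolding S_def by simp_all

lemma S_cases: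
  assumes "p \<in> S (Inl v)"
  obtains "p = pos v" | f where "stem f" "apex f = v" "p \<in> H f v" "crossed f" "v \<in> f"
proof -
  consider "p = pos v" | f where "stem f" "apex f = v" "p \<in> H f v" using assms unfolding S_Inl by blast
  then show ?thesis
  proof cases
    case (2 f)
    then show ?thesis using that(2)[of f] adj_crossed stem_adj apex_far(1) by blast
  qed (use that in blast)
qed

lemma pos_A: "e \<in> E \<Longrightarrow> v \<in> V \<Longrightarrow> pos v \<in> A e \<Longrightarrow> v \<in> e"
  using meets[of e] inj_on_image_mem_iff[OF inj, of v e] edge[of e] by (metis IntI imageI)

text \<open>By \<open>H_Int\<close> the segment of a stem that is neither \<open>e\<close> nor the
  mate of \<open>e\<close> meets \<open>A e\<close> at most in \<open>pos v\<close>.\<close>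

lemma S_A:
  assumes "e \<in> E" "v \<in> V" "p \<in> A e" "p \<in> S (Inl v)"
  obtains "p = pos v" "v \<in> e" | f where "stem f" "apex f = v" "p \<in> H f v" "f = e \<or> e = mate f"
  using assms(4)
proof (cases rule: S_cases)
  case 1
  then show ?thesis using that(1) pos_A assms by blast
next
  case (2 f)
  show ?thesis
  proof (cases "f = e \<or> e = mate f")
    case True
    then show ?thesis using that(2) 2 by blast
  next
    case False
    then have "A e \<inter> H f v \<subseteq> {pos v} \<inter> pos ` e" by (intro H_Int) (use assms 2 in auto)
    then have "p = pos v" using assms(3) 2(3) by blast
    then show ?thesis using that(1) pos_A assms by blast
  qed
qed

lemma S_A_nonadj:
  assumes "e \<in> E" "\<not> adj e" "v \<in> V" "p \<in> A e" "p \<in> S (Inl v)"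
  shows "p = pos v \<and> v \<in> e"
  using assms(1,3-5)
proof (cases rule: S_A)
  case (2 f)
  then have "adj e" using stem_adj apex_far(7) by blast
  then show ?thesis using assms(2) by blast
qed auto

text \<open>Besides a vertex, the far half can meet a blob only along the stem of its crossing. If
  that stem is \<open>e\<close>, the two halves of \<open>e\<close> meet in \<open>pt e\<close>; if
  it is the mate, the two arcs meet only in \<open>pt e\<close> and in the apex, which is not on the
  far half.\<close>

lemma S_H_far:
  assumes e: "adj e" and v: "v \<in> V" and p: "p \<in> H e (far e)" "p \<in> S (Inl v)"
  shows "(v = far e \<and> p = pos v) \<or> (v = apex e \<and> p = pt e)"
proof -
  note ap = apex_far[OF e]
  have c: "crossed e" by (rule adj_crossed[OF e])
  have eE: "e \<in> E" using mate_props(4)[OF c] .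
  note Hf = H_at[OF c ap(4)]
  have far: "w = far e" if "w \<in> V" "pos w \<in> H e (far e)" for w
  proof -
    have "pos w = pos (far e)" using Hf(3) that by blast
    then show ?thesis using inj_onD[OF inj] that(1) edge[OF eE] ap(4) by blast
  qed
  have pA: "p \<in> A e" using Hf(2) p(1) by blast
  from eE v pA p(2) show ?thesis
  proof (cases rule: S_A)
    case 1
    then show ?thesis using far[OF v] p(1) by blast
  next
    case (2 f)
    note apf = apex_far[OF stem_adj[OF 2(1)]]
    have cf: "crossed f" using adj_crossed stem_adj 2(1) by blast
    have av: "apex e = v" using 2(2,4) apf(8) by blast
    from 2(4) show ?thesis
    proof
      assume "f = e"
      then have "p \<in> H e (apex e) \<inter> H e (far e)" using 2(3) av p(1) by blast
      then have "p = pt e" using H_props(3)[OF c ap(6) ap(5)[symmetric]] by blast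
      then show ?thesis using av by blast
    next
      assume em: "e = mate f"
      have "p \<in> A f" using H_at(2)[OF cf, of v] 2(2,3) apf(1) by blast
      then have "p \<in> pos ` (e \<inter> f) \<or> p = pt e"
        using A_Int[OF eE mate_props(4)[OF cf] _ pA] em mate_props(6)[OF cf] by blast
      moreover have "p \<notin> pos ` (e \<inter> f)"
      proof
        assume "p \<in> pos ` (e \<inter> f)"
        then have "p = pos (apex f)" using apf(3) em by (auto simp: Int_commute)
        then have "pos (apex e) \<in> H e (far e)" using p(1) av 2(2) by simp
        moreover have "apex e \<in> V" using ap(1) edge[OF eE] by blast
        ultimately show False using far ap(5) by metis
      qed
      ultimately show ?thesis using av by blast
    qed
  qed
qed

lemma pt_in_blob: "adj e \<Longrightarrow> pt e \<in> S (Inl (apex e))"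
proof -
  assume e: "adj e"
  obtain f where f: "stem f" "f = e \<or> f = mate e" using stem_exists[OF e] by blast
  have "apex f = apex e" "pt f = pt e" using f(2) apex_far(8)[OF e] mate_props(3)[OF adj_crossed[OF e]] by auto
  then have "pt e \<in> H f (apex e)" "apex f = apex e"
    using H_at(4)[OF adj_crossed[OF stem_adj[OF f(1)]] apex_far(1)[OF stem_adj[OF f(1)]]] by auto
  then show ?thesis unfolding S_Inl using f(1) by blast
qed

lemma pos_in_blob: "pos v \<in> S (Inl v)"
  unfolding S_Inl by simp

lemma ptx_on: "x \<in> X \<Longrightarrow> e \<in> E \<Longrightarrow> ptx x \<in> A e \<Longrightarrow> e \<in> x"
proof -
  assume x: "x \<in> X" and e: "e \<in> E" "ptx x \<in> A e"
  obtain f where f: "f \<in> x" using x unfolding X_def by blast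
  then have "e = f \<or> e = mate f" using pt_on[OF X_mem(1)[OF x f] e(1)] e(2) ptx_eq[OF x f] by simp
  then show ?thesis using X_mem(3)[OF x f] f by blast
qed

lemma ptx_not_blob:
  assumes "x \<in> X" "v \<in> V"
  shows "ptx x \<notin> S (Inl v)"
proof
  assume p: "ptx x \<in> S (Inl v)"
  obtain e where e: "e \<in> x" using assms(1) unfolding X_def by blast
  note xm = X_mem[OF assms(1) e]
  have "ptx x \<in> A e" using mate_props(7)[OF xm(1)] ptx_eq[OF assms(1) e] by simp
  then have "ptx x = pos v" using S_A_nonadj[OF xm(4,5) assms(2) _ p] by blast
  then show False using mate_props(8)[OF xm(1)] ptx_eq[OF assms(1) e] assms(2) by auto
qed

lemma blob_topology:
  assumes "v \<in> V"
  shows "compact (S (Inl v)) \<and> path_connected (S (Inl v)) \<and> connected (- S (Inl v))"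
  unfolding S_Inl
proof (rule nonseparating_bouquet)
  have "{H e v | e. stem e \<and> apex e = v} \<subseteq> (\<lambda>e. H e v) ` E"
    using mate_props(4) adj_crossed stem_adj by blast
  then show "finite {H e v | e. stem e \<and> apex e = v}" using finE finite_surj by blast
next
  fix T assume "T \<in> {H e v | e. stem e \<and> apex e = v}"
  then obtain e where e: "T = H e v" "stem e" "apex e = v" by blast
  have "arc_between T (pos v) (pt e)"
    using H_at(1)[OF adj_crossed[OF stem_adj[OF e(2)]] apex_far(1)[OF stem_adj[OF e(2)]]] e by simp
  then show "compact T \<and> path_connected T \<and> connected (- T) \<and> pos v \<in> T"
    using arc_between_topology arc_between_ends(1) by blast
next
  fix T T' assume T: "T \<in> {H e v | e. stem e \<and> apex e = v}" "T' \<in> {H e v | e. stem e \<and> apex e = v}" "T \<noteq> T'"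
  obtain e where e: "T = H e v" "stem e" "apex e = v" using T(1) by blast
  obtain f where f: "T' = H f v" "stem f" "apex f = v" using T(2) by blast
  have ce: "crossed e" "v \<in> e" using adj_crossed stem_adj apex_far(1) e by blast+
  have cf: "crossed f" "v \<in> f" using adj_crossed stem_adj apex_far(1) f by blast+
  have "e \<noteq> f" using T(3) e f by blast
  moreover have "e \<noteq> mate f" using stem_mate e f by blast
  ultimately have "A e \<inter> H f v \<subseteq> {pos v}" using H_Int[OF mate_props(4)[OF ce(1)] assms cf] by blast
  then show "T \<inter> T' \<subseteq> {pos v}" using H_at(2)[OF ce] e f by blast
qed

text \<open>Segments at different vertices belong to different stems, which are not mates by
  \<open>stem_mate\<close>, so \<open>H_Int\<close> confines their intersection to a vertex.\<close>

lemma blob_disjoint: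
  assumes "u \<in> V" "v \<in> V" "u \<noteq> v"
  shows "S (Inl u) \<inter> S (Inl v) = {}"
proof (rule ccontr)
  assume "S (Inl u) \<inter> S (Inl v) \<noteq> {}"
  then obtain p where p: "p \<in> S (Inl u)" "p \<in> S (Inl v)" by blast
  have np: "pos u \<noteq> pos v" using inj_onD[OF inj] assms by blast
  have *: False if "p = pos u" "p \<in> H f v" "crossed f" "v \<in> f" "u \<in> V" "pos u \<noteq> pos v" for u v f
    using that H_at(3)[OF that(3,4)] by blast
  from p(1) show False
  proof (cases rule: S_cases)
    case 1
    from p(2) show False
    proof (cases rule: S_cases)
      case 1
      then show False using \<open>p = pos u\<close> np by simp
    next
      case (2 f)
      then show False using * 1 assms(1) np by blast
    qed
  next
    case e: (2 e)
    from p(2) show False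
    proof (cases rule: S_cases)
      case 1
      then show False using *[of v e u] e assms np by auto
    next
      case f: (2 f)
      have "e \<noteq> f" using e f assms(3) by blast
      moreover have "e \<noteq> mate f" using stem_mate e f by blast
      ultimately have "A e \<inter> H f v \<subseteq> {pos v}"
        using H_Int[OF mate_props(4)[OF e(4)] assms(2) f(4,5)] by blast
      moreover have "p \<in> A e" using H_at(2)[OF e(4,5)] e(3) by blast
      ultimately have "p = pos v" using f(3) by blast
      then show False using *[of v e u] e assms np by auto
    qed
  qed
qed

lemma half_eq: "half v x = half w y \<longleftrightarrow> v = w \<and> x = y"
  unfolding half_def by (auto simp: doubleton_eq_iff)

lemma half_lift: "half v x \<noteq> lift e"
  unfolding half_def lift_def by auto

lemma inj_lift: "lift e = lift f \<longleftrightarrow> e = f"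
  unfolding lift_def by (simp add: inj_image_eq_iff)

lemma edge_blobs:
  assumes "c \<in> Es"
  obtains u v a b where "c = {u, v}" "u \<in> Vs" "v \<in> Vs" "u \<noteq> v" "arc_between (I c) a b"
    "I c \<inter> S u = {a}" "I c \<inter> S v = {b}"
  using assms
proof (cases rule: Es_cases)
  case (plain e)
  obtain a b where ab: "e = {a, b}" "a \<noteq> b" "a \<in> V" "b \<in> V"
    using edge[OF plain(2)] by (auto simp: card_2_iff)
  have arc: "arc_between (A e) (pos a) (pos b)" using arcs plain(2) ab(1) by simp
  have na: "\<not> adj e" using adj_crossed plain(3) by blast
  have "A e \<inter> S (Inl a) \<subseteq> {pos a}" "A e \<inter> S (Inl b) \<subseteq> {pos b}"
    using S_A_nonadj[OF plain(2) na ab(3)] S_A_nonadj[OF plain(2) na ab(4)] by auto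
  then have "A e \<inter> S (Inl a) = {pos a}" "A e \<inter> S (Inl b) = {pos b}"
    using pos_in_blob arc_between_ends(1,2)[OF arc] by auto
  moreover have "c = {Inl a, Inl b}" using plain(1) ab(1) unfolding lift_def by simp
  ultimately show ?thesis using that[of "Inl a" "Inl b" "pos a" "pos b"] arc ab plain(4)
    unfolding Vs_def by simp
next
  case (adjacent e)
  note ap = apex_far[OF adjacent(3)]
  note h = H_at[OF adj_crossed[OF adjacent(3)] ap(4)]
  have V: "apex e \<in> V" "far e \<in> V" using edge[OF adjacent(2)] ap by auto
  have "I c \<inter> S (Inl (far e)) \<subseteq> {pos (far e)}" "I c \<inter> S (Inl (apex e)) \<subseteq> {pt e}"
    using S_H_far[OF adjacent(3) V(1)] S_H_far[OF adjacent(3) V(2)] ap(5) adjacent(4) by auto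
  then have "I c \<inter> S (Inl (far e)) = {pos (far e)}" "I c \<inter> S (Inl (apex e)) = {pt e}"
    using pos_in_blob pt_in_blob[OF adjacent(3)] arc_between_ends(1,2)[OF h(1)] adjacent(4) by auto
  moreover have "c = {Inl (far e), Inl (apex e)}"
    using adjacent(1) arg_cong[OF ap(6), of lift] unfolding lift_def by auto
  ultimately show ?thesis using that[of "Inl (far e)" "Inl (apex e)"] h(1) V ap(5) adjacent(4)
    unfolding Vs_def by simp
next
  case (half v x e)
  note xm = X_mem[OF half(2,3)]
  note h = H_at[OF xm(1) half(4)]
  have V: "v \<in> V" using edge[OF xm(4)] half(4) by auto
  have "I c \<inter> S (Inl v) \<subseteq> {pos v}" using S_A_nonadj[OF xm(4,5) V] h(2) half(5) by auto
  then have "I c \<inter> S (Inl v) = {pos v}" using pos_in_blob arc_between_ends(1)[OF h(1)] half(5) by auto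
  moreover have "I c \<inter> S (Inr x) = {pt e}" unfolding S_Inr using ptx_eq[OF half(2,3)] h(4) half(5) by simp
  ultimately show ?thesis using that[of "Inl v" "Inr x"] h(1) V half unfolding Vs_def half_def by simp
qed

lemma edge_avoids:
  assumes "c \<in> Es" "u \<in> Vs" "u \<notin> c"
  shows "I c \<inter> S u = {}"
proof (rule ccontr)
  assume "I c \<inter> S u \<noteq> {}"
  then obtain p where p: "p \<in> I c" "p \<in> S u" by blast
  obtain e where e: "e \<in> E" "I c \<subseteq> A e" "c = lift e \<or> (\<exists>v x. c = half v x \<and> x \<in> X \<and> e \<in> x \<and> v \<in> e)"
    using I_sub[OF assms(1)] by metis
  consider w where "u = Inl w" "w \<in> V" | x where "u = Inr x" "x \<in> X" using assms(2) unfolding Vs_def by blast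
  then show False
  proof cases
    case (1 w)
    have pw: "p \<in> S (Inl w)" using p(2) 1 by simp
    from assms(1) show False
    proof (cases rule: Es_cases)
      case (plain e)
      have "w \<in> e" using S_A_nonadj[OF plain(2) _ 1(2) _ pw] adj_crossed plain(3,4) p(1) by blast
      then show False using assms(3) plain(1) 1 unfolding lift_def by blast
    next
      case (adjacent e)
      have "w = far e \<or> w = apex e" using S_H_far[OF adjacent(3) 1(2) _ pw] p(1) adjacent(4) by blast
      then have "w \<in> e" using apex_far[OF adjacent(3)] by blast
      then show False using assms(3) adjacent(1) 1 unfolding lift_def by blast
    next
      case (half v x e)
      note xm = X_mem[OF half(2,3)]
      note h = H_at[OF xm(1) half(4)]
      have "p = pos w" using S_A_nonadj[OF xm(4,5) 1(2) _ pw] h(2) half(5) p(1) by blast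
      then have "pos w = pos v" using h(3) half(5) p(1) 1(2) by blast
      moreover have "v \<in> V" using half(4) edge[OF xm(4)] by blast
      ultimately have "w = v" using inj_onD[OF inj] 1(2) by blast
      then show False using assms(3) half(1) 1(1) unfolding half_def by blast
    qed
  next
    case (2 x)
    have px: "p = ptx x" using p(2) 2(1) S_Inr by blast
    then have "ptx x \<in> A e" using p(1) e(2) by blast
    then have ex: "e \<in> x" using ptx_on[OF 2(2) e(1)] by blast
    from assms(1) show False
    proof (cases rule: Es_cases)
      case (plain f)
      then show False using ptx_on[OF 2(2) plain(2)] p(1) px X_mem(1)[OF 2(2)] by blast
    next
      case (adjacent f)
      have "ptx x \<in> A f"
        using p(1) px adjacent(4) H_at(2)[OF adj_crossed[OF adjacent(3)] apex_far(4)[OF adjacent(3)]] by blast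
      then show False using ptx_on[OF 2(2) adjacent(2)] X_mem(5)[OF 2(2)] adjacent(3) by blast
    next
      case (half v y f)
      note xm = X_mem[OF half(2,3)]
      have "ptx x \<in> A f" using p(1) px half(5) H_at(2)[OF xm(1) half(4)] by blast
      then have "f \<in> x" using ptx_on[OF 2(2) xm(4)] by blast
      then have "x = y" using X_eq[OF 2(2) half(2) _ half(3)] by blast
      then show False using assms(3) half(1) 2(1) unfolding half_def by blast
    qed
  qed
qed

lemma pt_covered:
  assumes "crossed e"
  shows "pt e \<in> \<Union>(S ` Vs)"
proof -
  consider "adj e" | "{e, mate e} \<in> X" using crossed_cases[OF assms] by blast
  then show ?thesis
  proof cases
    case 1
    have "apex e \<in> V" using apex_far(1)[OF 1] edge[OF mate_props(4)[OF assms]] by blast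
    then show ?thesis using pt_in_blob[OF 1] unfolding Vs_def by blast
  next
    case 2
    have "ptx {e, mate e} = pt e" by (rule ptx_eq[OF 2]) simp
    then have "pt e \<in> S (Inr {e, mate e})" unfolding S_Inr by simp
    then show ?thesis using 2 unfolding Vs_def by blast
  qed
qed

lemma pos_covered: "v \<in> V \<Longrightarrow> pos v \<in> \<Union>(S ` Vs)"
  using pos_in_blob unfolding Vs_def by blast

lemma edges_meet_in_blobs:
  assumes "c \<in> Es" "d \<in> Es" "c \<noteq> d"
  shows "I c \<inter> I d \<subseteq> \<Union>(S ` Vs)"
proof
  fix p assume p: "p \<in> I c \<inter> I d"
  obtain e where e: "e \<in> E" "I c \<subseteq> A e" "c = lift e \<or> (\<exists>v x. c = half v x \<and> x \<in> X \<and> e \<in> x \<and> v \<in> e)"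
    using I_sub[OF assms(1)] by metis
  obtain f where f: "f \<in> E" "I d \<subseteq> A f" "d = lift f \<or> (\<exists>v x. d = half v x \<and> x \<in> X \<and> f \<in> x \<and> v \<in> f)"
    using I_sub[OF assms(2)] by metis
  show "p \<in> \<Union>(S ` Vs)"
  proof (cases "e = f")
    case False
    have "p \<in> A e" "p \<in> A f" using p e f by blast+
    then have "p \<in> pos ` (e \<inter> f) \<or> (crossed e \<and> f = mate e \<and> p = pt e)" by (rule A_Int[OF e(1) f(1) False])
    then show ?thesis using pt_covered pos_covered edge[OF e(1)] by blast
  next
    case True
    \<comment> \<open>Two pieces of one edge can only be its two halves, since an edge belonging to
      a crossing in \<open>X\<close> is not lifted.\<close>
    have lX: "False" if "lift e \<in> Es" "x \<in> X" "e \<in> x" for x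
      using that half_lift unfolding Es_def M_def by (auto simp: inj_lift)
    have "\<exists>v x. c = half v x \<and> x \<in> X \<and> e \<in> x \<and> v \<in> e" "\<exists>v x. d = half v x \<and> x \<in> X \<and> e \<in> x \<and> v \<in> e"
      using e(3) f(3) True assms lX by metis+
    then obtain v x w y where v: "c = half v x" "x \<in> X" "e \<in> x" "v \<in> e"
      and w: "d = half w y" "y \<in> X" "e \<in> y" "w \<in> e" by blast
    have "x = y" using X_eq v w by blast
    then have "v \<noteq> w" using assms(3) v w by blast
    have c: "crossed e" using X_mem(1)[OF v(2,3)] .
    have "e = {v, w}" using edge_pair[OF e(1) v(4)] w(4) \<open>v \<noteq> w\<close> by (metis insertE singletonD)
    then have "H e v \<inter> H e w = {pt e}" using H_props(3)[OF c] \<open>v \<noteq> w\<close> by blast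
    then have "p = pt e" using p I_half[OF v(2-4)] I_half[OF w(2-4)] v(1) w(1) by blast
    then show ?thesis using pt_covered[OF c] by simp
  qed
qed

lemma Union_X: "\<Union>(\<Union>X) \<subseteq> V"
  using X_mem(4) edge by blast

lemma finX: "finite X"
proof -
  have "X \<subseteq> Pow E" using X_mem(4) by blast
  then show ?thesis using finE finite_subset by blast
qed

lemma fat: "fat_plane_graph Vs Es S I"
proof
  show "simple_graph Vs Es"
    unfolding simple_graph_def
  proof (intro conjI ballI)
    show "finite Vs" unfolding Vs_def using finV finX by simp
  next
    fix c assume "c \<in> Es"
    then obtain u v where "c = {u, v}" "u \<in> Vs" "v \<in> Vs" "u \<noteq> v" using edge_blobs by metis
    then show "c \<subseteq> Vs" "card c = 2" by auto
  qed
next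
  fix u assume "u \<in> Vs"
  then consider v where "u = Inl v" "v \<in> V" | x where "u = Inr x" unfolding Vs_def by blast
  then show "compact (S u) \<and> path_connected (S u) \<and> connected (- S u) \<and> S u \<noteq> {}"
  proof cases
    case (1 v)
    then show ?thesis using blob_topology[OF 1(2)] pos_in_blob by blast
  next
    case (2 x)
    have "connected (- {ptx x})" by (rule connected_punctured_universe) simp
    then show ?thesis unfolding 2 S_Inr by simp
  qed
next
  fix u v assume uv: "u \<in> Vs" "v \<in> Vs" "u \<noteq> v"
  have xy: "S (Inr x) \<inter> S (Inr y) = {}" if xy: "x \<in> X" "y \<in> X" "x \<noteq> y" for x y
  proof -
    obtain e where e: "e \<in> x" using xy(1) unfolding X_def by blast
    obtain f where f: "f \<in> y" using xy(2) unfolding X_def by blast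
    have "ptx x \<noteq> ptx y"
    proof
      assume "ptx x = ptx y"
      then have "ptx x \<in> A f" using mate_props(7)[OF X_mem(1)[OF xy(2) f]] ptx_eq[OF xy(2) f] by simp
      then have "f \<in> x" using ptx_on[OF xy(1) X_mem(4)[OF xy(2) f]] by blast
      then show False using X_eq[OF xy(1,2) _ f] xy(3) by blast
    qed
    then show ?thesis unfolding S_Inr by simp
  qed
  have vx: "S (Inl w) \<inter> S (Inr x) = {}" if "w \<in> V" "x \<in> X" for w x
    using ptx_not_blob[OF that(2,1)] unfolding S_Inr by simp
  from uv(1,2) consider w w' where "u = Inl w" "v = Inl w'" "w \<in> V" "w' \<in> V"
    | w x where "u = Inl w" "v = Inr x" "w \<in> V" "x \<in> X" | w x where "v = Inl w" "u = Inr x" "w \<in> V" "x \<in> X"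
    | x y where "u = Inr x" "v = Inr y" "x \<in> X" "y \<in> X"
    unfolding Vs_def by blast
  then show "S u \<inter> S v = {}"
  proof cases
    case (1 w w')
    then show ?thesis using blob_disjoint uv(3) by metis
  next
    case (2 w x)
    then show ?thesis using vx by metis
  next
    case (3 w x)
    then show ?thesis using vx Int_commute by metis
  next
    case (4 x y)
    then show ?thesis using xy uv(3) by metis
  qed
next
  fix u v assume uv: "{u, v} \<in> Es"
  obtain u' v' a b where *: "{u, v} = {u', v'}" "arc_between (I {u, v}) a b" "I {u, v} \<inter> S u' = {a}" "I {u, v} \<inter> S v' = {b}"
    using edge_blobs[OF uv] by metis
  from *(1) have "(u = u' \<and> v = v') \<or> (u = v' \<and> v = u')" by (metis doubleton_eq_iff)
  then show "\<exists>a b. arc_between (I {u, v}) a b \<and> I {u, v} \<inter> S u = {a} \<and> I {u, v} \<inter> S v = {b}"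
    using *(2-4) arc_between_sym by blast
qed (rule edge_avoids edges_meet_in_blobs; assumption)+

end

section \<open>Face structure of a 3-edge-connected drawing\<close>

locale one_planar_3conn = one_planar +
  assumes C4: "C4_free E"
    and cuts3: "\<And>W. W \<noteq> {} \<Longrightarrow> W \<subset> V \<Longrightarrow> 3 \<le> card {e \<in> E. e \<inter> W \<noteq> {} \<and> e - W \<noteq> {}}"
    and two: "2 \<le> card V"
begin

text \<open>For the transfer of edge cuts to the planarisation: by \<open>owner_unique\<close>,
  choosing one piece for each cut edge is injective.\<close>

definition owner :: "('a + 'a set set) set \<Rightarrow> 'a set \<Rightarrow> bool" where
  "owner c e \<longleftrightarrow> c = lift e \<or> (\<exists>v x. c = half v x \<and> x \<in> X \<and> e \<in> x \<and> v \<in> e)"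

lemma owner_unique: "owner c e \<Longrightarrow> owner c f \<Longrightarrow> e = f"
proof -
  assume o: "owner c e" "owner c f"
  show "e = f"
  proof (cases "c = lift e")
    case True
    then have "c = lift f" using o(2) half_lift unfolding owner_def by metis
    then show ?thesis using True inj_lift by blast
  next
    case False
    then obtain v x where v: "c = half v x" "x \<in> X" "e \<in> x" "v \<in> e" using o(1) unfolding owner_def by blast
    then have "f \<in> x \<and> v \<in> f" using o(2) half_lift half_eq unfolding owner_def by metis
    then show ?thesis using X_edge_at[OF v(2), of v] v(3,4) by (metis UnionI)
  qed
qed

text \<open>If the crossing on \<open>e\<close> lies in \<open>C\<close>, the half at the end
  outside \<open>C\<close> is cut, otherwise the half at the end inside.\<close>

lemma cut_edge:
  assumes e: "e \<in> E" "e \<inter> W \<noteq> {}" "e - W \<noteq> {}" and W: "W = {v \<in> V. Inl v \<in> C}"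
  shows "\<exists>c. c \<in> Es \<and> c \<inter> C \<noteq> {} \<and> c - C \<noteq> {} \<and> owner c e"
proof -
  obtain u v where u: "u \<in> e" "u \<in> W" and v: "v \<in> e" "v \<notin> W" using e by blast
  have uC: "Inl u \<in> C" and vC: "Inl v \<notin> C" using u v W edge[OF e(1)] by auto
  show ?thesis
  proof (cases "e \<in> \<Union>X")
    case False
    then have "lift e \<in> Es" using e(1) unfolding Es_def M_def by blast
    moreover have "lift e \<inter> C \<noteq> {}" "lift e - C \<noteq> {}" using u v uC vC unfolding lift_def by auto
    ultimately show ?thesis unfolding owner_def by blast
  next
    case True
    then obtain x where x: "x \<in> X" "e \<in> x" by blast
    have hE: "half w x \<in> Es" "owner (half w x) e" if "w \<in> e" for w
      using that x unfolding Es_def owner_def by blast+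
    show ?thesis
    proof (cases "Inr x \<in> C")
      case True
      then show ?thesis using hE[OF v(1)] vC by (intro exI[of _ "half v x"]) (auto simp: half_def)
    next
      case False
      then show ?thesis using hE[OF u(1)] uC by (intro exI[of _ "half u x"]) (auto simp: half_def)
    qed
  qed
qed

lemma card_Union_x:
  assumes "x \<in> X"
  shows "card (\<Union>x) = 4"
proof -
  obtain e where e: "e \<in> x" using assms unfolding X_def by blast
  note xm = X_mem[OF assms e]
  have "\<Union>x = e \<union> mate e" using xm(3) by auto
  moreover have "card e = 2" "card (mate e) = 2" using edge mate_props(4,5)[OF xm(1)] by auto
  moreover have "finite e" "finite (mate e)" using calculation by (auto intro: card_ge_0_finite)
  ultimately show ?thesis using card_Un_disjoint[of e "mate e"] xm(2) by simp
qed

lemma finEs: "finite Es"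
  using fat_plane_graph.finE[OF fat] .

lemma lift_Es: "e \<in> M \<Longrightarrow> lift e \<in> Es" and half_Es: "x \<in> X \<Longrightarrow> v \<in> \<Union>x \<Longrightarrow> half v x \<in> Es"
  unfolding Es_def by blast+

lemma Es_shape:
  assumes "c \<in> Es"
  obtains e where "c = lift e" "e \<in> M" | v x where "c = half v x" "x \<in> X" "v \<in> \<Union>x"
  using assms unfolding Es_def by blast

text \<open>A set that splits \<open>V\<close> inherits a cut of the graph. Otherwise some crossing
  vertex is on the other side from all four of its ends, and its four half-edges are cut.\<close>

lemma Es_cuts3:
  assumes "C \<noteq> {}" "C \<subset> Vs"
  shows "3 \<le> card {c \<in> Es. c \<inter> C \<noteq> {} \<and> c - C \<noteq> {}}" (is "3 \<le> card ?R")
proof -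
  define W where "W = {v \<in> V. Inl v \<in> C}"
  have finR: "finite ?R" using finEs by simp
  have star: "3 \<le> card ?R" if x: "x \<in> X" "\<And>v. v \<in> \<Union>x \<Longrightarrow> half v x \<inter> C \<noteq> {} \<and> half v x - C \<noteq> {}" for x
  proof -
    have "half v x \<in> ?R" if "v \<in> \<Union>x" for v using half_Es[OF x(1) that] x(2)[OF that] by simp
    then have "(\<lambda>v. half v x) ` \<Union>x \<subseteq> ?R" by (intro image_subsetI)
    then have "card ((\<lambda>v. half v x) ` \<Union>x) \<le> card ?R" by (rule card_mono[OF finR])
    moreover have "inj_on (\<lambda>v. half v x) (\<Union>x)" by (rule inj_onI) (simp add: half_eq)
    then have "card ((\<lambda>v. half v x) ` \<Union>x) = 4" using card_Union_x[OF x(1)] by (simp only: card_image)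
    ultimately show ?thesis by linarith
  qed
  have UV: "v \<in> V" if "x \<in> X" "v \<in> \<Union>x" for x v using Union_X that by blast
  have "W \<subseteq> V" unfolding W_def by (rule Collect_restrict)
  then consider "W \<noteq> {}" "W \<subset> V" | "W = {}" | "W = V" by (metis psubsetI)
  then show ?thesis
  proof cases
    case 1
    let ?L = "{e \<in> E. e \<inter> W \<noteq> {} \<and> e - W \<noteq> {}}"
    have "\<exists>c. c \<in> ?R \<and> owner c e" if e: "e \<in> ?L" for e
    proof -
      have "\<exists>c. c \<in> Es \<and> c \<inter> C \<noteq> {} \<and> c - C \<noteq> {} \<and> owner c e"
        by (rule cut_edge[OF _ _ _ W_def]) (use e in simp_all)
      then show ?thesis by simp
    qed
    then have "\<forall>e\<in>?L. \<exists>c. c \<in> ?R \<and> owner c e" by (rule ballI)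
    from bchoice[OF this] obtain \<phi> where \<phi>': "\<forall>e\<in>?L. \<phi> e \<in> ?R \<and> owner (\<phi> e) e" by (rule exE)
    have \<phi>: "\<phi> e \<in> ?R" "owner (\<phi> e) e" if "e \<in> ?L" for e
      by (rule conjunct1[OF bspec[OF \<phi>' that]], rule conjunct2[OF bspec[OF \<phi>' that]])
    have "inj_on \<phi> ?L"
    proof (rule inj_onI)
      fix e f assume e: "e \<in> ?L" and f: "f \<in> ?L" and "\<phi> e = \<phi> f"
      then have "owner (\<phi> e) f" using \<phi>(2)[OF f] by simp
      then show "e = f" using owner_unique[OF \<phi>(2)[OF e]] by simp
    qed
    moreover have "\<phi> ` ?L \<subseteq> ?R" using \<phi>(1) by (intro image_subsetI)
    ultimately have "card ?L \<le> card ?R" by (rule card_inj_on_le[OF _ _ finR])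
    then show ?thesis using cuts3[OF 1] by linarith
  next
    case 2
    obtain u where "u \<in> C" using assms by blast
    then obtain x where x: "x \<in> X" "Inr x \<in> C" using 2 assms(2) unfolding W_def Vs_def by blast
    have "Inl v \<notin> C" if "v \<in> \<Union>x" for v using 2 UV[OF x(1) that] unfolding W_def by blast
    then show ?thesis by (intro star[OF x(1)]) (use x(2) in \<open>auto simp: half_def\<close>)
  next
    case 3
    obtain u where "u \<in> Vs" "u \<notin> C" using assms by blast
    then obtain x where x: "x \<in> X" "Inr x \<notin> C" using 3 unfolding W_def Vs_def by blast
    have "Inl v \<in> C" if "v \<in> \<Union>x" for v using 3 UV[OF x(1) that] unfolding W_def by blast
    then show ?thesis by (intro star[OF x(1)]) (use x(2) in \<open>auto simp: half_def\<close>)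
  qed
qed

lemma card_Vs: "card Vs = card V + card X"
  unfolding Vs_def using finV finX by (subst card_Un_disjoint) (auto simp: card_image)

lemma fat3: "fat_plane_graph_3conn Vs Es S I"
proof (rule fat_plane_graph_3conn.intro[OF fat], unfold_locales)
  show "2 \<le> card Vs" using two card_Vs by simp
qed (rule Es_cuts3)

lemma card_Es: "card Es = card M + 4 * card X"
proof -
  let ?Hs = "{half v x | v x. x \<in> X \<and> v \<in> \<Union>x}"
  have eq: "?Hs = (\<lambda>(x, v). half v x) ` (SIGMA x:X. \<Union>x)" by auto
  have "inj_on (\<lambda>(x, v). half v x) (SIGMA x:X. \<Union>x)" by (rule inj_onI) (auto simp: half_eq)
  then have "card ?Hs = card (SIGMA x:X. \<Union>x)" unfolding eq by (rule card_image)
  also have "\<dots> = (\<Sum>x\<in>X. card (\<Union>x))"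
    using finX card_Union_x by (intro card_SigmaI) (auto intro: card_ge_0_finite)
  also have "\<dots> = 4 * card X" using card_Union_x by simp
  finally have 1: "card ?Hs = 4 * card X" .
  have 2: "card (lift ` M) = card M" by (intro card_image inj_onI) (simp add: inj_lift)
  have fin: "finite (lift ` M)" "finite ?Hs" using finEs unfolding Es_def by (simp_all only: finite_Un)
  have "lift ` M \<inter> ?Hs = {}" using half_lift by blast
  then show ?thesis unfolding Es_def card_Un_disjoint[OF fin \<open>lift ` M \<inter> ?Hs = {}\<close>] 1 2 by simp
qed

lemma card_E: "card E = card M + 2 * card X"
proof -
  have sub: "\<Union>X \<subseteq> E" using X_mem(4) by blast
  have c2: "card x = 2" if x: "x \<in> X" for x
  proof -
    obtain e where e: "e \<in> x" using x unfolding X_def by blast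
    then show ?thesis using X_mem(3)[OF x e] mate_props(6)[OF X_mem(1)[OF x e]] by (metis card_2_iff)
  qed
  have "card (\<Union>X) = (\<Sum>x\<in>X. card x)"
  proof (rule card_Union_disjoint)
    show "pairwise disjnt X" using X_eq unfolding pairwise_def disjnt_def by blast
    show "finite x" if "x \<in> X" for x using c2[OF that] by (auto intro: card_ge_0_finite)
  qed
  also have "\<dots> = 2 * card X" using c2 by simp
  finally have "card (\<Union>X) = 2 * card X" .
  moreover have "card M = card E - card (\<Union>X)" unfolding M_def
    by (rule card_Diff_subset[OF finite_subset[OF sub finE] sub])
  moreover have "card (\<Union>X) \<le> card E" by (rule card_mono[OF finE sub])
  ultimately show ?thesis by linarith
qed

sublocale fp: fat_plane_graph_3conn Vs Es S I
  by (rule fat3)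

definition faces :: "complex set set" where "faces = fp.F Es"
definition side0 :: "complex set \<Rightarrow> 'a set set" where
  "side0 f = {e \<in> M. lift e \<in> fp.bd f}"
definition corner :: "complex set \<Rightarrow> 'a set set \<Rightarrow> 'a set" where
  "corner f x = {v \<in> \<Union>x. half v x \<in> fp.bd f}"

lemma bd_Es: "fp.bd f \<subseteq> Es"
  unfolding fp.bd_def by blast

lemma no_leaf:
  assumes f: "f \<in> faces"
  shows "card {e \<in> side0 f. v \<in> e} + card {x \<in> X. v \<in> corner f x} \<noteq> 1"
proof (cases "v \<in> V")
  case True
  let ?A = "{e \<in> side0 f. v \<in> e}" and ?B = "{x \<in> X. v \<in> corner f x}"
  have "{c \<in> fp.bd f. Inl v \<in> c} = lift ` ?A \<union> half v ` ?B"
  proof (intro set_eqI iffI)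
    fix c assume c: "c \<in> {c \<in> fp.bd f. Inl v \<in> c}"
    then have "c \<in> Es" using bd_Es by blast
    then show "c \<in> lift ` ?A \<union> half v ` ?B"
    proof (cases rule: Es_shape)
      case (1 e)
      have "v \<in> e" "lift e \<in> fp.bd f" using c 1(1) by (auto simp: lift_def)
      then have "e \<in> ?A" using 1(2) by (simp add: side0_def)
      then show ?thesis unfolding 1(1) by (intro UnI1 imageI)
    next
      case (2 w x)
      have "w = v" "half w x \<in> fp.bd f" using c 2(1) by (auto simp: half_def)
      then have "x \<in> ?B" using 2 by (simp add: corner_def)
      then show ?thesis unfolding 2(1) \<open>w = v\<close> by (intro UnI2 imageI)
    qed
  next
    fix c assume "c \<in> lift ` ?A \<union> half v ` ?B"
    then show "c \<in> {c \<in> fp.bd f. Inl v \<in> c}"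
      unfolding side0_def corner_def by (auto simp: lift_def half_def)
  qed
  moreover have "lift ` ?A \<inter> half v ` ?B = {}" using half_lift by (auto simp: eq_commute)
  moreover have "finite ?A" "finite ?B" using finE finX unfolding side0_def M_def by auto
  moreover have "card (lift ` ?A) = card ?A" by (intro card_image inj_onI) (simp add: inj_lift)
  moreover have "card (half v ` ?B) = card ?B" by (intro card_image inj_onI) (simp add: half_eq)
  ultimately have N: "card {c \<in> fp.bd f. Inl v \<in> c} = card ?A + card ?B" by (simp add: card_Un_disjoint)
  have v: "Inl v \<in> Vs" using True unfolding Vs_def by blast
  show ?thesis using fp.bd_no_leaf[OF f[unfolded faces_def] v] unfolding N .
next
  case False
  have "{e \<in> side0 f. v \<in> e} = {}" using False edge unfolding side0_def M_def by blast
  moreover have "{x \<in> X. v \<in> corner f x} = {}" using False Union_X unfolding corner_def by blast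
  ultimately show ?thesis by (simp only: card.empty)
qed

lemma corner_card_1:
  assumes f: "f \<in> faces" and x: "x \<in> X"
  shows "card (corner f x) \<noteq> 1"
proof -
  have "{c \<in> fp.bd f. Inr x \<in> c} = (\<lambda>v. half v x) ` corner f x"
  proof (intro set_eqI iffI)
    fix c assume c: "c \<in> {c \<in> fp.bd f. Inr x \<in> c}"
    then have "c \<in> Es" using bd_Es by blast
    then show "c \<in> (\<lambda>v. half v x) ` corner f x"
    proof (cases rule: Es_shape)
      case (1 e)
      then show ?thesis using c by (auto simp: lift_def)
    next
      case (2 w y)
      have "y = x" "half w y \<in> fp.bd f" using c 2(1) by (auto simp: half_def)
      then have "w \<in> corner f x" using 2 by (simp add: corner_def)
      then show ?thesis unfolding 2(1) \<open>y = x\<close> by (rule imageI)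
    qed
  next
    fix c assume "c \<in> (\<lambda>v. half v x) ` corner f x"
    then show "c \<in> {c \<in> fp.bd f. Inr x \<in> c}" unfolding corner_def by (auto simp: half_def)
  qed
  moreover have "card ((\<lambda>v. half v x) ` corner f x) = card (corner f x)"
    by (intro card_image inj_onI) (simp add: half_eq)
  ultimately have N: "card {c \<in> fp.bd f. Inr x \<in> c} = card (corner f x)" by simp
  have v: "Inr x \<in> Vs" using x unfolding Vs_def by blast
  show ?thesis using fp.bd_no_leaf[OF f[unfolded faces_def] v] unfolding N .
qed

lemma face_structure: "face_structure E X faces side0 corner"
proof
  show "finite E" by (rule finE)
  show "C4_free E" by (rule C4)
  show "finite faces" unfolding faces_def by (rule fp.finite_F)
  show "card e = 2" if "e \<in> E" for e using edge[OF that] by blast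
  show "\<exists>e f. x = {e, f} \<and> e \<in> E \<and> f \<in> E \<and> e \<inter> f = {}" if "x \<in> X" for x
    using that mate_props(4,5) unfolding X_def by blast
  show "x = y" if "x \<in> X" "y \<in> X" "e \<in> x" "e \<in> y" for x y e using X_eq that by blast
  show "side0 f \<subseteq> E - \<Union>X" for f unfolding side0_def M_def by blast
  show "corner f x \<subseteq> \<Union>x" for f x unfolding corner_def by blast
  show "card {f \<in> faces. e \<in> side0 f} = 2" if "e \<in> E - \<Union>X" for e
  proof -
    have e: "e \<in> M" using that unfolding M_def .
    then have "{f \<in> faces. e \<in> side0 f} = {f \<in> fp.F Es. lift e \<in> fp.bd f}" unfolding side0_def faces_def by blast
    then show ?thesis using fp.bd_two[OF lift_Es[OF e]] by simp
  qed
  show "card {f \<in> faces. v \<in> corner f x} = 2" if "x \<in> X" "v \<in> \<Union>x" for x v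
  proof -
    have "{f \<in> faces. v \<in> corner f x} = {f \<in> fp.F Es. half v x \<in> fp.bd f}"
      using that unfolding corner_def faces_def by blast
    then show ?thesis using fp.bd_two[OF half_Es[OF that]] by simp
  qed
  show "card (corner f x) \<noteq> 1" if "f \<in> faces" "x \<in> X" for f x by (rule corner_card_1[OF that])
  show "card {e \<in> side0 f. v \<in> e} + card {x \<in> X. v \<in> corner f x} \<noteq> 1" if "f \<in> faces" for f v
    by (rule no_leaf[OF that])
  show "e = e'" if "f \<in> faces" "g \<in> faces" "f \<noteq> g" "e \<in> side0 f" "e \<in> side0 g" "e' \<in> side0 f" "e' \<in> side0 g"
    for f g e e'
    using fp.bd_share[of f g "lift e" "lift e'"] that inj_lift unfolding faces_def side0_def by blast
  show "v \<notin> corner g x" if "f \<in> faces" "g \<in> faces" "f \<noteq> g" "e \<in> side0 f" "e \<in> side0 g" "x \<in> X" "v \<in> corner f x"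
    for f g e x v
    using fp.bd_share[of f g "lift e" "half v x"] that half_lift[of v x e]
    unfolding faces_def side0_def corner_def by (metis (no_types, lifting) mem_Collect_eq)
  show "v = w" if "f \<in> faces" "g \<in> faces" "f \<noteq> g" "x \<in> X" "v \<in> corner f x" "v \<in> corner g x" "w \<in> corner f x" "w \<in> corner g x"
    for f g x v w
    using fp.bd_share[of f g "half v x" "half w x"] that half_eq unfolding faces_def corner_def by blast
  show "side0 f \<noteq> {} \<or> (\<exists>x\<in>X. corner f x \<noteq> {})" if f: "f \<in> faces" for f
  proof -
    obtain c where c: "c \<in> fp.bd f" using fp.bd_nonempty f unfolding faces_def by blast
    then have "c \<in> Es" using bd_Es by blast
    then show ?thesis
    proof (cases rule: Es_shape)
      case (1 e)
      then have "e \<in> side0 f" using c by (simp add: side0_def)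
      then show ?thesis by blast
    next
      case (2 w y)
      then have "w \<in> corner f y" using c by (simp add: corner_def)
      then show ?thesis using 2(2) by blast
    qed
  qed
qed

theorem edge_bound: "2 * card E + 10 \<le> 5 * card V"
proof -
  have "5 * card faces \<le> 3 * card M + 11 * card X"
    using face_structure.face_count[OF face_structure] unfolding M_def .
  moreover have "card Es + 2 \<le> card faces + card Vs" unfolding faces_def by (rule fp.euler)
  \<comment> \<open>Five times Euler's inequality reads \<open>5 * card M + 15 * card X + 10 \<le> 5
    * card faces + 5 * card V\<close>; the bound on the faces leaves
    \<open>2 * card M + 4 * card X + 10 \<le> 5 * card V\<close>.\<close>
  ultimately show ?thesis using card_E card_Es card_Vs by linarith
qed

end

section \<open>Reduction to 3-edge-connected graphs\<close>

lemma one_planar_subgraph: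
  assumes "one_planar V E pos A" "W \<subseteq> V"
  shows "one_planar W {e \<in> E. e \<subseteq> W} pos A"
proof -
  interpret one_planar V E pos A by (rule assms(1))
  \<comment> \<open>Fewer vertices leave more points that count as crossings; none is gained,
    because the arc of an edge inside \<open>W\<close> passes through no vertex outside
    \<open>W\<close>.\<close>
  have off: "p \<notin> pos ` V" if "e \<in> E" "e \<subseteq> W" "p \<in> A e" "p \<notin> pos ` W" for e p
    using meets[OF that(1)] that(2-4) by blast
  show ?thesis
  proof
    show "simple_graph W {e \<in> E. e \<subseteq> W}"
      unfolding simple_graph_def using finV edge assms(2) finite_subset by auto
    show "inj_on pos W" using inj assms(2) inj_on_subset by blast
    show "arc_between (A {a, b}) (pos a) (pos b)" if "{a, b} \<in> {e \<in> E. e \<subseteq> W}" for a b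
      using arcs that by blast
    show "A e \<inter> pos ` W = pos ` e" if "e \<in> {e \<in> E. e \<subseteq> W}" for e
    proof -
      have e: "e \<in> E" "e \<subseteq> W" using that by auto
      have "pos ` e \<subseteq> pos ` W" "pos ` W \<subseteq> pos ` V" using e(2) assms(2) by blast+
      then show ?thesis using meets[OF e(1)] by blast
    qed
    show "f = g \<and> p = q"
      if "e \<in> {e \<in> E. e \<subseteq> W}" "f \<in> {e \<in> E. e \<subseteq> W}" "g \<in> {e \<in> E. e \<subseteq> W}" "f \<noteq> e" "g \<noteq> e"
        "p \<in> A e \<inter> A f" "q \<in> A e \<inter> A g" "p \<notin> pos ` W" "q \<notin> pos ` W" for e f g p q
      by (rule once[of e f g p q]) (use that off[of e] in auto)
  qed
qed

lemma C4_free_mono: "C4_free E \<Longrightarrow> E' \<subseteq> E \<Longrightarrow> C4_free E'"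
  unfolding C4_free_def by blast

lemma card_edges_le:
  assumes "simple_graph V E"
  shows "card E \<le> card V choose 2"
proof -
  have fin: "finite V" and E: "E \<subseteq> {e. e \<subseteq> V \<and> card e = 2}" using assms unfolding simple_graph_def by auto
  have "finite {e. e \<subseteq> V \<and> card e = 2}" using fin by simp
  then have "card E \<le> card {e. e \<subseteq> V \<and> card e = 2}" using E card_mono by blast
  then show ?thesis using n_subsets[OF fin, of 2] by simp
qed

text \<open>The excess over \<open>5 * (n - 2)\<close> of twice the number of edges in small graphs.\<close>

definition slack :: "nat \<Rightarrow> nat" where
  "slack n = (if n = 1 then 5 else if n = 2 then 2 else if n = 3 then 1 else 0)"

lemma one_planar_edge_bound:
  assumes "one_planar V E pos A" "C4_free E" "V \<noteq> {}"
  shows "2 * card E + 10 \<le> 5 * card V + slack (card V)"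
  using assms
proof (induction "card V" arbitrary: V E rule: less_induct)
  case less
  interpret one_planar V E pos A by (rule less.prems(1))
  have n: "card V \<noteq> 0" using less.prems(3) finV by simp
  consider "card V = 1" | "card V = 2" | "card V = 3" | "4 \<le> card V" using n by linarith
  then show ?case
  proof cases
    case 4
    show ?thesis
    proof (cases "\<forall>W. W \<noteq> {} \<longrightarrow> W \<subset> V \<longrightarrow> 3 \<le> card {e \<in> E. e \<inter> W \<noteq> {} \<and> e - W \<noteq> {}}")
      case True
      have "one_planar_3conn V E pos A"
      proof unfold_locales
        show "C4_free E" by (rule less.prems(2))
        show "3 \<le> card {e \<in> E. e \<inter> W \<noteq> {} \<and> e - W \<noteq> {}}" if "W \<noteq> {}" "W \<subset> V" for W
          by (rule True[rule_format, OF that])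
        show "2 \<le> card V" using 4 by simp
      qed
      then show ?thesis by (rule one_planar_3conn.edge_bound[THEN trans_le_add1])
    next
      case False
      then obtain W where W: "W \<noteq> {}" "W \<subset> V" "\<not> 3 \<le> card {e \<in> E. e \<inter> W \<noteq> {} \<and> e - W \<noteq> {}}"
        unfolding not_all not_imp by (elim exE conjE)
      let ?C = "{e \<in> E. e \<inter> W \<noteq> {} \<and> e - W \<noteq> {}}" and ?E1 = "{e \<in> E. e \<subseteq> W}" and ?E2 = "{e \<in> E. e \<subseteq> V - W}"
      have fW: "finite W" using W(2) finV finite_subset by blast
      have cs: "card V = card W + card (V - W)"
        using W(2) fW finV by (metis card_Diff_subset card_mono le_add_diff_inverse psubset_imp_subset)
      have ne: "V - W \<noteq> {}" using W(2) by blast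
      have pos: "card W \<noteq> 0" "card (V - W) \<noteq> 0" using W(1) ne fW finV by auto
      have 1: "2 * card ?E1 + 10 \<le> 5 * card W + slack (card W)"
      proof (rule less.hyps)
        show "one_planar W ?E1 pos A" by (rule one_planar_subgraph[OF less.prems(1)]) (use W in blast)
      qed (use cs pos W(1) C4_free_mono[OF less.prems(2)] in auto)
      have 2: "2 * card ?E2 + 10 \<le> 5 * card (V - W) + slack (card (V - W))"
      proof (rule less.hyps)
        show "one_planar (V - W) ?E2 pos A" by (rule one_planar_subgraph[OF less.prems(1)]) blast
      qed (use cs pos ne C4_free_mono[OF less.prems(2)] in auto)
      have "E \<subseteq> ?E1 \<union> ?E2 \<union> ?C" using edge by blast
      then have "card E \<le> card (?E1 \<union> ?E2 \<union> ?C)" using finE by (intro card_mono) auto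
      also have "\<dots> \<le> card (?E1 \<union> ?E2) + card ?C" by (rule card_Un_le)
      also have "\<dots> \<le> card ?E1 + card ?E2 + card ?C" using card_Un_le[of ?E1 ?E2] by simp
      finally have "card E \<le> card ?E1 + card ?E2 + 2" using W(3) by linarith
      \<comment> \<open>Adding the two bounds leaves 10 to spare, of which the at most two cut edges
        take 4. So slacks up to 6 fit; the extreme is \<open>5 + 1\<close>, for one vertex joined to
        three.\<close>
      moreover have "slack (card W) + slack (card (V - W)) \<le> 6"
        using pos cs 4 unfolding slack_def by auto
      ultimately show ?thesis using 1 2 cs by linarith
    qed
  \<comment> \<open>For at most three vertices \<open>slack\<close> is exactly what the complete
    graph needs.\<close>
  qed (use card_edges_le[OF graph] in \<open>simp_all add: slack_def choose_two\<close>)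
qed

text \<open>\<open>drawing\<close> lives in \<open>real \<times> real\<close>, while the Jordan
  curve theorem and Janiszewski's theorem are applied in \<open>complex\<close>.\<close>

definition to_complex :: "real \<times> real \<Rightarrow> complex" where
  "to_complex z = Complex (fst z) (snd z)"

lemma inj_to_complex: "inj to_complex"
  by (rule injI) (simp add: to_complex_def prod_eq_iff)

lemma continuous_to_complex: "continuous_on T to_complex"
proof -
  have "to_complex = (\<lambda>z. of_real (fst z) + \<i> * of_real (snd z))"
    unfolding to_complex_def by (simp add: fun_eq_iff complex_eq_iff)
  moreover have "continuous_on T (\<lambda>z. complex_of_real (fst z) + \<i> * complex_of_real (snd z))"
    by (intro continuous_intros)
  ultimately show ?thesis by metis
qed

lemma arc_to_complex:
  assumes "arc g"
  shows "arc_between (to_complex ` path_image g) (to_complex (pathstart g)) (to_complex (pathfinish g))"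
proof -
  have "path (to_complex \<circ> g)"
    by (rule path_continuous_image[OF arc_imp_path[OF assms] continuous_to_complex])
  moreover have "inj_on (to_complex \<circ> g) {0..1}"
    using assms inj_to_complex unfolding arc_def by (simp add: comp_inj_on inj_on_subset)
  ultimately have "arc (to_complex \<circ> g)" unfolding arc_def by blast
  then show ?thesis unfolding arc_between_def
    by (intro exI[of _ "to_complex \<circ> g"]) (simp add: path_image_compose pathstart_compose pathfinish_compose)
qed

lemma k_planar_one_planar:
  assumes "simple_graph V E" "k_planar 1 V E"
  obtains pos A where "one_planar V E pos A"
proof -
  obtain pos0 \<gamma> where dr: "drawing V E pos0 \<gamma>"
    and cr: "\<And>e. e \<in> E \<Longrightarrow> finite (crossings V E pos0 \<gamma> e) \<and> card (crossings V E pos0 \<gamma> e) \<le> 1"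
    using assms(2) unfolding k_planar_def by blast
  let ?pos = "to_complex \<circ> pos0" and ?A = "\<lambda>e. to_complex ` path_image (\<gamma> e)"
  have eV: "e \<subseteq> V" if "e \<in> E" for e using assms(1) that unfolding simple_graph_def by blast
  have d: "arc (\<gamma> e)" "{pathstart (\<gamma> e), pathfinish (\<gamma> e)} = pos0 ` e"
    "path_image (\<gamma> e) \<inter> pos0 ` V = pos0 ` e" if "e \<in> E" for e
    using dr that unfolding drawing_def by auto
  have "one_planar V E ?pos ?A"
  proof
    show "simple_graph V E" by (rule assms(1))
    show "inj_on ?pos V" using dr inj_to_complex unfolding drawing_def by (simp add: comp_inj_on inj_on_subset)
    show "arc_between (?A {a, b}) (?pos a) (?pos b)" if "{a, b} \<in> E" for a b
    proof -
      have "{pathstart (\<gamma> {a, b}), pathfinish (\<gamma> {a, b})} = {pos0 a, pos0 b}" using d(2)[OF that] by simp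
      then have "pathstart (\<gamma> {a, b}) = pos0 a \<and> pathfinish (\<gamma> {a, b}) = pos0 b \<or>
        pathstart (\<gamma> {a, b}) = pos0 b \<and> pathfinish (\<gamma> {a, b}) = pos0 a" by (metis doubleton_eq_iff)
      then show ?thesis using arc_to_complex[OF d(1)[OF that]] arc_between_sym by auto
    qed
    show "?A e \<inter> ?pos ` V = ?pos ` e" if "e \<in> E" for e
      using d(3)[OF that] by (metis image_Int[OF inj_to_complex] image_comp)
    show "f = g \<and> p = q" if H: "e \<in> E" "f \<in> E" "g \<in> E" "f \<noteq> e" "g \<noteq> e" "p \<in> ?A e \<inter> ?A f" "q \<in> ?A e \<inter> ?A g"
        "p \<notin> ?pos ` V" "q \<notin> ?pos ` V" for e f g p q
    proof -
      have "p \<in> to_complex ` (path_image (\<gamma> e) \<inter> path_image (\<gamma> f))"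
        "q \<in> to_complex ` (path_image (\<gamma> e) \<inter> path_image (\<gamma> g))"
        using H(6,7) by (simp_all only: image_Int[OF inj_to_complex])
      then obtain p' q' where p: "p = to_complex p'" "p' \<in> path_image (\<gamma> e) \<inter> path_image (\<gamma> f)"
        and q: "q = to_complex q'" "q' \<in> path_image (\<gamma> e) \<inter> path_image (\<gamma> g)" by blast
      have "p' \<notin> pos0 ` V" "q' \<notin> pos0 ` V" using H(8,9) p(1) q(1) by auto
      then have mem: "(f, p') \<in> crossings V E pos0 \<gamma> e" "(g, q') \<in> crossings V E pos0 \<gamma> e"
        unfolding crossings_def using H p(2) q(2) by auto
      have "\<forall>s\<in>crossings V E pos0 \<gamma> e. \<forall>t\<in>crossings V E pos0 \<gamma> e. s = t"
        using cr[OF H(1)] card_le_Suc0_iff_eq[of "crossings V E pos0 \<gamma> e"] by simp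
      then have "(f, p') = (g, q')" using mem by metis
      then show ?thesis using p(1) q(1) by simp
    qed
  qed
  then show ?thesis by (rule that)
qed

theorem theorem6:
  fixes V :: "'a set" and E :: "'a set set"
  assumes "simple_graph V E"
    and "C4_free E"
    and "k_planar 1 V E"
    and "card V \<ge> 4"
  shows "real (card E) \<le> 5 / 2 * (real (card V) - 2)"
proof -
  obtain pos A where op: "one_planar V E pos A" using k_planar_one_planar[OF assms(1,3)] by metis
  have "V \<noteq> {}" using assms(4) by auto
  then have "2 * card E + 10 \<le> 5 * card V"
    using one_planar_edge_bound[OF op assms(2)] assms(4) by (simp add: slack_def)
  then have "real (2 * card E + 10) \<le> real (5 * card V)" by (simp only: of_nat_le_iff)
  then show ?thesis by simp
qed

end
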